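(* Let $X$ be a locally compact Polish space and let $\mu$ be a random discrete measure on $X$ (a probability measure on $\mathbb M(X)$ with $\mu(\mathbb K(X))=1$) which has finite moments, with moment sequence $(M^{(n)})_{n=0}^\infty$. Assume that for each $\Lambda\in\mathcal B_c(X)$ there is a constant $C_\Lambda>0$ such that $M^{(n)}(\Lambda^n)\le C_\Lambda^n\,n!$ for all $n\in\mathbb N$. Let $\nu=\mathcal E(\mu)$ be the associated point process in $Y=X\times\mathbb R_+$. Then: (i) For each $n\in\mathbb N$ and $\Delta\in\mathcal B_c(X^{(n)}_{\widehat 0})$ there exists a unique finite measure $\xi^{(n)}_\Delta$ on $(\mathbb R_+)^n$ which solves the moment problem $$\int_{(\mathbb R_+)^n}s_1^{i_1}\cdots s_n^{i_n}\,d\xi^{(n)}_\Delta(s_1,\dots,s_n)=\frac1{n!}M_{i_1+1,\dots,i_n+1}(\Delta),\qquad (i_1,\dots,i_n)\in\mathbb Z_+^n .$$ (ii) For each $n\in\mathbb N$ there exists a unique measure $\xi^{(n)}$ on $\mathscr V_n$ which satisfies $$\xi^{(n)}_\Delta(A)=\int_{\mathscr V_n}\chi_\Delta(x_1,\dots,x_n)\,\chi_A(s_1,\dots,s_n)\,d\xi^{(n)}(x_1,s_1,\dots,x_n,s_n)$$ for all $\Delta\in\mathcal B_c(X^{(n)}_{\widehat 0})$ and $A\in\mathcal B((\mathbb R_+)^n)$. (iii) For each $n\in\mathbb N$, let $\rho^{(n)}$ be the measure on $\mathscr V_n$ given by $$d\rho^{(n)}(x_1,s_1,\dots,x_n,s_n):=(s_1\cdots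 s_n)^{-1}\,d\xi^{(n)}(x_1,s_1,\dots,x_n,s_n).$$ Then $\rho^{(n)}$ is the restriction to $\Gamma^{(n)}(Y)$ of the correlation measure $\rho$ of the point process $\nu$.
   Context: $\mathbb N=\{1,2,\dots\}$, $\mathbb Z_+=\mathbb N\cup\{0\}$, $\mathbb R_+=(0,\infty)$ with metric $|\ln(a/b)|$. $\mathcal B_c(X)$: Borel sets with compact closure. $\mathbb M(X)$: nonnegative Radon measures on $X$ with the vague topology and Borel $\sigma$-algebra. $\mathbb K(X)\subset\mathbb M(X)$: Radon measures of the form $\eta=\sum_i s_i\delta_{x_i}$, $s_i>0$, $x_i$ distinct, at most countable (possibly empty) sum. $\mu$ has finite moments if $\int\eta(A)^n\,d\mu(\eta)<\infty$ for all $n\in\mathbb N$, $A\in\mathcal B_c(X)$; then $M^{(n)}$ is the symmetric Radon measure on $X^n$ with $M^{(n)}(A_1\times\dots\times A_n)=\int\eta(A_1)\cdots\eta(A_n)\,d\mu(\eta)$, and $M^{(0)}=1$. $X^{(n)}_{\widehat 0}$: points of $X^n$ with pairwise distinct coordinates. $\mathcal B_c(X^{(n)}_{\widehat 0})$: Borel subsets of $X^{(n)}_{\widehat 0}$ whose closure in $X^n$ is compact. For $i_1,\dots,i_k\in\mathbb N$, $n=i_1+\dots+i_k$, $M_{i_1,\dots,i_k}$ is the measure on $X^{(k)}_{\widehat 0}$ with $M_{i_1,\dots,i_k}(\Delta)=M^{(n)}(\{(x_1,\dots,x_1,\dots,x_k,\dots,x_k):(x_1,\dots,x_k)\in\Delta\})$,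 where $x_l$ is repeated $i_l$ times consecutively. $Y=X\times\mathbb R_+$; $\Gamma(Y)$ is the space of locally finite subsets of $Y$ (identified with Radon measures $\sum_i\delta_{y_i}$, with the trace of the Borel $\sigma$-algebra of $\mathbb M(Y)$); a point process in $Y$ is a probability measure on $\Gamma(Y)$. $\mathcal E:\mathbb K(X)\to\Gamma(Y)$ is the measurable map $\mathcal E(\sum_i s_i\delta_{x_i})=\{(x_i,s_i)\}$, and $\mathcal E(\mu)$ is the pushforward of $\mu$. $\mathscr V_n:=\{(x_1,s_1,\dots,x_n,s_n)\in Y^n : (x_1,\dots,x_n)\in X^{(n)}_{\widehat 0}\}$. $\Gamma_0(Y)$ is the space of finite subsets of $Y$ and $\Gamma^{(n)}(Y)$ that of $n$-point subsets. The correlation measure of $\nu$ is the unique measure $\rho$ on $\Gamma_0(Y)$ with $\int_{\Gamma(Y)}\sum_{\lambda\subset\gamma,\,|\lambda|<\infty}G(\lambda)\,d\nu(\gamma)=\int_{\Gamma_0(Y)}G\,d\rho$ for all measurable $G:\Gamma_0(Y)\to[0,\infty]$. Its restriction to $\Gamma^{(n)}(Y)$ is identified with the symmetric measure $\rho^{(n)}$ on $Y^n$ (off the diagonals) satisfying $\int\sum_{\{y_1,\dots,y_n\}\subset\gamma}f(y_1,\dots,y_n)\,d\nu(\gamma)=\int f\,d\rho^{(n)}$ for all symmetric measurable $f\ge0$ (sum over unordered $n$-point subsets); it is concentrated on $\mathscr V_n$. *)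

theory Defs
  imports "HOL-Probability.Probability" "HOL-Combinatorics.Permutations"
begin

section \<open>Borel sets, Radon measures, vague topology\<close>

text \<open>
  Everything is relative to an abstract topology, since the spaces in play include
  \<open>X ^ n\<close> with \<open>n\<close> bound inside formulas and \<open>Y = X \<times> (0, \<infinity>)\<close>.
\<close>

definition borel_of :: "'a topology \<Rightarrow> 'a measure" where
  "borel_of T = sigma (topspace T) {U. openin T U}"

definition rel_compact_borel :: "'a topology \<Rightarrow> 'a set set" where
  "rel_compact_borel T = {A \<in> sets (borel_of T). compactin T (T closure_of A)}"

text \<open>Points of \<open>X ^ n\<close> are functions on \<open>{..<n}\<close>, extensional outside \<open>{..<n}\<close>.\<close>

definition power_topology :: "nat \<Rightarrow> 'a topology \<Rightarrow> (nat \<Rightarrow> 'a) topology" where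
  "power_topology n T = product_topology (\<lambda>_. T) {..<n}"

definition radon_measures :: "'a topology \<Rightarrow> 'a measure set" where
  "radon_measures T = {\<eta>. space \<eta> = topspace T \<and> sets \<eta> = sets (borel_of T) \<and>
     (\<forall>K. compactin T K \<longrightarrow> emeasure \<eta> K < \<infinity>) \<and>
     (\<forall>B\<in>sets \<eta>. emeasure \<eta> B = (SUP K\<in>{K. compactin T K \<and> K \<subseteq> B}. emeasure \<eta> K))}"

text \<open>
  The coarsest topology making \<open>\<eta> \<mapsto> \<integral> f d\<eta>\<close> continuous for every continuous \<open>f\<close> with compact support.
\<close>

definition vague_topology :: "'a topology \<Rightarrow> 'a measure topology" where
  "vague_topology T = topology_generated_by
     {{\<eta> \<in> radon_measures T. (\<integral>x. f x \<partial>\<eta>) \<in> U} | f U.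
        continuous_map T euclideanreal f \<and>
        compactin T (T closure_of {x \<in> topspace T. f x \<noteq> 0}) \<and> open U}"

text \<open>The measure \<open>\<Sum>x\<in>S. s x * \<delta>\<^sub>x\<close>.\<close>

definition weighted_dirac_sum :: "'a topology \<Rightarrow> 'a set \<Rightarrow> ('a \<Rightarrow> ennreal) \<Rightarrow> 'a measure" where
  "weighted_dirac_sum T S s = distr (point_measure S s) (borel_of T) (\<lambda>x. x)"

definition discrete_radon_measures :: "'a topology \<Rightarrow> 'a measure set" where
  "discrete_radon_measures T = {\<eta> \<in> radon_measures T. \<exists>S s. countable S \<and> S \<subseteq> topspace T \<and>
     (\<forall>x\<in>S. 0 < s x) \<and> \<eta> = weighted_dirac_sum T S (\<lambda>x. ennreal (s x))}"


section \<open>Random discrete measures and their moments\<close>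

definition random_discrete_measure :: "'a topology \<Rightarrow> 'a measure measure \<Rightarrow> bool" where
  "random_discrete_measure T \<mu> \<longleftrightarrow> prob_space \<mu> \<and>
     space \<mu> = radon_measures T \<and> sets \<mu> = sets (borel_of (vague_topology T)) \<and>
     emeasure \<mu> (discrete_radon_measures T) = 1"

definition finite_moments :: "'a topology \<Rightarrow> 'a measure measure \<Rightarrow> bool" where
  "finite_moments T \<mu> \<longleftrightarrow>
     (\<forall>n\<ge>1. \<forall>A\<in>rel_compact_borel T. (\<integral>\<^sup>+\<eta>. emeasure \<eta> A ^ n \<partial>\<mu>) < \<infinity>)"

definition symmetric_measure :: "nat \<Rightarrow> (nat \<Rightarrow> 'a) measure \<Rightarrow> bool" where
  "symmetric_measure n m \<longleftrightarrow>
     (\<forall>\<pi>. \<pi> permutes {..<n} \<longrightarrow> distr m m (\<lambda>x. \<lambda>i\<in>{..<n}. x (\<pi> i)) = m)"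

text \<open>For \<open>n = 0\<close> this is the unit mass on the one-point space \<open>X ^ 0\<close> when \<open>\<mu>\<close> is a probability.\<close>

definition is_moment_measure ::
  "'a topology \<Rightarrow> 'a measure measure \<Rightarrow> nat \<Rightarrow> (nat \<Rightarrow> 'a) measure \<Rightarrow> bool" where
  "is_moment_measure T \<mu> n m \<longleftrightarrow>
     m \<in> radon_measures (power_topology n T) \<and> symmetric_measure n m \<and>
     (\<forall>A. (\<forall>i<n. A i \<in> rel_compact_borel T) \<longrightarrow>
        emeasure m (PiE {..<n} A) = (\<integral>\<^sup>+\<eta>. (\<Prod>i<n. emeasure \<eta> (A i)) \<partial>\<mu>))"

definition off_diagonal :: "'a topology \<Rightarrow> nat \<Rightarrow> (nat \<Rightarrow> 'a) set" where
  "off_diagonal T n = {x \<in> PiE {..<n} (\<lambda>_. topspace T). inj_on x {..<n}}"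

text \<open>Relative compactness is taken in \<open>X ^ n\<close>: the closure may meet the diagonals.\<close>

definition rel_compact_off_diagonal :: "'a topology \<Rightarrow> nat \<Rightarrow> (nat \<Rightarrow> 'a) set set" where
  "rel_compact_off_diagonal T n =
     {\<Delta> \<in> rel_compact_borel (power_topology n T). \<Delta> \<subseteq> off_diagonal T n}"

text \<open>
  The point \<open>(x\<^sub>0, \<dots>, x\<^sub>0, x\<^sub>1, \<dots>, x\<^sub>1, \<dots>)\<close> in which \<open>x\<^sub>l\<close> is repeated \<open>i l\<close> times, for \<open>l < k\<close>.
\<close>

definition repeat_coords :: "nat \<Rightarrow> (nat \<Rightarrow> nat) \<Rightarrow> (nat \<Rightarrow> 'a) \<Rightarrow> (nat \<Rightarrow> 'a)" where
  "repeat_coords k i x =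
     (\<lambda>j\<in>{..<(\<Sum>l<k. i l)}. concat (map (\<lambda>l. replicate (i l) (x l)) [0..<k]) ! j)"

definition coalesced_moment ::
  "(nat \<Rightarrow> (nat \<Rightarrow> 'a) measure) \<Rightarrow> nat \<Rightarrow> (nat \<Rightarrow> nat) \<Rightarrow> (nat \<Rightarrow> 'a) set \<Rightarrow> ennreal" where
  "coalesced_moment M k i \<Delta> = emeasure (M (\<Sum>l<k. i l)) (repeat_coords k i ` \<Delta>)"


section \<open>Configurations and correlation measures\<close>

definition configurations :: "'a topology \<Rightarrow> 'a set set" where
  "configurations T = {\<gamma>. \<gamma> \<subseteq> topspace T \<and> (\<forall>K. compactin T K \<longrightarrow> finite (\<gamma> \<inter> K))}"

definition configuration_space :: "'a topology \<Rightarrow> 'a set measure" where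
  "configuration_space T = vimage_algebra (configurations T)
     (\<lambda>\<gamma>. weighted_dirac_sum T \<gamma> (\<lambda>_. 1)) (borel_of (vague_topology T))"

definition finite_configuration_space :: "'a topology \<Rightarrow> 'a set measure" where
  "finite_configuration_space T = restrict_space (configuration_space T) {\<gamma>. finite \<gamma>}"

definition n_point_configurations :: "'a topology \<Rightarrow> nat \<Rightarrow> 'a set set" where
  "n_point_configurations T n = {\<gamma> \<in> configurations T. finite \<gamma> \<and> card \<gamma> = n}"

definition is_correlation_measure :: "'a topology \<Rightarrow> 'a set measure \<Rightarrow> 'a set measure \<Rightarrow> bool" where
  "is_correlation_measure T \<nu> \<rho> \<longleftrightarrow>
     space \<rho> = space (finite_configuration_space T) \<and>
     sets \<rho> = sets (finite_configuration_space T) \<and>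
     (\<forall>G. G \<in> borel_measurable (finite_configuration_space T) \<longrightarrow>
        (\<integral>\<^sup>+\<gamma>. (\<integral>\<^sup>+\<zeta>. G \<zeta> \<partial>count_space {\<zeta>. \<zeta> \<subseteq> \<gamma> \<and> finite \<zeta>}) \<partial>\<nu>) = (\<integral>\<^sup>+\<zeta>. G \<zeta> \<partial>\<rho>))"

definition correlation_measure :: "'a topology \<Rightarrow> 'a set measure \<Rightarrow> 'a set measure" where
  "correlation_measure T \<nu> = (THE \<rho>. is_correlation_measure T \<nu> \<rho>)"

definition symmetric_function :: "'a topology \<Rightarrow> nat \<Rightarrow> ((nat \<Rightarrow> 'a) \<Rightarrow> ennreal) \<Rightarrow> bool" where
  "symmetric_function T n f \<longleftrightarrow> (\<forall>\<pi> y. \<pi> permutes {..<n} \<longrightarrow> y \<in> PiE {..<n} (\<lambda>_. topspace T) \<longrightarrow>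
     f (\<lambda>i\<in>{..<n}. y (\<pi> i)) = f y)"

definition enumeration :: "nat \<Rightarrow> 'a set \<Rightarrow> (nat \<Rightarrow> 'a)" where
  "enumeration n \<zeta> = (SOME y. y \<in> extensional {..<n} \<and> bij_betw y {..<n} \<zeta>)"

text \<open>
  A measure \<open>r\<close> on (a permutation-invariant subset of) the off-diagonal part of \<open>Y ^ n\<close> represents the
  restriction of the correlation measure of \<open>\<nu>\<close> to the \<open>n\<close>-point configurations: \<open>r\<close> is symmetric,
  forgetting the order of the points maps \<open>r\<close> to that restriction, and \<open>r\<close> integrates symmetric
  functions to the mean of their sums over unordered \<open>n\<close>-point subsets. The choice made by
  \<^const>\<open>enumeration\<close> is immaterial because \<open>f\<close> is symmetric.
\<close>

definition represents_correlation ::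
  "'a topology \<Rightarrow> 'a set measure \<Rightarrow> nat \<Rightarrow> (nat \<Rightarrow> 'a) measure \<Rightarrow> bool" where
  "represents_correlation T \<nu> n r \<longleftrightarrow>
     symmetric_measure n r \<and>
     restrict_space (correlation_measure T \<nu>) (n_point_configurations T n) =
       distr r (restrict_space (finite_configuration_space T) (n_point_configurations T n))
         (\<lambda>y. y ` {..<n}) \<and>
     (\<forall>f. f \<in> borel_measurable (borel_of (power_topology n T)) \<longrightarrow> symmetric_function T n f \<longrightarrow>
        (\<integral>\<^sup>+\<gamma>. (\<integral>\<^sup>+\<zeta>. f (enumeration n \<zeta>)
            \<partial>count_space {\<zeta>. \<zeta> \<subseteq> \<gamma> \<and> finite \<zeta> \<and> card \<zeta> = n}) \<partial>\<nu>) = (\<integral>\<^sup>+y. f y \<partial>r))"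


section \<open>The marked space \<open>Y = X \<times> (0, \<infinity>)\<close>\<close>

definition pos_top :: "real topology" where
  "pos_top = Metric_space.mtopology {0<..} (\<lambda>a b. \<bar>ln (a / b)\<bar>)"

definition marked_top :: "'a topology \<Rightarrow> ('a \<times> real) topology" where
  "marked_top T = prod_topology T pos_top"

text \<open>
  Stated through the masses of atoms; the lemma \<open>marks_weighted_dirac_sum\<close> below gives its value on
  \<open>\<Sum>x\<in>S. s x * \<delta>\<^sub>x\<close>.
\<close>

definition marks :: "'a measure \<Rightarrow> ('a \<times> real) set" where
  "marks \<eta> = {(x, s). x \<in> space \<eta> \<and> 0 < s \<and> emeasure \<eta> {x} = ennreal s}"

definition marked_point_process :: "'a topology \<Rightarrow> 'a measure measure \<Rightarrow> ('a \<times> real) set measure" where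
  "marked_point_process T \<mu> =
     distr (restrict_space \<mu> (discrete_radon_measures T)) (configuration_space (marked_top T)) marks"

definition distinct_positions :: "'a topology \<Rightarrow> nat \<Rightarrow> (nat \<Rightarrow> 'a \<times> real) set" where
  "distinct_positions T n =
     {y \<in> PiE {..<n} (\<lambda>_. topspace (marked_top T)). (\<lambda>i\<in>{..<n}. fst (y i)) \<in> off_diagonal T n}"

definition distinct_positions_space :: "'a topology \<Rightarrow> nat \<Rightarrow> (nat \<Rightarrow> 'a \<times> real) measure" where
  "distinct_positions_space T n =
     restrict_space (borel_of (power_topology n (marked_top T))) (distinct_positions T n)"


section \<open>The measures \<open>\<xi>\<close>\<close>

definition solves_moment_problem ::
  "(nat \<Rightarrow> (nat \<Rightarrow> 'a) measure) \<Rightarrow> nat \<Rightarrow> (nat \<Rightarrow> 'a) set \<Rightarrow> (nat \<Rightarrow> real) measure \<Rightarrow> bool" where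
  "solves_moment_problem M n \<Delta> \<xi> \<longleftrightarrow>
     space \<xi> = topspace (power_topology n pos_top) \<and>
     sets \<xi> = sets (borel_of (power_topology n pos_top)) \<and> finite_measure \<xi> \<and>
     (\<forall>i. (\<integral>\<^sup>+s. ennreal (\<Prod>l<n. s l ^ i l) \<partial>\<xi>) =
        ennreal (1 / fact n) * coalesced_moment M n (\<lambda>l. i l + 1) \<Delta>)"

definition xi_Delta :: "(nat \<Rightarrow> (nat \<Rightarrow> 'a) measure) \<Rightarrow> nat \<Rightarrow> (nat \<Rightarrow> 'a) set \<Rightarrow> (nat \<Rightarrow> real) measure" where
  "xi_Delta M n \<Delta> = (THE \<xi>. solves_moment_problem M n \<Delta> \<xi>)"

definition disintegrates_to_xi_Delta ::
  "'a topology \<Rightarrow> (nat \<Rightarrow> (nat \<Rightarrow> 'a) measure) \<Rightarrow> nat \<Rightarrow> (nat \<Rightarrow> 'a \<times> real) measure \<Rightarrow> bool" where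
  "disintegrates_to_xi_Delta T M n \<xi> \<longleftrightarrow>
     space \<xi> = distinct_positions T n \<and> sets \<xi> = sets (distinct_positions_space T n) \<and>
     (\<forall>\<Delta>\<in>rel_compact_off_diagonal T n. \<forall>A\<in>sets (borel_of (power_topology n pos_top)).
        emeasure (xi_Delta M n \<Delta>) A =
          (\<integral>\<^sup>+y. indicator \<Delta> (\<lambda>i\<in>{..<n}. fst (y i)) * indicator A (\<lambda>i\<in>{..<n}. snd (y i)) \<partial>\<xi>))"

definition xi :: "'a topology \<Rightarrow> (nat \<Rightarrow> (nat \<Rightarrow> 'a) measure) \<Rightarrow> nat \<Rightarrow> (nat \<Rightarrow> 'a \<times> real) measure" where
  "xi T M n = (THE \<xi>. disintegrates_to_xi_Delta T M n \<xi>)"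

definition rho :: "'a topology \<Rightarrow> (nat \<Rightarrow> (nat \<Rightarrow> 'a) measure) \<Rightarrow> nat \<Rightarrow> (nat \<Rightarrow> 'a \<times> real) measure" where
  "rho T M n = density (xi T M n) (\<lambda>y. ennreal (inverse (\<Prod>i<n. snd (y i))))"


section \<open>Sanity checks\<close>

lemma space_borel_of [simp]: "space (borel_of T) = topspace T"
  unfolding borel_of_def by (rule space_measure_of) (auto dest: openin_subset)

lemma borel_of_euclidean: "borel_of (euclidean :: 'a::topological_space topology) = borel"
  by (simp add: borel_of_def borel_def)

lemma topspace_vague_topology: "topspace (vague_topology T) = radon_measures T"
proof -
  let ?S = "{{\<eta> \<in> radon_measures T. (\<integral>x. f x \<partial>\<eta>) \<in> U} | f U.
        continuous_map T euclideanreal f \<and>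
        compactin T (T closure_of {x \<in> topspace T. f x \<noteq> 0}) \<and> open U}"
  have "radon_measures T \<in> ?S"
    by (rule CollectI, rule exI[of _ "\<lambda>_. 0"], rule exI[of _ UNIV]) auto
  then have "\<Union>?S = radon_measures T" by blast
  then show ?thesis
    unfolding vague_topology_def topology_generated_by_topspace .
qed

text \<open>The logarithmic metric induces the usual topology of the half-line.\<close>

lemma Metric_space_pos: "Metric_space {0<..} (\<lambda>a b. \<bar>ln (a / b :: real)\<bar>)"
  by unfold_locales (auto simp: ln_div)

lemma pos_top_eq: "pos_top = top_of_set {0<..}"
proof -
  interpret P: Metric_space "{0<..}" "\<lambda>a b. \<bar>ln (a / b :: real)\<bar>"
    by (rule Metric_space_pos)
  have ball: "P.mball x r = {0<..} \<inter> ln -` ball (ln x) r" if "x > 0" for x r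
    unfolding set_eq_iff P.in_mball using that by (auto simp: ln_div dist_real_def)
  have "openin pos_top U \<longleftrightarrow> openin (top_of_set {0<..}) U" for U
  proof
    assume U: "openin pos_top U"
    have "\<exists>T. open T \<and> x \<in> T \<and> T \<subseteq> U" if "x \<in> U" for x
    proof -
      obtain r where r: "r > 0" "P.mball x r \<subseteq> U" and x: "x > 0"
        using U \<open>x \<in> U\<close> unfolding pos_top_def P.openin_mtopology by (meson greaterThan_iff subsetD)
      have "open ({0<..} \<inter> ln -` ball (ln x) r)"
        by (rule continuous_open_preimage) (auto intro!: continuous_intros)
      with r x show ?thesis by (intro exI[of _ "P.mball x r"]) (auto simp: ball)
    qed
    then have "open U" by (subst open_subopen) blast
    moreover have "U \<subseteq> {0<..}"
      using U unfolding pos_top_def P.openin_mtopology by auto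
    ultimately show "openin (top_of_set {0<..}) U"
      by (simp add: openin_open_eq)
  next
    assume "openin (top_of_set {0<..}) U"
    then have U: "open U" "U \<subseteq> {0<..}" by (simp_all add: openin_open_eq)
    have "\<exists>r>0. P.mball x r \<subseteq> U" if "x \<in> U" for x
    proof -
      have x: "x > 0" using U that by auto
      have "open (exp -` U)"
        using U(1) by (intro open_vimage continuous_intros)
      moreover have "ln x \<in> exp -` U" using x that by simp
      ultimately obtain r where r: "r > 0" "ball (ln x) r \<subseteq> exp -` U"
        using open_contains_ball by blast
      have "P.mball x r \<subseteq> U"
      proof
        fix y assume "y \<in> P.mball x r"
        then have "y > 0" "ln y \<in> ball (ln x) r" by (auto simp: ball[OF x])
        with r show "y \<in> U" by (metis exp_ln subsetD vimage_eq)
      qed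
      with r show ?thesis by blast
    qed
    with U show "openin pos_top U" unfolding pos_top_def P.openin_mtopology by blast
  qed
  then show ?thesis by (simp add: topology_eq)
qed

lemma marks_weighted_dirac_sum:
  fixes s :: "'a::polish_space \<Rightarrow> real"
  assumes "\<And>x. x \<in> S \<Longrightarrow> 0 < s x"
  shows "marks (weighted_dirac_sum euclidean S (\<lambda>x. ennreal (s x))) = (\<lambda>x. (x, s x)) ` S"
proof -
  have id: "(\<lambda>x. x) \<in> measurable (point_measure S (\<lambda>x. ennreal (s x))) borel"
    by simp
  have *: "emeasure (weighted_dirac_sum euclidean S (\<lambda>x. ennreal (s x))) {x} =
      (if x \<in> S then ennreal (s x) else 0)" for x
  proof -
    have "emeasure (weighted_dirac_sum euclidean S (\<lambda>x. ennreal (s x))) {x} =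
        emeasure (point_measure S (\<lambda>x. ennreal (s x))) ({x} \<inter> S)"
      unfolding weighted_dirac_sum_def borel_of_euclidean
      by (subst emeasure_distr[OF id]) (auto simp: space_point_measure intro!: arg_cong2[where f=emeasure])
    also have "\<dots> = (if x \<in> S then ennreal (s x) else 0)"
      by (subst emeasure_point_measure_finite2) auto
    finally show ?thesis .
  qed
  show ?thesis
  proof (intro set_eqI iffI)
    fix p assume "p \<in> marks (weighted_dirac_sum euclidean S (\<lambda>x. ennreal (s x)))"
    then obtain x t where p: "p = (x, t)" "0 < t"
        "(if x \<in> S then ennreal (s x) else 0) = ennreal t"
      by (auto simp: marks_def *)
    then have "x \<in> S" by (auto split: if_splits)
    with p assms have "t = s x" by (simp add: less_imp_le)
    with p \<open>x \<in> S\<close> show "p \<in> (\<lambda>x. (x, s x)) ` S" by auto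
  next
    fix p assume "p \<in> (\<lambda>x. (x, s x)) ` S"
    then show "p \<in> marks (weighted_dirac_sum euclidean S (\<lambda>x. ennreal (s x)))"
      using assms by (auto simp: marks_def *) (simp add: weighted_dirac_sum_def)
  qed
qed

end

theory Submission
  imports Defs
begin

text \<open>
  Sum over tuples of distinct points of the random configuration \<open>marks \<eta>\<close>: averaging \<open>1 / n!\<close> times
  the counting measure on these tuples gives a measure on the tuples with distinct positions, which by
  construction represents the \<open>n\<close>-point part of the correlation measure. Multiplied by
  \<open>s\<^sub>1 \<dots> s\<^sub>n\<close> it becomes \<open>\<xi>\<close>. Since \<open>\<eta> = \<Sum> s\<^sub>i \<delta>\<close> at \<open>x\<^sub>i\<close>, integrating
  \<open>s\<^sub>1 ^ i\<^sub>1 \<dots> s\<^sub>n ^ i\<^sub>n\<close> over \<open>\<Delta>\<close> against \<open>\<xi>\<close> picks out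
  exactly those terms of the tensor power of \<open>\<eta>\<close> in which \<open>x\<^sub>l\<close> is repeated \<open>i\<^sub>l + 1\<close> times, so
  its slices solve the moment problem. The bound \<open>C ^ n n!\<close> makes the moment problem determinate:
  in one dimension the Fourier transform is determined by its Taylor expansions, whose radius of
  convergence is bounded below along the whole line, and the general case follows coordinatewise.
\<close>

section \<open>Determinacy of moment problems\<close>

text \<open>Most of the length goes into measurability. The vague Borel algebra is given by
  integrals of continuous functions, while correlation measures count points in Borel sets, and
  extracting marks needs atom masses that are measurable jointly in the measure and the point. A
  countable subbase finer than the vague topology connects the two descriptions, for
  \<open>X\<close> and for the marked space at once. Existence in the moment problem and in the
  disintegration is obtained by exhibiting slices of one explicit measure; the growth bound then
  serves uniqueness and finiteness. All estimates have the shape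
  \<open>A * C ^ p * fact (p + c)\<close>. The shift \<open>c\<close> absorbs both the
  \<open>+ 1\<close> in the multiplicities \<open>i l + 1\<close> and the powers of other
  coordinates that enter as weights. \<open>C\<close> itself never changes, and the length
  \<open>1 / (4 * C)\<close> of a Fourier step depends on nothing else. The closure of \<Delta> may
  meet the diagonals. This is harmless: the bound is only used on a cube that contains all
  repetitions of points of \<Delta>.\<close>

lemma fact_add_le: "(fact (j + b) :: real) \<le> 2 ^ (j + b) * fact j * fact b"
proof -
  have "real ((j + b) choose b) \<le> 2 ^ (j + b)"
    using binomial_le_pow2[of "j + b" b] by (metis of_nat_le_iff of_nat_numeral of_nat_power)
  moreover have "(fact (j + b) :: real) = fact b * fact j * real ((j + b) choose b)"
    using binomial_fact_lemma[of b "j + b"]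
    by (metis add_diff_cancel_right' le_add2 of_nat_fact of_nat_mult)
  ultimately show ?thesis by (simp add: mult_left_mono algebra_simps)
qed

text \<open>The moments enter as extended nonnegative integrals, whereas the Fourier argument needs
  integrable functions and real bounds. The shift \<open>c\<close> keeps this form of bound stable
  under multiplication by a fixed monomial.\<close>

lemma nn_integral_power_bound:
  fixes m :: "real measure"
  assumes "sets m = sets borel" "AE s in m. 0 \<le> s" "0 < A" "0 < C"
    and bound: "\<And>p. (\<integral>\<^sup>+s. ennreal (s ^ p) \<partial>m) \<le> ennreal (A * C ^ p * fact (p + c))"
  shows "integrable m (\<lambda>s. s ^ p)" "(\<integral>s. s ^ p \<partial>m) \<le> A * C ^ p * fact (p + c)"
proof -
  have meas [measurable]: "(\<lambda>s. s ^ p) \<in> borel_measurable m"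
    using assms(1) by (simp cong: measurable_cong_sets)
  have nonneg: "AE s in m. 0 \<le> s ^ p" using assms(2) by eventually_elim simp
  have fin: "(\<integral>\<^sup>+s. ennreal (s ^ p) \<partial>m) < \<infinity>"
    using bound[of p] by (simp add: le_less_trans)
  show int: "integrable m (\<lambda>s. s ^ p)"
    by (rule integrableI_nonneg[OF meas nonneg fin])
  have "ennreal (\<integral>s. s ^ p \<partial>m) = (\<integral>\<^sup>+s. ennreal (s ^ p) \<partial>m)"
    by (rule nn_integral_eq_integral[symmetric, OF int nonneg])
  with bound[of p] have "ennreal (\<integral>s. s ^ p \<partial>m) \<le> ennreal (A * C ^ p * fact (p + c))"
    by simp
  moreover have "0 \<le> A * C ^ p * fact (p + c)" using assms(3,4) by simp
  ultimately show "(\<integral>s. s ^ p \<partial>m) \<le> A * C ^ p * fact (p + c)"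
    by (subst (asm) ennreal_le_iff)
qed

text \<open>The exponential of \<open>\<i> * h * s\<close> is expanded and integrated termwise; this
  converges because \<open>fact j\<close> in the denominator cancels the factorial of the moment
  bound up to a geometric factor. The admissible \<open>h\<close> depend on \<open>C\<close> alone,
  neither on \<open>t\<close> nor on \<open>k\<close>.\<close>

lemma fourier_moment_sums:
  fixes m :: "real measure"
  assumes m: "sets m = sets borel" "AE s in m. 0 \<le> s" "0 < A" "0 < C"
    and bound: "\<And>p. (\<integral>\<^sup>+s. ennreal (s ^ p) \<partial>m) \<le> ennreal (A * C ^ p * fact (p + c))"
    and h: "\<bar>h\<bar> \<le> 1 / (4 * C)"
  shows "(\<lambda>j. (\<i> * of_real h) ^ j / fact j * (\<integral>s. of_real (s ^ (k + j)) * iexp (t * s) \<partial>m)) sums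
    (\<integral>s. of_real (s ^ k) * iexp ((t + h) * s) \<partial>m)"
proof -
  have [measurable_cong]: "sets m = sets borel" by (fact m(1))
  note int = nn_integral_power_bound[OF m bound]
  let ?f = "\<lambda>j s. (\<i> * of_real h) ^ j / fact j * (of_real (s ^ (k + j)) * iexp (t * s))"
  have norm_iexp: "norm (iexp x) = 1" for x by simp
  have norm_f: "norm (?f j s) = \<bar>h\<bar> ^ j / fact j * \<bar>s ^ (k + j)\<bar>" for j s
    by (simp add: norm_mult norm_divide norm_power power_abs)
  have intp: "integrable m (\<lambda>s. complex_of_real (s ^ p) * iexp (t * s))" for p
    by (rule Bochner_Integration.integrable_bound[OF int(1)[of p]]) (auto simp: norm_mult norm_power power_abs)
  have intf: "integrable m (?f j)" for j
    by (rule integrable_mult_right[OF intp])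
  have sums_f: "(\<lambda>j. ?f j s) sums (of_real (s ^ k) * iexp ((t + h) * s))" for s
  proof -
    have "(\<lambda>j. (\<i> * of_real (h * s)) ^ j /\<^sub>R fact j) sums exp (\<i> * of_real (h * s))"
      by (rule exp_converges)
    then have "(\<lambda>j. of_real (s ^ k) * iexp (t * s) * ((\<i> * of_real (h * s)) ^ j /\<^sub>R fact j)) sums
        (of_real (s ^ k) * iexp (t * s) * exp (\<i> * of_real (h * s)))"
      by (rule sums_mult)
    moreover have "of_real (s ^ k) * iexp (t * s) * ((\<i> * of_real (h * s)) ^ j /\<^sub>R fact j) = ?f j s" for j
      by (simp add: power_add power_mult_distrib scaleR_conv_of_real field_simps)
    moreover have "iexp (t * s) * exp (\<i> * of_real (h * s)) = iexp ((t + h) * s)"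
      by (simp add: exp_add[symmetric] algebra_simps)
    ultimately show ?thesis by (simp add: mult.assoc)
  qed
  have summ: "AE s in m. summable (\<lambda>j. norm (?f j s))"
  proof (rule AE_I2)
    fix s
    have "summable (\<lambda>j. \<bar>s ^ k\<bar> * (inverse (fact j) * (\<bar>h\<bar> * \<bar>s\<bar>) ^ j))"
      by (rule summable_mult[OF summable_exp])
    then show "summable (\<lambda>j. norm (?f j s))"
      unfolding norm_f by (simp add: power_add abs_mult power_abs power_mult_distrib field_simps)
  qed
  \<comment> \<open>\<open>b\<close> collects what stays fixed in the factorial as \<open>j\<close>
    grows. By \<open>fact_add_le\<close> the growing part costs a factor \<open>2 ^ j\<close>, and
    \<open>\<bar>h\<bar> \<le> 1 / (4 * C)\<close> makes the ratio
    \<open>2 * C * \<bar>h\<bar>\<close> at most one half.\<close>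
  define b where "b = k + c"
  have le: "(\<integral>s. norm (?f j s) \<partial>m) \<le> A * C ^ k * 2 ^ b * fact b * (1 / 2) ^ j" for j
  proof -
    have "(\<integral>s. \<bar>s ^ (k + j)\<bar> \<partial>m) = (\<integral>s. s ^ (k + j) \<partial>m)"
      using m(2) by (intro integral_cong_AE) auto
    also have "\<dots> \<le> A * C ^ (k + j) * fact (j + b)"
      using int(2)[of "k + j"] by (simp add: b_def add_ac)
    also have "\<dots> \<le> A * C ^ (k + j) * (2 ^ (j + b) * fact j * fact b)"
      using m(3,4) by (intro mult_left_mono fact_add_le) auto
    finally have "(\<integral>s. norm (?f j s) \<partial>m) \<le>
        \<bar>h\<bar> ^ j / fact j * (A * C ^ (k + j) * (2 ^ (j + b) * fact j * fact b))"
      unfolding norm_f integral_mult_right_zero by (rule mult_left_mono) simp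
    also have "\<dots> = A * C ^ k * 2 ^ b * fact b * (2 * C * \<bar>h\<bar>) ^ j"
      by (simp add: power_add power_mult_distrib)
    also have "\<dots> \<le> A * C ^ k * 2 ^ b * fact b * (1 / 2) ^ j"
      using h m(3,4) by (intro mult_left_mono power_mono) (auto simp: field_simps)
    finally show ?thesis .
  qed
  have "summable (\<lambda>j. \<integral>s. norm (?f j s) \<partial>m)"
  proof (rule summable_comparison_test')
    show "summable (\<lambda>j. A * C ^ k * 2 ^ b * fact b * (1 / 2 :: real) ^ j)"
      by (intro summable_mult summable_geometric) simp
    show "norm (\<integral>s. norm (?f j s) \<partial>m) \<le> A * C ^ k * 2 ^ b * fact b * (1 / 2) ^ j" for j
      using le[of j] by (simp add: integral_nonneg_AE)
  qed
  from sums_integral[OF intf summ this]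
  have "(\<lambda>j. \<integral>s. ?f j s \<partial>m) sums (\<integral>s. (\<Sum>j. ?f j s) \<partial>m)" .
  then show ?thesis
    unfolding sums_unique[OF sums_f, symmetric] integral_mult_right_zero .
qed

text \<open>
  Agreement of all the integrals of \<open>s ^ k * exp (\<i> t s)\<close> propagates from \<open>t\<close> to a neighbourhood of
  fixed size, hence from \<open>t = 0\<close> to the whole line.
\<close>

theorem moment_determinate:
  fixes m1 m2 :: "real measure"
  assumes s: "sets m1 = sets borel" "sets m2 = sets borel"
    and pos: "AE s in m1. 0 \<le> s" "AE s in m2. 0 \<le> s"
    and AC: "0 < A" "0 < C"
    and bound: "\<And>p. (\<integral>\<^sup>+s. ennreal (s ^ p) \<partial>m1) \<le> ennreal (A * C ^ p * fact (p + c))"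
    and eq: "\<And>p. (\<integral>\<^sup>+s. ennreal (s ^ p) \<partial>m1) = (\<integral>\<^sup>+s. ennreal (s ^ p) \<partial>m2)"
  shows "m1 = m2"
proof -
  have [measurable_cong]: "sets m1 = sets borel" "sets m2 = sets borel" by (fact s)+
  have sp: "space m1 = UNIV" "space m2 = UNIV" using s by (auto dest: sets_eq_imp_space_eq)
  note bound2 = bound[unfolded eq]
  let ?D = "\<lambda>m k t. \<integral>s. complex_of_real (s ^ k) * iexp (t * s) \<partial>m"
  \<comment> \<open>The step length allowed by \<open>fourier_moment_sums\<close>, common to both
    measures, all \<open>k\<close> and all base points.\<close>
  define \<epsilon> where "\<epsilon> = 1 / (4 * C)"
  have "\<epsilon> > 0" using AC by (simp add: \<epsilon>_def)
  have step: "\<forall>k. ?D m1 k (t + h) = ?D m2 k (t + h)"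
    if "\<forall>k. ?D m1 k t = ?D m2 k t" "\<bar>h\<bar> \<le> \<epsilon>" for t h
  proof
    fix k
    note h = that(2)[unfolded \<epsilon>_def]
    note s1 = fourier_moment_sums[OF s(1) pos(1) AC bound h, of k t]
    note s2 = fourier_moment_sums[OF s(2) pos(2) AC bound2 h, of k t]
    show "?D m1 k (t + h) = ?D m2 k (t + h)"
      using s1 s2 unfolding that(1)[rule_format] by (rule sums_unique2)
  qed
  \<comment> \<open>At \<open>t = 0\<close> the transforms are the moments; nonnegativity of
    \<open>s\<close> permits passing between extended and real integrals.\<close>
  have zero: "\<forall>k. ?D m1 k 0 = ?D m2 k 0"
  proof
    fix k
    have "ennreal (\<integral>s. s ^ k \<partial>m1) = (\<integral>\<^sup>+s. ennreal (s ^ k) \<partial>m1)"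
      using pos(1) by (intro nn_integral_eq_integral[symmetric] nn_integral_power_bound[OF s(1) pos(1) AC bound]) auto
    also have "\<dots> = (\<integral>\<^sup>+s. ennreal (s ^ k) \<partial>m2)" by (rule eq)
    also have "\<dots> = ennreal (\<integral>s. s ^ k \<partial>m2)"
      using pos(2) by (intro nn_integral_eq_integral nn_integral_power_bound[OF s(2) pos(2) AC bound2]) auto
    finally have "(\<integral>s. s ^ k \<partial>m1) = (\<integral>s. s ^ k \<partial>m2)"
      using pos by (subst (asm) ennreal_inj) (auto intro!: integral_nonneg_AE)
    then have "complex_of_real (\<integral>s. s ^ k \<partial>m1) = complex_of_real (\<integral>s. s ^ k \<partial>m2)" by simp
    then show "?D m1 k 0 = ?D m2 k 0"
      unfolding integral_complex_of_real[symmetric] by simp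
  qed
  have all: "\<forall>k. ?D m1 k t = ?D m2 k t" for t
  proof -
    \<comment> \<open>\<open>t\<close> is reached from 0 in \<open>n\<close> equal steps, none
      longer than \<epsilon>.\<close>
    obtain n :: nat where n: "\<bar>t\<bar> / \<epsilon> < real n" using reals_Archimedean2 by blast
    have n0: "0 < real n" using n \<open>\<epsilon> > 0\<close> by (meson abs_ge_zero divide_nonneg_pos le_less_trans)
    have h: "\<bar>t / real n\<bar> \<le> \<epsilon>" using n n0 \<open>\<epsilon> > 0\<close> by (simp add: field_simps)
    have "\<forall>k. ?D m1 k (real j * (t / real n)) = ?D m2 k (real j * (t / real n))" for j
    proof (induction j)
      case 0
      then show ?case using zero by simp
    next
      case (Suc j)
      have "real j * (t / real n) + t / real n = real (Suc j) * (t / real n)"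
        by (simp add: algebra_simps add_divide_distrib)
      with step[OF Suc h] show ?case by metis
    qed
    from this[of n] show ?thesis using n0 by simp
  qed
  have mass: "emeasure m1 UNIV = emeasure m2 UNIV" using eq[of 0] sp by simp
  have fin: "emeasure m1 UNIV < \<infinity>" using bound[of 0] sp by (simp add: le_less_trans)
  show ?thesis
  \<comment> \<open>Levy's uniqueness theorem concerns probability measures, so both measures are
    divided by their common mass \<open>a\<close>; mass zero has to be split off.\<close>
  proof (cases "emeasure m1 UNIV = 0")
    case True
    show ?thesis
    proof (rule measure_eqI)
      fix B assume "B \<in> sets m1"
      have "emeasure m1 B \<le> emeasure m1 UNIV" "emeasure m2 B \<le> emeasure m2 UNIV"
        by (auto intro!: emeasure_mono simp: s)
      with True mass show "emeasure m1 B = emeasure m2 B" by simp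
    qed (simp add: s)
  next
    case False
    define a where "a = measure m1 UNIV"
    have a1: "emeasure m1 UNIV = ennreal a"
      unfolding a_def by (rule emeasure_eq_ennreal_measure) (use fin in simp)
    have "a \<noteq> 0" using False a1 by auto
    then have "a > 0" using measure_nonneg[of m1 UNIV] unfolding a_def by linarith
    note a = a1 this
    let ?n = "\<lambda>m. density m (\<lambda>_. ennreal (1 / a))"
    have emeas: "emeasure (?n m) B = ennreal (1 / a) * emeasure m B" if "B \<in> sets borel" "sets m = sets borel" for m B
      using that by (simp add: emeasure_density_const)
    have rd: "real_distribution (?n m)" if "sets m = sets borel" "emeasure m UNIV = ennreal a" for m
    proof -
      have "space m = UNIV" using that(1) by (auto dest: sets_eq_imp_space_eq)
      have "emeasure (?n m) UNIV = ennreal (1 / a) * ennreal a"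
        using emeas[OF _ that(1), of UNIV] that(2) by simp
      also have "\<dots> = 1" using a(2) by (subst ennreal_mult[symmetric]) auto
      finally have "prob_space (?n m)"
        using \<open>space m = UNIV\<close> by (intro prob_spaceI) simp
      then show ?thesis
        using that \<open>space m = UNIV\<close> by (simp add: real_distribution_def real_distribution_axioms_def)
    qed
    have ch: "char (?n m) t = (1 / a) *\<^sub>R ?D m 0 t" if [measurable_cong]: "sets m = sets borel" for m t
      using a(2) unfolding char_def by (subst integral_density) auto
    have "?n m1 = ?n m2"
    proof (rule Levy_uniqueness)
      show "real_distribution (?n m1)" "real_distribution (?n m2)"
        using rd[OF s(1) a(1)] rd[OF s(2) a(1)[unfolded mass]] by simp_all
      have "?D m1 0 t = ?D m2 0 t" for t using all by blast
      then show "char (?n m1) = char (?n m2)"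
        by (intro ext) (simp only: ch s)
    qed
    show ?thesis
    proof (rule measure_eqI)
      fix B assume "B \<in> sets m1"
      then have B: "B \<in> sets borel" by (simp add: s)
      have "ennreal a * (ennreal (1 / a) * emeasure m B) = emeasure m B" for m
        using a(2) by (subst mult.assoc[symmetric], subst ennreal_mult[symmetric]) auto
      with emeas[OF B s(1)] emeas[OF B s(2)] \<open>?n m1 = ?n m2\<close>
      show "emeasure m1 B = emeasure m2 B" by metis
    qed (simp add: s)
  qed
qed

text \<open>
  The monomials in the coordinates are replaced by indicators one coordinate at a time; each step is the
  one-dimensional uniqueness for the image under that coordinate of a weighted measure.
\<close>

theorem multivariate_moment_determinate:
  fixes m1 m2 :: "(nat \<Rightarrow> real) measure" and A C :: real
  defines "N \<equiv> (\<lambda>n. PiM {..<n} (\<lambda>_. restrict_space borel {0<..}) :: (nat \<Rightarrow> real) measure)"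
  assumes s: "sets m1 = sets (N n)" "sets m2 = sets (N n)"
    and AC: "0 < A" "0 < C"
    and bound: "\<And>i. (\<integral>\<^sup>+s. ennreal (\<Prod>l<n. s l ^ i l) \<partial>m1) \<le>
      ennreal (A * C ^ (\<Sum>l<n. i l) * fact ((\<Sum>l<n. i l) + c))"
    and eq: "\<And>i. (\<integral>\<^sup>+s. ennreal (\<Prod>l<n. s l ^ i l) \<partial>m1) = (\<integral>\<^sup>+s. ennreal (\<Prod>l<n. s l ^ i l) \<partial>m2)"
  shows "m1 = m2"
proof -
  have [measurable_cong]: "sets m1 = sets (N n)" "sets m2 = sets (N n)" by (fact s)+
  have sp: "space m1 = PiE {..<n} (\<lambda>_. {0<..})" "space m2 = PiE {..<n} (\<lambda>_. {0<..})"
    using s[THEN sets_eq_imp_space_eq] by (auto simp: N_def space_PiM)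
  have proj [measurable]: "(\<lambda>s. s l) \<in> borel_measurable (N n)" if "l < n" for l
  proof -
    have "(\<lambda>s. s l) \<in> measurable (N n) (restrict_space borel {0<..})"
      unfolding N_def using that by simp
    then show ?thesis by (auto simp: measurable_restrict_space2_iff)
  qed
  \<comment> \<open>A hybrid test function: indicators in the coordinates below \<open>k\<close>,
    powers in the others. \<open>W 0\<close> yields the given moments, \<open>W n\<close> the
    measure of a box.\<close>
  define W where "W k B i s = (\<Prod>l<k. indicator (B l) (s l)) * (\<Prod>l\<in>{k..<n}. ennreal (s l ^ i l))"
    for k :: nat and B :: "nat \<Rightarrow> real set" and i s
  have W: "\<forall>B i. (\<forall>l. B l \<in> sets borel) \<longrightarrow> (\<integral>\<^sup>+s. W k B i s \<partial>m1) = (\<integral>\<^sup>+s. W k B i s \<partial>m2)"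
    if "k \<le> n" for k
    using that
  proof (induction k)
    case 0
    have "(\<integral>\<^sup>+s. W 0 B i s \<partial>m) = (\<integral>\<^sup>+s. ennreal (\<Prod>l<n. s l ^ i l) \<partial>m)"
      if "space m = PiE {..<n} (\<lambda>_. {0<..})" for m B i
      using that
      by (intro nn_integral_cong) (auto simp: W_def atLeast0LessThan PiE_iff intro!: prod_ennreal less_imp_le)
    then show ?case by (simp add: sp eq)
  next
    case (Suc k)
    then have k: "k < n" by simp
    show ?case
    proof (intro allI impI)
      fix B :: "nat \<Rightarrow> real set" and i assume B: "\<forall>l. B l \<in> sets borel"
      have B' [measurable]: "B l \<in> sets borel" for l using B by blast
      \<comment> \<open>The weight involves every coordinate except \<open>k\<close>. The image of
        \<open>density m w\<close> under coordinate \<open>k\<close> is then a measure on the line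
        whose moments are integrals of \<open>W k\<close> with varying exponent at
        \<open>k\<close>.\<close>
      define w where "w s = (\<Prod>l<k. indicator (B l) (s l)) * (\<Prod>l\<in>{Suc k..<n}. ennreal (s l ^ i l))" for s
      have w [measurable]: "w \<in> borel_measurable (N n)"
        unfolding w_def using k by (intro borel_measurable_times_ennreal borel_measurable_prod_ennreal) auto
      have [measurable]: "(\<lambda>s. s k) \<in> borel_measurable (N n)" using k by (rule proj)
      let ?m = "\<lambda>m. distr (density m w) borel (\<lambda>s. s k)"
      \<comment> \<open>The total degree of the later powers. It turns \<open>A\<close> into
        \<open>A * C ^ r\<close> and \<open>c\<close> into \<open>r + c\<close>, and leaves
        \<open>C\<close> alone.\<close>
      define r where "r = (\<Sum>l\<in>{Suc k..<n}. i l)"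
      have split: "{k..<n} = insert k {Suc k..<n}" using k by auto
      have splitn: "{..<n} = {..<k} \<union> insert k {Suc k..<n}" using k by auto
      have mom: "(\<integral>\<^sup>+s. ennreal (s ^ p) \<partial>?m m) = (\<integral>\<^sup>+s. W k B (i(k := p)) s \<partial>m)"
        if [measurable_cong]: "sets m = sets (N n)" for m p
        by (subst nn_integral_distr, simp, simp, subst nn_integral_density)
          (auto intro!: nn_integral_cong simp: W_def w_def split mult_ac)
      have mom_le: "(\<integral>\<^sup>+s. ennreal (s ^ p) \<partial>?m m1) \<le> ennreal (A * C ^ r * C ^ p * fact (p + (r + c)))" for p
      proof -
        \<comment> \<open>Bounding the indicators by 1 amounts to taking exponent 0 in the
          coordinates below \<open>k\<close>.\<close>
        define i' where "i' l = (if l < k then 0 else if l = k then p else i l)" for l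
        have "(\<integral>\<^sup>+s. W k B (i(k := p)) s \<partial>m1) \<le> (\<integral>\<^sup>+s. ennreal (\<Prod>l<n. s l ^ i' l) \<partial>m1)"
        proof (rule nn_integral_mono)
          fix s assume "s \<in> space m1"
          then have pos: "0 < s l" if "l < n" for l using that by (auto simp: sp PiE_iff)
          have "W k B (i(k := p)) s \<le> 1 * (\<Prod>l\<in>{k..<n}. ennreal (s l ^ (i(k := p)) l))"
            unfolding W_def by (intro mult_right_mono prod_le_1) (auto simp: indicator_def)
          also have "\<dots> = ennreal (\<Prod>l\<in>{k..<n}. s l ^ (i(k := p)) l)"
            unfolding mult_1 by (rule prod_ennreal) (auto intro!: less_imp_le zero_less_power pos simp del: zero_less_power)
          also have "(\<Prod>l\<in>{k..<n}. s l ^ (i(k := p)) l) = (\<Prod>l<n. s l ^ i' l)"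
            unfolding splitn split by (subst prod.union_disjoint) (auto simp: i'_def)
          finally show "W k B (i(k := p)) s \<le> ennreal (\<Prod>l<n. s l ^ i' l)" .
        qed
        also have "\<dots> \<le> ennreal (A * C ^ (\<Sum>l<n. i' l) * fact ((\<Sum>l<n. i' l) + c))"
          by (rule bound)
        also have "(\<Sum>l<n. i' l) = p + r"
          unfolding splitn r_def by (subst sum.union_disjoint) (auto simp: i'_def)
        finally show ?thesis by (simp add: mom s power_add mult_ac add_ac fun_upd_def)
      qed
      have ae: "AE s in ?m m. 0 \<le> s" if "sets m = sets (N n)" "space m = PiE {..<n} (\<lambda>_. {0<..})" for m
      proof (subst AE_distr_iff)
        show "(\<lambda>s. s k) \<in> borel_measurable (density m w)"
          using that(1) \<open>(\<lambda>s. s k) \<in> borel_measurable (N n)\<close> by (simp cong: measurable_cong_sets)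
        show "AE s in density m w. 0 \<le> s k"
          using k that(2) by (intro AE_I2) (auto simp: PiE_iff intro: less_imp_le)
      qed simp
      have "?m m1 = ?m m2"
      proof (rule moment_determinate[where A = "A * C ^ r" and C = C and c = "r + c"])
        show "(\<integral>\<^sup>+s. ennreal (s ^ p) \<partial>?m m1) = (\<integral>\<^sup>+s. ennreal (s ^ p) \<partial>?m m2)" for p
          using Suc.IH B k by (simp add: mom s)
      qed (use AC mom_le ae[OF s(1) sp(1)] ae[OF s(2) sp(2)] in auto)
      moreover have "emeasure (?m m) (B k) = (\<integral>\<^sup>+s. W (Suc k) B i s \<partial>m)"
        if [measurable_cong]: "sets m = sets (N n)" for m
      proof -
        have "emeasure (?m m) (B k) = (\<integral>\<^sup>+x. indicator (B k) x \<partial>?m m)" by simp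
        also have "\<dots> = (\<integral>\<^sup>+s. w s * indicator (B k) (s k) \<partial>m)"
          by (subst nn_integral_distr, simp, simp, subst nn_integral_density) auto
        also have "\<dots> = (\<integral>\<^sup>+s. W (Suc k) B i s \<partial>m)"
          by (intro nn_integral_cong) (simp add: W_def w_def mult_ac)
        finally show ?thesis .
      qed
      ultimately show "(\<integral>\<^sup>+s. W (Suc k) B i s \<partial>m1) = (\<integral>\<^sup>+s. W (Suc k) B i s \<partial>m2)"
        using s by metis
    qed
  qed
  show ?thesis
  proof (rule measure_eqI_PiM_finite)
    show "finite {..<n}" by simp
    show "sets m1 = sets (PiM {..<n} (\<lambda>_. restrict_space borel {0<..}))"
      "sets m2 = sets (PiM {..<n} (\<lambda>_. restrict_space borel {0<..}))"
      using s by (simp_all add: N_def)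
    show "emeasure m1 (PiE {..<n} B) = emeasure m2 (PiE {..<n} B)"
      if B: "\<And>l. l \<in> {..<n} \<Longrightarrow> B l \<in> sets (restrict_space borel {0<..})" for B
    proof -
      \<comment> \<open>Nothing is known about \<open>B\<close> outside \<open>{..<n}\<close>; the
        default value makes every member Borel, as the induction statement demands.\<close>
      define B' where "B' l = (if l < n then B l else {})" for l
      have sB: "B l \<in> sets borel" "B l \<subseteq> {0<..}" if "l < n" for l
        using B[of l] that by (auto simp: sets_restrict_space_iff dest: sets.sets_into_space)
      then have B': "\<forall>l. B' l \<in> sets borel" by (auto simp: B'_def)
      have E: "emeasure m (PiE {..<n} B) = (\<integral>\<^sup>+s. W n B' i s \<partial>m)"
        if m: "sets m = sets (N n)" "space m = PiE {..<n} (\<lambda>_. {0<..})" for m i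
      proof -
        have "PiE {..<n} B \<in> sets m"
          unfolding m(1) N_def using B by (intro sets_PiM_I_finite) auto
        then have "emeasure m (PiE {..<n} B) = (\<integral>\<^sup>+s. indicator (PiE {..<n} B) s \<partial>m)" by simp
        also have "\<dots> = (\<integral>\<^sup>+s. W n B' i s \<partial>m)"
        proof (rule nn_integral_cong)
          fix s assume "s \<in> space m"
          then have "s \<in> extensional {..<n}" by (simp add: m(2) PiE_iff)
          then show "indicator (PiE {..<n} B) s = W n B' i s"
            by (auto simp: W_def B'_def indicator_def PiE_iff prod_zero_iff)
        qed
        finally show ?thesis .
      qed
      show ?thesis
        using W[of n] B' by (simp add: E[OF s(1) sp(1), of "\<lambda>_. 0"] E[OF s(2) sp(2), of "\<lambda>_. 0"])
    qed
    \<comment> \<open>The total mass is finite, by the bound with all exponents 0, so a constant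
      exhaustion suffices.\<close>
    show "range (\<lambda>_::nat. PiE {..<n} (\<lambda>_. {0<..} :: real set)) \<subseteq> prod_algebra {..<n} (\<lambda>_. restrict_space borel {0<..} :: real measure)"
      using sets.top[of "restrict_space borel {0<..} :: real measure"]
      by (auto intro!: prod_algebraI_finite simp: space_restrict_space)
    show "(\<Union>_::nat. PiE {..<n} (\<lambda>_. {0<..})) = space (PiM {..<n} (\<lambda>_. restrict_space borel {0<..} :: real measure))"
      by (simp add: space_PiM)
    have "emeasure m1 (space m1) < \<infinity>"
      using le_less_trans[OF bound[of "\<lambda>_. 0"]] by (simp del: nn_integral_const add: nn_integral_const[of m1 1, simplified])
    then show "emeasure m1 (PiE {..<n} (\<lambda>_. {0<..})) \<noteq> \<infinity>" by (simp add: sp)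
  qed
qed

section \<open>The Borel algebra of the vague topology\<close>

lemma sets_borel_of: "sets (borel_of T) = sigma_sets (topspace T) {U. openin T U}"
  unfolding borel_of_def by (rule sets_measure_of) (auto dest: openin_subset)

lemma openin_borel_of: "openin T U \<Longrightarrow> U \<in> sets (borel_of T)"
  by (auto simp: sets_borel_of)

lemma sets_borel_of_top_of_set:
  "sets (borel_of (top_of_set S)) = sets (restrict_space borel S)"
proof
  have "{U. openin (top_of_set S) U} \<subseteq> sets (restrict_space borel S)"
    by (auto simp: openin_open sets_restrict_space)
  from sets.sigma_sets_subset[OF this]
  show "sets (borel_of (top_of_set S)) \<subseteq> sets (restrict_space borel S)"
    unfolding sets_borel_of space_restrict_space topspace_euclidean_subtopology space_borel Int_UNIV_right .
next
  have *: "(\<lambda>x. x) \<in> borel_measurable (borel_of (top_of_set S))"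
  proof (rule borel_measurableI)
    fix U :: "'a set" assume "open U"
    then have "openin (top_of_set S) (S \<inter> U)" by auto
    moreover have "(\<lambda>x. x) -` U \<inter> space (borel_of (top_of_set S)) = S \<inter> U" by auto
    ultimately show "(\<lambda>x. x) -` U \<inter> space (borel_of (top_of_set S)) \<in> sets (borel_of (top_of_set S))"
      by (simp add: openin_borel_of)
  qed
  show "sets (restrict_space borel S) \<subseteq> sets (borel_of (top_of_set S))"
  proof
    fix A assume "A \<in> sets (restrict_space borel S)"
    then obtain B where "B \<in> sets borel" "A = S \<inter> B" by (auto simp: sets_restrict_space)
    with measurable_sets[OF *, of B] show "A \<in> sets (borel_of (top_of_set S))"
      by (simp add: vimage_def Int_commute)
  qed
qed

text \<open>Open sets are unions of finite intersections of subbasic sets. A countable subbase has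
  only countably many finite intersections, so any such union is in fact countable.\<close>

lemma generate_topology_on_measurable:
  assumes "generate_topology_on \<C> W" "countable \<C>"
    and meas: "\<And>C. C \<in> \<C> \<Longrightarrow> g -` C \<inter> space \<Omega> \<in> sets \<Omega>"
  shows "g -` W \<inter> space \<Omega> \<in> sets \<Omega>"
proof -
  define I where "I = (\<lambda>F. \<Inter>F) ` {F. finite F \<and> F \<subseteq> \<C> \<and> F \<noteq> {}}"
  obtain \<D> where "\<D> \<subseteq> Collect (finite' intersection_of (\<lambda>C. C \<in> \<C>))" and W: "\<Union>\<D> = W"
    using assms(1) unfolding generate_topology_on_eq union_of_def by blast
  then have "\<D> \<subseteq> I"
    by (auto simp: I_def intersection_of_def image_iff subset_iff)
  with W have \<D>: "\<D> \<subseteq> I" "W = \<Union>\<D>" by simp_all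
  have "countable I"
    unfolding I_def by (rule countable_image, rule countable_subset[OF _ countable_Collect_finite_subset[OF assms(2)]]) auto
  then have "countable \<D>" using \<D>(1) countable_subset by blast
  moreover have "g -` D \<inter> space \<Omega> \<in> sets \<Omega>" if D: "D \<in> \<D>" for D
  proof -
    have "D \<in> I" using D \<D>(1) by auto
    then obtain F where F: "D = \<Inter>F" "finite F" "F \<subseteq> \<C>" "F \<noteq> {}"
      unfolding I_def by (elim imageE) simp
    then have "g -` D \<inter> space \<Omega> = (\<Inter>C\<in>F. g -` C \<inter> space \<Omega>)" by auto
    also have "\<dots> \<in> sets \<Omega>" using F meas by (intro sets.finite_INT) auto
    finally show ?thesis .
  qed
  ultimately have "(\<Union>D\<in>\<D>. g -` D \<inter> space \<Omega>) \<in> sets \<Omega>" by (intro sets.countable_UN') auto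
  also have "(\<Union>D\<in>\<D>. g -` D \<inter> space \<Omega>) = g -` W \<inter> space \<Omega>" using \<D>(2) by auto
  finally show ?thesis .
qed

text \<open>One setting for both spaces of the theorem: \<open>S = UNIV\<close> gives
  \<open>X\<close>, and \<open>S = UNIV \<times> {0<..}\<close> gives the marked space as an open
  part of a metric space.\<close>

locale lc_open =
  fixes S :: "'b::{metric_space, second_countable_topology} set"
  assumes open_S: "open S"
    and lc: "\<And>x. x \<in> S \<Longrightarrow> \<exists>U K. open U \<and> x \<in> U \<and> U \<subseteq> K \<and> compact K \<and> K \<subseteq> S"
begin

abbreviation "Bor \<equiv> borel_of (top_of_set S)"
abbreviation "Rad \<equiv> radon_measures (top_of_set S)"
abbreviation "Vag \<equiv> borel_of (vague_topology (top_of_set S))"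

lemma sets_Bor: "A \<in> sets Bor \<longleftrightarrow> A \<in> sets borel \<and> A \<subseteq> S"
  using open_S by (auto simp: sets_borel_of_top_of_set sets_restrict_space_iff)

lemma compactin_S: "compactin (top_of_set S) K \<longleftrightarrow> compact K \<and> K \<subseteq> S"
  by (simp add: compactin_subtopology)

text \<open>By Lindelof, countably many open sets with compact hull inside \<open>S\<close> cover
  \<open>S\<close>, and their finite unions increase. All Radon measures are finite on the members
  of this single exhaustion.\<close>

lemma ex_exhaustion:
  "\<exists>E::nat \<Rightarrow> 'b set. (\<forall>j. open (E j) \<and> (\<exists>K. compact K \<and> E j \<subseteq> K \<and> K \<subseteq> S)) \<and> incseq E \<and> (\<Union>j. E j) = S"
proof -
  define \<U> where "\<U> = {U. open U \<and> (\<exists>K. compact K \<and> U \<subseteq> K \<and> K \<subseteq> S)}"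
  have \<U>: "open U" "\<exists>K. compact K \<and> U \<subseteq> K \<and> K \<subseteq> S" if "U \<in> \<U>" for U
    using that by (auto simp: \<U>_def)
  obtain F where F: "F \<subseteq> \<U>" "countable F" "\<Union>F = \<Union>\<U>"
    by (rule Lindelof[of \<U>]) (auto simp: \<U>)
  have S: "\<Union>\<U> = S"
  proof (intro equalityI subsetI)
    fix x assume "x \<in> S"
    from lc[OF this] obtain U K where UK: "open U" "x \<in> U" "U \<subseteq> K" "compact K" "K \<subseteq> S"
      by metis
    then have "U \<in> \<U>" unfolding \<U>_def by (intro CollectI conjI exI[of _ K])
    then show "x \<in> \<Union>\<U>" using UK(2) by (rule UnionI)
  next
    fix x assume "x \<in> \<Union>\<U>"
    then obtain U where "x \<in> U" "U \<in> \<U>" by blast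
    with \<U>(2)[of U] show "x \<in> S" by blast
  qed
  \<comment> \<open>The empty set is added because \<open>from_nat_into\<close> enumerates only
    nonempty families, and \<open>F\<close> could be empty.\<close>
  define G where "G = from_nat_into (insert {} F)"
  have "{} \<in> \<U>" by (auto simp: \<U>_def intro!: exI[of _ "{}"])
  have rG: "range G = insert {} F" unfolding G_def using F(2) by (intro range_from_nat_into) auto
  have G: "G i \<in> \<U>" for i
  proof -
    have "G i \<in> insert {} F" unfolding rG[symmetric] by (rule rangeI)
    then show ?thesis using F(1) \<open>{} \<in> \<U>\<close> by auto
  qed
  have "\<forall>i. \<exists>K. compact K \<and> G i \<subseteq> K \<and> K \<subseteq> S" using \<U>(2)[OF G] by blast
  from choice[OF this] obtain K where K: "\<forall>i. compact (K i) \<and> G i \<subseteq> K i \<and> K i \<subseteq> S" ..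
  define E where "E j = (\<Union>i\<le>j. G i)" for j
  have "open (E j)" for j unfolding E_def using \<U>(1)[OF G] by (intro open_UN) blast
  moreover have "\<exists>K. compact K \<and> E j \<subseteq> K \<and> K \<subseteq> S" for j
  proof (intro exI conjI)
    show "compact (\<Union>i\<le>j. K i)" using K by (intro compact_UN) auto
    show "E j \<subseteq> (\<Union>i\<le>j. K i)" "(\<Union>i\<le>j. K i) \<subseteq> S" unfolding E_def using K by blast+
  qed
  moreover have "incseq E" unfolding incseq_def E_def by (intro allI impI UN_mono) auto
  moreover have "(\<Union>j. E j) = S"
  proof -
    have "(\<Union>j. E j) = \<Union>(range G)" by (auto simp: E_def)
    also have "\<dots> = S" unfolding rG using F(3) S by simp
    finally show ?thesis .
  qed
  ultimately show ?thesis by (intro exI[of _ E] conjI allI)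
qed

definition E :: "nat \<Rightarrow> 'b set" where
  "E = (SOME E. (\<forall>j. open (E j) \<and> (\<exists>K. compact K \<and> E j \<subseteq> K \<and> K \<subseteq> S)) \<and> incseq E \<and> (\<Union>j. E j) = S)"

lemma E_exhaustion:
  "(\<forall>j. open (E j) \<and> (\<exists>K. compact K \<and> E j \<subseteq> K \<and> K \<subseteq> S)) \<and> incseq E \<and> (\<Union>j. E j) = S"
  unfolding E_def by (rule someI_ex[OF ex_exhaustion])

lemmas open_E = E_exhaustion[THEN conjunct1, THEN spec, THEN conjunct1]
  and E_compact = E_exhaustion[THEN conjunct1, THEN spec, THEN conjunct2]
  and incseq_E = E_exhaustion[THEN conjunct2, THEN conjunct1]
  and UN_E = E_exhaustion[THEN conjunct2, THEN conjunct2]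

lemma E_subset: "E j \<subseteq> S" using UN_E by blast

lemma E_sets: "E j \<in> sets Bor" using open_E E_subset by (simp add: sets_Bor)

lemma compact_subset_E:
  assumes "compact K" "K \<subseteq> S" shows "\<exists>j. K \<subseteq> E j"
proof -
  obtain C where C: "finite C" "K \<subseteq> (\<Union>j\<in>C. E j)"
    by (rule compactE_image[OF assms(1), of UNIV E]) (auto simp: open_E UN_E intro: subsetD[OF assms(2)])
  have "(\<Union>j\<in>C. E j) \<subseteq> E (Max (insert 0 C))"
    using C(1) by (intro UN_least incseqD[OF incseq_E] Max_ge) auto
  with C(2) show ?thesis by blast
qed

lemma RadD:
  assumes "\<eta> \<in> Rad"
  shows "space \<eta> = S" "sets \<eta> = sets Bor" "emeasure \<eta> (E j) < \<infinity>"
    "compact K \<Longrightarrow> K \<subseteq> S \<Longrightarrow> emeasure \<eta> K < \<infinity>"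
proof -
  show sp: "space \<eta> = S" "sets \<eta> = sets Bor" using assms by (auto simp: radon_measures_def)
  show *: "emeasure \<eta> K < \<infinity>" if "compact K" "K \<subseteq> S" for K
    using assms that by (auto simp: radon_measures_def compactin_S)
  obtain K where K: "compact K" "E j \<subseteq> K" "K \<subseteq> S" using E_compact by blast
  have "emeasure \<eta> (E j) \<le> emeasure \<eta> K"
    using K by (intro emeasure_mono) (auto simp: sp sets_Bor borel_compact)
  with *[OF K(1,3)] show "emeasure \<eta> (E j) < \<infinity>" by simp
qed

lemma emeasure_E_SUP:
  assumes "sets \<eta> = sets Bor" "A \<in> sets Bor"
  shows "emeasure \<eta> A = (SUP j. emeasure \<eta> (A \<inter> E j))"
proof -
  have "A = (\<Union>j. A \<inter> E j)" using UN_E assms(2) by (auto simp: sets_Bor)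
  then have "emeasure \<eta> A = emeasure \<eta> (\<Union>j. A \<inter> E j)" by (rule arg_cong)
  also have "\<dots> = (SUP j. emeasure \<eta> (A \<inter> E j))"
    using incseq_E assms E_sets by (intro SUP_emeasure_incseq[symmetric]) (auto simp: incseq_def)
  finally show ?thesis .
qed

section \<open>Evaluations on Borel sets are measurable for the vague topology\<close>

lemma integral_vague_measurable:
  fixes f :: "'b \<Rightarrow> real"
  assumes "continuous_on S f" "compact K" "K \<subseteq> S" "\<And>x. x \<in> S \<Longrightarrow> f x \<noteq> 0 \<Longrightarrow> x \<in> K"
  shows "(\<lambda>\<eta>. \<integral>x. f x \<partial>\<eta>) \<in> borel_measurable Vag"
proof (rule borel_measurableI)
  fix U :: "real set" assume "open U"
  have "{x \<in> S. f x \<noteq> 0} \<subseteq> K" using assms(4) by blast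
  then have "closure {x \<in> S. f x \<noteq> 0} \<subseteq> K" using assms(2) by (simp add: closure_minimal compact_imp_closed)
  then have "compact (closure {x \<in> S. f x \<noteq> 0})" "closure {x \<in> S. f x \<noteq> 0} \<subseteq> S"
    using assms(2,3) by (auto intro: compact_closure[THEN iffD2] bounded_subset compact_imp_bounded
        simp: compact_eq_bounded_closed) (metis closed_closure compact_Int_closed inf.absorb2)
  then have "compactin (top_of_set S) (top_of_set S closure_of {x \<in> topspace (top_of_set S). f x \<noteq> 0})"
    by (auto simp: compactin_S closure_of_subtopology Int_absorb1 Collect_conj_eq)
  then have "{\<eta> \<in> Rad. (\<integral>x. f x \<partial>\<eta>) \<in> U} \<in> {{\<eta> \<in> Rad. (\<integral>x. f x \<partial>\<eta>) \<in> U} | f U.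
        continuous_map (top_of_set S) euclideanreal f \<and>
        compactin (top_of_set S) (top_of_set S closure_of {x \<in> topspace (top_of_set S). f x \<noteq> 0}) \<and> open U}"
    using assms(1) \<open>open U\<close> by (intro CollectI exI[of _ f] exI[of _ U]) auto
  then have "openin (vague_topology (top_of_set S)) {\<eta> \<in> Rad. (\<integral>x. f x \<partial>\<eta>) \<in> U}"
    unfolding vague_topology_def by (rule topology_generated_by_Basis)
  then have "{\<eta> \<in> Rad. (\<integral>x. f x \<partial>\<eta>) \<in> U} \<in> sets Vag"
    by (rule openin_borel_of)
  also have "{\<eta> \<in> Rad. (\<integral>x. f x \<partial>\<eta>) \<in> U} = (\<lambda>\<eta>. \<integral>x. f x \<partial>\<eta>) -` U \<inter> space Vag"
    by (auto simp: topspace_vague_topology)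
  finally show "(\<lambda>\<eta>. \<integral>x. f x \<partial>\<eta>) -` U \<inter> space Vag \<in> sets Vag" .
qed

text \<open>Truncated multiples of the distance to the complement increase to the indicator of
  \<open>U\<close>. The compact set \<open>K\<close> around \<open>U\<close> makes them admissible
  test functions, and monotone convergence does the rest.\<close>

lemma emeasure_open_vague_measurable:
  assumes "open U" "U \<subseteq> K" "compact K" "K \<subseteq> S"
  shows "(\<lambda>\<eta>. emeasure \<eta> U) \<in> borel_measurable Vag"
proof -
  \<comment> \<open>\<open>infdist\<close> to the empty set is 0, so for \<open>U = UNIV\<close> the
    general formula would give 0 instead of 1.\<close>
  define f where "f m x = (if U = UNIV then 1 else min 1 (real m * infdist x (- U)))" for m x
  have cont: "continuous_on A (f m)" for m A
    by (cases "U = UNIV") (auto simp: f_def[abs_def] intro!: continuous_intros)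
  have f01: "0 \<le> f m x" "f m x \<le> 1" for m x by (auto simp: f_def infdist_nonneg)
  have f0: "f m x = 0" if "x \<notin> U" for m x using that by (auto simp: f_def)
  have inc: "incseq (\<lambda>m x. ennreal (f m x))"
    by (auto simp: incseq_def le_fun_def f_def intro!: ennreal_leI mult_right_mono infdist_nonneg min.mono)
  have sup: "(SUP m. ennreal (f m x)) = indicator U x" for x
  proof (cases "x \<in> U")
    case True
    have "\<exists>m. f m x = 1"
    proof (cases "U = UNIV")
      case False
      then have "infdist x (- U) > 0"
        using True assms(1) by (intro infdist_pos_not_in_closed) auto
      then obtain m where "1 < real m * infdist x (- U)"
        by (rule reals_Archimedean3[THEN spec, THEN exE])
      then have "f m x = 1" by (simp add: f_def)
      then show ?thesis ..
    qed (simp add: f_def)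
    then obtain m where "f m x = 1" ..
    show ?thesis
    proof (rule antisym)
      show "(SUP m. ennreal (f m x)) \<le> indicator U x"
        using True f01(2) by (intro SUP_least) (simp add: ennreal_le_1)
      show "indicator U x \<le> (SUP m. ennreal (f m x))"
        using True \<open>f m x = 1\<close> by (intro SUP_upper2[of m]) auto
    qed
  qed (simp add: f0)
  have eq: "emeasure \<eta> U = (SUP m. ennreal (\<integral>x. f m x \<partial>\<eta>))" if "\<eta> \<in> Rad" for \<eta>
  proof -
    note R = RadD[OF that]
    have U: "U \<in> sets \<eta>" using assms by (auto simp: R sets_Bor)
    have meas: "f m \<in> borel_measurable \<eta>" for m
    proof -
      have "f m \<in> borel_measurable (restrict_space borel S)"
        using cont by (rule borel_measurable_continuous_on_restrict)
      then show ?thesis using R(2) by (simp add: sets_borel_of_top_of_set cong: measurable_cong_sets)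
    qed
    have int: "integrable \<eta> (f m)" for m
    proof (rule Bochner_Integration.integrable_bound)
      have "emeasure \<eta> U \<le> emeasure \<eta> K"
        using assms by (intro emeasure_mono) (auto simp: R sets_Bor borel_compact)
      then show "integrable \<eta> (indicator U :: 'b \<Rightarrow> real)"
        using U R(4)[OF assms(3,4)] by (intro integrable_real_indicator) auto
      show "AE x in \<eta>. norm (f m x) \<le> norm (indicator U x :: real)"
        using f01 f0 by (auto simp: indicator_def)
    qed (rule meas)
    have "emeasure \<eta> U = (\<integral>\<^sup>+x. (SUP m. ennreal (f m x)) \<partial>\<eta>)" using U by (simp add: sup)
    also have "\<dots> = (SUP m. \<integral>\<^sup>+x. ennreal (f m x) \<partial>\<eta>)"
      using meas by (intro nn_integral_monotone_convergence_SUP inc) auto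
    also have "\<dots> = (SUP m. ennreal (\<integral>x. f m x \<partial>\<eta>))"
      using int f01 by (simp add: nn_integral_eq_integral)
    finally show ?thesis .
  qed
  have "(\<lambda>\<eta>. SUP m. ennreal (\<integral>x. f m x \<partial>\<eta>)) \<in> borel_measurable Vag"
    using assms f0 by (intro borel_measurable_SUP measurable_compose[OF integral_vague_measurable[OF cont assms(3,4)]]) auto
  then show ?thesis
    by (rule measurable_cong[THEN iffD2, rotated]) (simp add: eq topspace_vague_topology)
qed

text \<open>A Dynkin argument leads from open sets to Borel sets. Everything is cut down to
  \<open>E j\<close> beforehand, since complements require the subtraction of finite masses.\<close>

theorem emeasure_vague_measurable:
  assumes "A \<in> sets Bor"
  shows "(\<lambda>\<eta>. emeasure \<eta> A) \<in> borel_measurable Vag"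
proof -
  let ?G = "{U. openin (top_of_set S) U}"
  have "(\<lambda>\<eta>. emeasure \<eta> (A \<inter> E j)) \<in> borel_measurable Vag" for j
  proof -
    obtain K where K: "compact K" "E j \<subseteq> K" "K \<subseteq> S" using E_compact by blast
    have "Int_stable ?G" by (auto simp: Int_stable_def)
    moreover have "?G \<subseteq> Pow S" by (auto dest: openin_imp_subset)
    moreover have sets_Bor': "sets Bor = sigma_sets S ?G"
      by (simp add: sets_borel_of)
    then have "A \<in> sigma_sets S ?G" using assms by simp
    ultimately show ?thesis
    proof (induction rule: sigma_sets_induct_disjoint)
      case (basic U)
      then have "open (U \<inter> E j)" using open_S open_E by (auto simp: openin_open_eq)
      then show ?case using K by (rule_tac emeasure_open_vague_measurable[of _ K]) auto
    next
      case empty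
      then show ?case by simp
    next
      case (compl A)
      have "(\<lambda>\<eta>. emeasure \<eta> (E j) - emeasure \<eta> (A \<inter> E j)) \<in> borel_measurable Vag"
        using compl emeasure_open_vague_measurable[OF open_E K(2,1,3)] by simp
      moreover have "emeasure \<eta> ((S - A) \<inter> E j) = emeasure \<eta> (E j) - emeasure \<eta> (A \<inter> E j)"
        if "\<eta> \<in> Rad" for \<eta>
      proof -
        note R = RadD[OF that]
        have "A \<inter> E j \<in> sets \<eta>" using compl(1) E_sets by (auto simp: R sets_Bor'[symmetric])
        moreover from this have "emeasure \<eta> (A \<inter> E j) \<noteq> \<infinity>"
          using R(3)[of j] emeasure_mono[of "A \<inter> E j" "E j" \<eta>] E_sets by (auto simp: R top_unique)
        moreover have "(S - A) \<inter> E j = E j - A \<inter> E j" using E_subset by auto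
        ultimately show ?thesis using E_sets by (auto simp: emeasure_Diff R)
      qed
      ultimately show ?case
        by (subst measurable_cong[of Vag]) (auto simp: topspace_vague_topology)
    next
      case (union A)
      have "(\<lambda>\<eta>. \<Sum>i. emeasure \<eta> (A i \<inter> E j)) \<in> borel_measurable Vag" using union by simp
      moreover have "emeasure \<eta> ((\<Union>i. A i) \<inter> E j) = (\<Sum>i. emeasure \<eta> (A i \<inter> E j))" if "\<eta> \<in> Rad" for \<eta>
      proof -
        note R = RadD[OF that]
        have "(\<Union>i. A i) \<inter> E j = (\<Union>i. A i \<inter> E j)" by auto
        moreover have "disjoint_family (\<lambda>i. A i \<inter> E j)"
          using union(1) by (auto simp: disjoint_family_on_def)
        moreover have "range (\<lambda>i. A i \<inter> E j) \<subseteq> sets \<eta>"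
          using union(2) E_sets by (auto simp: R sets_Bor'[symmetric])
        ultimately show ?thesis by (simp add: suminf_emeasure)
      qed
      ultimately show ?case
        by (subst measurable_cong[of Vag]) (auto simp: topspace_vague_topology)
    qed
  qed
  then have "(\<lambda>\<eta>. SUP j. emeasure \<eta> (A \<inter> E j)) \<in> borel_measurable Vag" by simp
  then show ?thesis
    by (rule measurable_cong[THEN iffD2, rotated])
      (simp add: topspace_vague_topology emeasure_E_SUP[OF RadD(2) assms])
qed

section \<open>Step functions on countably many cells\<close>

definition base :: "nat \<Rightarrow> 'b set" where
  "base = from_nat_into (SOME B. countable B \<and> topological_basis B)"

lemma base_nbhd:
  assumes "open V" "x \<in> V" shows "\<exists>n. x \<in> base n \<and> base n \<subseteq> V"
proof -
  let ?B = "SOME B::'b set set. countable B \<and> topological_basis B"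
  have B: "countable ?B" "topological_basis ?B" using countable_basis is_basis by auto
  obtain W where W: "W \<in> ?B" "x \<in> W" "W \<subseteq> V" using topological_basisE[OF B(2) assms] by metis
  from from_nat_into_surj[OF B(1) W(1)] obtain n where "from_nat_into ?B n = W" by metis
  with W have "x \<in> base n \<and> base n \<subseteq> V" by (simp add: base_def)
  then show ?thesis ..
qed

lemma open_base: "open (base n)"
proof -
  let ?B = "SOME B::'b set set. countable B \<and> topological_basis B"
  have B: "topological_basis ?B" by (rule is_basis)
  have "?B \<noteq> {}"
  proof
    assume "?B = {}"
    with topological_basisE[OF B open_UNIV UNIV_I] show False by fastforce
  qed
  then have "base n \<in> ?B" unfolding base_def by (rule from_nat_into)
  with B show ?thesis by (rule topological_basis_open)
qed

text \<open>The atoms of the finite algebra generated by \<open>base 0, ..., base m\<close>, traced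
  on \<open>E j\<close>; \<open>J\<close> is the membership pattern of an atom.\<close>

definition cell :: "nat \<Rightarrow> nat \<Rightarrow> nat set \<Rightarrow> 'b set" where
  "cell j m J = {x \<in> E j. \<forall>n\<le>m. x \<in> base n \<longleftrightarrow> n \<in> J}"

lemma cell_sets: "cell j m J \<in> sets Bor"
proof -
  define D where "D n = (if n \<in> J then base n else - base n)" for n
  have D: "D n \<in> sets borel" for n
    using open_base[of n] by (simp add: D_def borel_comp)
  have "cell j m J = E j \<inter> (\<Inter>n\<in>{..m}. D n)"
    by (auto simp: cell_def D_def split: if_splits)
  also have "\<dots> \<in> sets borel"
    by (rule sets.Int[OF borel_open[OF open_E] sets.finite_INT[OF _ _ D]]) simp_all
  finally show ?thesis
    using E_subset[of j] unfolding sets_Bor cell_def by blast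
qed

text \<open>By compactness, \<open>K\<close> is covered by finitely many basic sets on each of which
  \<open>f\<close> oscillates by less than \<open>e\<close>. Once \<open>m\<close> exceeds their
  indices, a cell that meets \<open>K\<close> lies inside one of them; on a cell that misses
  \<open>K\<close> the function vanishes.\<close>

lemma step_approximation:
  fixes f :: "'b \<Rightarrow> real"
  assumes f: "continuous_on S f" and K: "compact K" "K \<subseteq> S" "\<And>x. x \<in> S \<Longrightarrow> x \<notin> K \<Longrightarrow> f x = 0"
    and "e > 0" and j: "K \<subseteq> E j"
  shows "\<exists>m q. \<forall>x\<in>S. \<bar>f x - (\<Sum>J\<in>Pow {..m}. q J * indicator (cell j m J) x)\<bar> \<le> e * indicator (E j) x"
proof -
  have "\<exists>n. x \<in> base n \<and> base n \<subseteq> {y \<in> S. \<bar>f y - f x\<bar> < e / 2}" if "x \<in> K" for x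
  proof (rule base_nbhd)
    have "open (S \<inter> f -` ball (f x) (e / 2))"
      using f open_S by (rule continuous_open_preimage) simp
    also have "S \<inter> f -` ball (f x) (e / 2) = {y \<in> S. \<bar>f y - f x\<bar> < e / 2}"
      by (auto simp: dist_real_def abs_minus_commute)
    finally show "open {y \<in> S. \<bar>f y - f x\<bar> < e / 2}" .
    show "x \<in> {y \<in> S. \<bar>f y - f x\<bar> < e / 2}" using that K(2) \<open>e > 0\<close> by auto
  qed
  then obtain n where n: "\<And>x. x \<in> K \<Longrightarrow> x \<in> base (n x) \<and> base (n x) \<subseteq> {y \<in> S. \<bar>f y - f x\<bar> < e / 2}"
    by metis
  obtain C where C: "C \<subseteq> K" "finite C" "K \<subseteq> (\<Union>x\<in>C. base (n x))"
    by (rule compactE_image[OF K(1), of K "\<lambda>x. base (n x)"]) (use n open_base in auto)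
  define m where "m = Max (insert 0 (n ` C))"
  have nm: "n x \<le> m" if "x \<in> C" for x unfolding m_def using that C(2) by (intro Max_ge) auto
  have osc: "\<bar>f y - f z\<bar> < e" if y: "y \<in> K" "y \<in> cell j m J" "z \<in> cell j m J" for y z J
  proof -
    obtain x where x: "x \<in> C" "y \<in> base (n x)" using C(3) y(1) by blast
    then have "z \<in> base (n x)" using y(2,3) nm[OF x(1)] by (auto simp: cell_def)
    moreover have "base (n x) \<subseteq> {y \<in> S. \<bar>f y - f x\<bar> < e / 2}" using n x(1) C(1) by blast
    ultimately have "\<bar>f y - f x\<bar> < e / 2" "\<bar>f z - f x\<bar> < e / 2" using x(2) by auto
    then show ?thesis by linarith
  qed
  \<comment> \<open>\<open>osc\<close> asks for one of the points to be in \<open>K\<close>; two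
    points outside \<open>K\<close> both have value 0.\<close>
  have osc': "\<bar>f y - f z\<bar> \<le> e" if "y \<in> cell j m J" "z \<in> cell j m J" for y z J
  proof -
    have "y \<in> S" "z \<in> S" using that E_subset by (auto simp: cell_def)
    then show ?thesis
      using osc[of y J z] osc[of z J y] that K(3)[of y] K(3)[of z] \<open>e > 0\<close>
      by (cases "y \<in> K"; cases "z \<in> K") (auto simp: abs_minus_commute)
  qed
  \<comment> \<open>The value at an arbitrary point of the cell. On an empty cell the choice is
    unspecified, but there the indicator is 0.\<close>
  define q where "q J = f (SOME x. x \<in> cell j m J)" for J
  have q: "\<bar>f x - q J\<bar> \<le> e" if "x \<in> cell j m J" for x J
    unfolding q_def by (rule osc'[OF that someI[where P="\<lambda>x. x \<in> cell j m J", OF that]])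
  have "\<bar>f x - (\<Sum>J\<in>Pow {..m}. q J * indicator (cell j m J) x)\<bar> \<le> e * indicator (E j) x" if "x \<in> S" for x
  proof (cases "x \<in> E j")
    case True
    define J0 where "J0 = {n. n \<le> m \<and> x \<in> base n}"
    have eq: "x \<in> cell j m J \<longleftrightarrow> J = J0" if "J \<in> Pow {..m}" for J
      using that True unfolding cell_def J0_def by auto
    have J0: "J0 \<in> Pow {..m}" by (auto simp: J0_def)
    have "(\<Sum>J\<in>Pow {..m}. q J * indicator (cell j m J) x) = (\<Sum>J\<in>Pow {..m}. if J = J0 then q J else 0)"
      by (rule sum.cong[OF refl]) (simp add: eq indicator_def)
    also have "\<dots> = q J0" using J0 by (subst sum.delta) auto
    finally show ?thesis using q[of x J0] eq[OF J0] True by simp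
  next
    case False
    then have "x \<notin> K" "\<And>J. x \<notin> cell j m J" using j by (auto simp: cell_def)
    then show ?thesis using K(3) that False by simp
  qed
  then show ?thesis by blast
qed

definition cells :: "'b set set" where
  "cells = range E \<union> (\<lambda>(j, m, J). cell j m J) ` (UNIV \<times> UNIV \<times> {J. finite J})"

lemma countable_cells: "countable cells"
  unfolding cells_def by (intro countable_Un countable_image countable_SIGMA countable_Collect_finite) auto

lemma cells_sets: "D \<in> cells \<Longrightarrow> D \<in> sets Bor"
  by (auto simp: cells_def cell_sets E_sets)

lemma cells_finite: "\<eta> \<in> Rad \<Longrightarrow> D \<in> cells \<Longrightarrow> emeasure \<eta> D < \<infinity>"
proof -
  assume "\<eta> \<in> Rad" "D \<in> cells"
  moreover from this obtain j where "D \<subseteq> E j" by (auto simp: cells_def cell_def)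
  ultimately show ?thesis
    using emeasure_mono[of D "E j" \<eta>] RadD(3)[of \<eta> j] E_sets by (auto simp: RadD(2))
qed

text \<open>
  A countable subbase of Borel sets generating a topology finer than the vague one: this makes the
  vague Borel algebra countably generated by evaluations on sets.
\<close>

definition subbase :: "'b measure set set" where
  "subbase = (\<lambda>(D, p, q). {\<eta> \<in> Rad. of_rat p < measure \<eta> D \<and> measure \<eta> D < of_rat q}) ` (cells \<times> UNIV \<times> UNIV)"

text \<open>Rational bounds keep \<open>subbase\<close> countable; by density they still fit inside
  any interval around a given value.\<close>

lemma measure_cell_continuous:
  assumes "D \<in> cells"
  shows "continuous_map (topology_generated_by subbase) euclideanreal (\<lambda>\<eta>. measure \<eta> D)"
proof -
  let ?T = "topology_generated_by subbase"
  have sub: "openin ?T {\<eta> \<in> Rad. of_rat p < measure \<eta> D \<and> measure \<eta> D < of_rat q}" for p q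
    using assms by (intro topology_generated_by_Basis) (auto simp: subbase_def)
  have top: "topspace ?T \<subseteq> Rad" by (auto simp: subbase_def)
  have "openin ?T {\<eta> \<in> topspace ?T. measure \<eta> D \<in> U}" if "open U" for U
  proof (subst openin_subopen, intro ballI)
    fix \<eta>0 assume \<eta>0: "\<eta>0 \<in> {\<eta> \<in> topspace ?T. measure \<eta> D \<in> U}"
    then obtain e where e: "e > 0" "ball (measure \<eta>0 D) e \<subseteq> U"
      using \<open>open U\<close> open_contains_ball by blast
    obtain p where p: "measure \<eta>0 D - e < of_rat p" "of_rat p < measure \<eta>0 D"
      using of_rat_dense[of "measure \<eta>0 D - e" "measure \<eta>0 D"] e(1) by auto
    obtain q where q: "measure \<eta>0 D < of_rat q" "of_rat q < measure \<eta>0 D + e"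
      using of_rat_dense[of "measure \<eta>0 D" "measure \<eta>0 D + e"] e(1) by auto
    let ?N = "{\<eta> \<in> Rad. of_rat p < measure \<eta> D \<and> measure \<eta> D < of_rat q}"
    have "?N \<subseteq> {\<eta> \<in> topspace ?T. measure \<eta> D \<in> U}"
    proof
      fix \<eta> assume \<eta>: "\<eta> \<in> ?N"
      then have "dist (measure \<eta>0 D) (measure \<eta> D) < e" using p q by (auto simp: dist_real_def)
      then have "measure \<eta> D \<in> U" using e(2) by (auto simp: subset_iff)
      moreover have "\<eta> \<in> topspace ?T" using openin_subset[OF sub] \<eta> by blast
      ultimately show "\<eta> \<in> {\<eta> \<in> topspace ?T. measure \<eta> D \<in> U}" by simp
    qed
    moreover have "\<eta>0 \<in> ?N" using \<eta>0 top p q by auto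
    ultimately show "\<exists>N. openin ?T N \<and> \<eta>0 \<in> N \<and> N \<subseteq> {\<eta> \<in> topspace ?T. measure \<eta> D \<in> U}"
      using sub by blast
  qed
  then show ?thesis by (auto simp: continuous_map_def)
qed

lemma topspace_subbase: "topspace (topology_generated_by subbase) = Rad"
proof -
  have "E 0 \<in> cells" by (auto simp: cells_def)
  have "\<eta> \<in> \<Union>subbase" if "\<eta> \<in> Rad" for \<eta>
  proof -
    obtain p where p: "of_rat p < measure \<eta> (E 0)"
      using of_rat_dense[of "measure \<eta> (E 0) - 1" "measure \<eta> (E 0)"] by auto
    obtain q where q: "measure \<eta> (E 0) < of_rat q"
      using of_rat_dense[of "measure \<eta> (E 0)" "measure \<eta> (E 0) + 1"] by auto
    show ?thesis
      unfolding subbase_def using p q that \<open>E 0 \<in> cells\<close>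
      by (intro UnionI[OF imageI[of "(E 0, p, q)"]]) auto
  qed
  moreover have "\<Union>subbase \<subseteq> Rad" by (auto simp: subbase_def)
  ultimately show ?thesis by auto
qed

text \<open>A three-term estimate: \<open>f\<close> is replaced by a step function over cells, whose
  integral is a finite combination of continuous evaluations. The error is \<open>e\<close> times
  the mass of \<open>E j\<close>, so that mass must be bounded on a neighbourhood as well.\<close>

lemma integral_subbase_continuous:
  fixes f :: "'b \<Rightarrow> real"
  assumes f: "continuous_on S f" and K: "compact K" "K \<subseteq> S" "\<And>x. x \<in> S \<Longrightarrow> x \<notin> K \<Longrightarrow> f x = 0"
    and "open U"
  shows "openin (topology_generated_by subbase) {\<eta> \<in> Rad. (\<integral>x. f x \<partial>\<eta>) \<in> U}"
proof (subst openin_subopen, intro ballI)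
  let ?T = "topology_generated_by subbase"
  fix \<eta>0 assume \<eta>0: "\<eta>0 \<in> {\<eta> \<in> Rad. (\<integral>x. f x \<partial>\<eta>) \<in> U}"
  then obtain r where r: "r > 0" "ball (\<integral>x. f x \<partial>\<eta>0) r \<subseteq> U"
    using \<open>open U\<close> open_contains_ball by blast
  obtain j where j: "K \<subseteq> E j" using compact_subset_E[OF K(1,2)] ..
  \<comment> \<open>A bound for the mass of \<open>E j\<close> valid near \<open>\<eta>0\<close>,
    because having mass below \<open>c\<close> is an open condition. With
    \<open>e * c = r / 3\<close> each of the two approximations costs less than
    \<open>r / 3\<close>; the last third is left for the difference of the step sums.\<close>
  define c where "c = measure \<eta>0 (E j) + 1"
  have "c > 0" unfolding c_def by (simp add: add_nonneg_pos)
  define e where "e = r / (3 * c)"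
  have "e > 0" using r \<open>c > 0\<close> by (simp add: e_def)
  obtain m q where mq: "\<And>x. x \<in> S \<Longrightarrow>
      \<bar>f x - (\<Sum>J\<in>Pow {..m}. q J * indicator (cell j m J) x)\<bar> \<le> e * indicator (E j) x"
    using step_approximation[OF f K \<open>e > 0\<close> j] by blast
  let ?g = "\<lambda>x. \<Sum>J\<in>Pow {..m}. q J * indicator (cell j m J) x"
  define G where "G \<eta> = (\<Sum>J\<in>Pow {..m}. q J * measure \<eta> (cell j m J))" for \<eta>
  have cell: "cell j m J \<in> cells" if "J \<in> Pow {..m}" for J
  proof -
    have "finite J" using that by (auto intro: finite_subset[of _ "{..m}"])
    then show ?thesis unfolding cells_def by (intro UnI2 image_eqI[of _ _ "(j, m, J)"]) auto
  qed
  have "E j \<in> cells" by (auto simp: cells_def)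
  have approx: "\<bar>(\<integral>x. f x \<partial>\<eta>) - G \<eta>\<bar> \<le> e * measure \<eta> (E j)" if "\<eta> \<in> Rad" for \<eta>
  proof -
    note R = RadD[OF that]
    have int_ind: "integrable \<eta> (indicator D :: 'b \<Rightarrow> real)" if "D \<in> cells" for D
      using cells_finite[OF \<open>\<eta> \<in> Rad\<close> that] cells_sets[OF that] R(2)
      by (intro integrable_real_indicator) auto
    have int_g: "integrable \<eta> ?g"
      by (intro Bochner_Integration.integrable_sum integrable_mult_right int_ind cell)
    have f_meas: "f \<in> borel_measurable \<eta>"
    proof -
      have "f \<in> borel_measurable (restrict_space borel S)"
        using f by (rule borel_measurable_continuous_on_restrict)
      then show ?thesis using R(2) by (simp add: sets_borel_of_top_of_set cong: measurable_cong_sets)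
    qed
    have int_e: "integrable \<eta> (\<lambda>x. e * indicator (E j) x)"
      by (intro integrable_mult_right int_ind \<open>E j \<in> cells\<close>)
    have "integrable \<eta> (\<lambda>x. f x - ?g x)"
    proof (rule Bochner_Integration.integrable_bound[OF int_e])
      show "(\<lambda>x. f x - ?g x) \<in> borel_measurable \<eta>"
        using f_meas borel_measurable_integrable[OF int_g] by (rule borel_measurable_diff)
      show "AE x in \<eta>. norm (f x - ?g x) \<le> norm (e * indicator (E j) x)"
        using mq \<open>e > 0\<close> by (intro AE_I2) (auto simp: R(1) abs_mult)
    qed
    note int_d = this
    have "(\<integral>x. f x \<partial>\<eta>) - G \<eta> = (\<integral>x. f x - ?g x \<partial>\<eta>)"
    proof -
      have "integrable \<eta> (\<lambda>x. (f x - ?g x) + ?g x)" using int_d int_g by (rule Bochner_Integration.integrable_add)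
      then have "integrable \<eta> f" by simp
      then have "(\<integral>x. f x - ?g x \<partial>\<eta>) = (\<integral>x. f x \<partial>\<eta>) - (\<integral>x. ?g x \<partial>\<eta>)"
        using int_g by (rule Bochner_Integration.integral_diff)
      also have "(\<integral>x. ?g x \<partial>\<eta>) = (\<Sum>J\<in>Pow {..m}. \<integral>x. q J * indicator (cell j m J) x \<partial>\<eta>)"
        by (intro Bochner_Integration.integral_sum integrable_mult_right int_ind cell)
      also have "\<dots> = G \<eta>"
        unfolding G_def
      proof (rule sum.cong[OF refl])
        fix J assume "J \<in> Pow {..m}"
        then have "cell j m J \<subseteq> space \<eta>" using cells_sets[OF cell] by (auto simp: sets_Bor R(1))
        then show "(\<integral>x. q J * indicator (cell j m J) x \<partial>\<eta>) = q J * measure \<eta> (cell j m J)"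
          by (simp add: Int_absorb2)
      qed
      finally show ?thesis by simp
    qed
    then have "\<bar>(\<integral>x. f x \<partial>\<eta>) - G \<eta>\<bar> \<le> (\<integral>x. \<bar>f x - ?g x\<bar> \<partial>\<eta>)"
      using integral_abs_bound[of \<eta> "\<lambda>x. f x - ?g x"] by simp
    also have "\<dots> \<le> (\<integral>x. e * indicator (E j) x \<partial>\<eta>)"
      using mq by (intro integral_mono integrable_abs int_d int_e) (auto simp: R(1))
    also have "\<dots> = e * measure \<eta> (E j)"
      using E_subset[of j] by (simp add: R(1) Int_absorb2)
    finally show ?thesis .
  qed
  let ?N = "{\<eta> \<in> Rad. measure \<eta> (E j) \<in> {..<c}} \<inter> {\<eta> \<in> Rad. G \<eta> \<in> ball (G \<eta>0) (r / 3)}"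
  have "continuous_map ?T euclideanreal G"
    unfolding G_def by (intro continuous_map_sum continuous_map_real_mult measure_cell_continuous cell) auto
  then have "openin ?T ?N"
    unfolding topspace_subbase[symmetric]
    by (intro openin_Int openin_continuous_map_preimage[OF measure_cell_continuous[OF \<open>E j \<in> cells\<close>]]
        openin_continuous_map_preimage[of _ euclideanreal]) auto
  moreover have "\<eta>0 \<in> ?N" using \<eta>0 r(1) by (simp add: c_def)
  moreover have "?N \<subseteq> {\<eta> \<in> Rad. (\<integral>x. f x \<partial>\<eta>) \<in> U}"
  proof
    fix \<eta> assume \<eta>: "\<eta> \<in> ?N"
    then have "\<eta> \<in> Rad" by simp
    have "e * measure \<eta> (E j) < r / 3" "e * measure \<eta>0 (E j) < r / 3"
    proof -
      have ec: "e * c = r / 3" using \<open>c > 0\<close> by (simp add: e_def)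
      have "e * measure \<eta> (E j) < e * c" "e * measure \<eta>0 (E j) < e * c"
        using \<eta> by (intro mult_strict_left_mono \<open>e > 0\<close>; simp add: c_def)+
      then show "e * measure \<eta> (E j) < r / 3" "e * measure \<eta>0 (E j) < r / 3" by (simp_all add: ec)
    qed
    moreover have "\<bar>G \<eta>0 - G \<eta>\<bar> < r / 3" using \<eta> by (simp add: dist_real_def)
    moreover have "\<eta>0 \<in> Rad" using \<eta>0 by simp
    note approx[OF \<open>\<eta> \<in> Rad\<close>] approx[OF this]
    ultimately have "\<bar>(\<integral>x. f x \<partial>\<eta>0) - (\<integral>x. f x \<partial>\<eta>)\<bar> < r" by linarith
    then show "\<eta> \<in> {\<eta> \<in> Rad. (\<integral>x. f x \<partial>\<eta>) \<in> U}"
      using r(2) \<open>\<eta> \<in> Rad\<close> by (auto simp: dist_real_def subset_iff)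
  qed
  ultimately show "\<exists>N. openin ?T N \<and> \<eta>0 \<in> N \<and> N \<subseteq> {\<eta> \<in> Rad. (\<integral>x. f x \<partial>\<eta>) \<in> U}" by blast
qed

lemma openin_vague_imp_subbase:
  assumes "openin (vague_topology (top_of_set S)) W"
  shows "openin (topology_generated_by subbase) W"
proof (rule generate_topology_on_coarsest)
  show "istopology (openin (topology_generated_by subbase))" by (rule istopology_openin)
  show "generate_topology_on {{\<eta> \<in> Rad. (\<integral>x. f x \<partial>\<eta>) \<in> U} | f U.
        continuous_map (top_of_set S) euclideanreal f \<and>
        compactin (top_of_set S) (top_of_set S closure_of {x \<in> topspace (top_of_set S). f x \<noteq> 0}) \<and> open U} W"
    using assms unfolding vague_topology_def openin_topology_generated_by_iff .
next
  fix V assume "V \<in> {{\<eta> \<in> Rad. (\<integral>x. f x \<partial>\<eta>) \<in> U} | f U.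
        continuous_map (top_of_set S) euclideanreal f \<and>
        compactin (top_of_set S) (top_of_set S closure_of {x \<in> topspace (top_of_set S). f x \<noteq> 0}) \<and> open U}"
  then obtain f U where V: "V = {\<eta> \<in> Rad. (\<integral>x. f x \<partial>\<eta>) \<in> U}"
    and f: "continuous_map (top_of_set S) euclideanreal f" "open U"
      "compactin (top_of_set S) (top_of_set S closure_of {x \<in> topspace (top_of_set S). f x \<noteq> 0})"
    by (elim CollectE exE conjE) simp
  let ?K = "top_of_set S closure_of {x \<in> topspace (top_of_set S). f x \<noteq> 0}"
  have K: "compact ?K" "?K \<subseteq> S" using f(3) by (simp_all add: compactin_S)
  have "{x \<in> topspace (top_of_set S). f x \<noteq> 0} \<subseteq> ?K" by (rule closure_of_subset) simp
  then have "f x = 0" if "x \<in> S" "x \<notin> ?K" for x using that by (auto simp: subset_iff)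
  from integral_subbase_continuous[OF _ K this f(2)]
  show "openin (topology_generated_by subbase) V" using f(1) by (simp add: V)
qed

text \<open>The converse of \<open>emeasure_vague_measurable\<close>. Every vaguely open set is open
  for the topology of the countable \<open>subbase\<close>, hence a countable combination of events
  about the masses of cells.\<close>

theorem vague_measurableI:
  assumes Rad: "\<And>\<omega>. \<omega> \<in> space \<Omega> \<Longrightarrow> g \<omega> \<in> Rad"
    and meas: "\<And>D. D \<in> sets Bor \<Longrightarrow> (\<lambda>\<omega>. emeasure (g \<omega>) D) \<in> borel_measurable \<Omega>"
  shows "g \<in> measurable \<Omega> Vag"
  unfolding borel_of_def[of "vague_topology (top_of_set S)"]
proof (rule measurable_measure_of)
  show "{U. openin (vague_topology (top_of_set S)) U} \<subseteq> Pow (topspace (vague_topology (top_of_set S)))"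
    by (auto dest: openin_subset)
  show "g \<in> space \<Omega> \<rightarrow> topspace (vague_topology (top_of_set S))"
    using Rad by (auto simp: topspace_vague_topology)
  fix W assume "W \<in> {U. openin (vague_topology (top_of_set S)) U}"
  then have "generate_topology_on subbase W"
    using openin_vague_imp_subbase by (simp add: openin_topology_generated_by_iff)
  then show "g -` W \<inter> space \<Omega> \<in> sets \<Omega>"
  proof (rule generate_topology_on_measurable)
    show "countable subbase"
      unfolding subbase_def by (intro countable_image countable_SIGMA countable_cells) auto
    fix C assume "C \<in> subbase"
    then obtain D p q where C: "C = {\<eta> \<in> Rad. of_rat p < measure \<eta> D \<and> measure \<eta> D < of_rat q}" "D \<in> cells"
      by (auto simp: subbase_def)
    have [measurable]: "(\<lambda>\<omega>. emeasure (g \<omega>) D) \<in> borel_measurable \<Omega>"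
      by (rule meas[OF cells_sets[OF C(2)]])
    have "g -` C \<inter> space \<Omega> = {\<omega> \<in> space \<Omega>. of_rat p < enn2real (emeasure (g \<omega>) D) \<and> enn2real (emeasure (g \<omega>) D) < of_rat q}"
      using Rad by (auto simp: C(1) measure_def)
    also have "\<dots> \<in> sets \<Omega>" by measurable
    finally show "g -` C \<inter> space \<Omega> \<in> sets \<Omega>" .
  qed
qed

end

section \<open>Products, kernels and mixtures\<close>

lemma continuous_map_borel_of_measurable:
  assumes "continuous_map T1 T2 f"
  shows "f \<in> measurable (borel_of T1) (borel_of T2)"
  unfolding borel_of_def[of T2]
proof (rule measurable_measure_of)
  show "{U. openin T2 U} \<subseteq> Pow (topspace T2)" by (auto dest: openin_subset)
  show "f \<in> space (borel_of T1) \<rightarrow> topspace T2"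
    using assms by (simp add: continuous_map_def)
  fix U assume "U \<in> {U. openin T2 U}"
  then have "openin T1 {x \<in> topspace T1. f x \<in> U}" using assms by (simp add: continuous_map_def)
  also have "{x \<in> topspace T1. f x \<in> U} = f -` U \<inter> space (borel_of T1)" by auto
  finally show "f -` U \<inter> space (borel_of T1) \<in> sets (borel_of T1)" by (rule openin_borel_of)
qed

text \<open>Second countability is what matters: an open set of the product is a union of boxes with
  sides from a countable base, and there are only countably many such boxes.\<close>

lemma sets_borel_of_power_topology:
  fixes S :: "'a::second_countable_topology set"
  shows "sets (borel_of (power_topology n (top_of_set S))) = sets (PiM {..<n} (\<lambda>_. borel_of (top_of_set S)))"
    (is "sets ?B = sets ?P")
proof
  have sp: "space ?P = PiE {..<n} (\<lambda>_. S)" "space ?B = PiE {..<n} (\<lambda>_. S)"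
    by (simp_all add: space_PiM power_topology_def)
  show "sets ?P \<subseteq> sets ?B"
  proof
    fix A assume A: "A \<in> sets ?P"
    have "(\<lambda>x. x) \<in> measurable ?B ?P"
    proof (rule measurable_PiM_single)
      show "(\<lambda>x. x) \<in> space ?B \<rightarrow> (\<Pi>\<^sub>E i\<in>{..<n}. space (borel_of (top_of_set S)))"
        unfolding sp by simp
      fix A i assume A: "A \<in> sets (borel_of (top_of_set S))" "i \<in> {..<n}"
      have "(\<lambda>x. x i) \<in> measurable ?B (borel_of (top_of_set S))"
        unfolding power_topology_def
        by (intro continuous_map_borel_of_measurable continuous_map_product_projection A(2))
      from measurable_sets[OF this A(1)]
      show "{x \<in> space ?B. x i \<in> A} \<in> sets ?B" by (simp add: vimage_def Int_def conj_commute)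
    qed
    from measurable_sets[OF this A] show "A \<in> sets ?B"
      using sets.sets_into_space[OF A] unfolding sp by (simp add: Int_absorb2)
  qed
  have "{W. openin (power_topology n (top_of_set S)) W} \<subseteq> sets ?P"
  proof
    fix W assume "W \<in> {W. openin (power_topology n (top_of_set S)) W}"
    then have W: "openin (product_topology (\<lambda>_. top_of_set S) {..<n}) W" by (simp add: power_topology_def)
    obtain \<B> :: "'a set set" where \<B>: "countable \<B>" "topological_basis \<B>" using ex_countable_basis by blast
    define \<C> where "\<C> = (\<lambda>B. S \<inter> B) ` \<B>"
    define \<G> where "\<G> = PiE {..<n} ` (PiE {..<n} (\<lambda>_. \<C>))"
    have "countable \<G>" unfolding \<G>_def \<C>_def using \<B>(1) by (intro countable_image countable_PiE) auto
    have \<G>: "G \<in> sets ?P" if G: "G \<in> \<G>" for G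
    proof -
      obtain X where X: "G = PiE {..<n} X" "X \<in> PiE {..<n} (\<lambda>_. \<C>)" using G by (auto simp: \<G>_def)
      have "X i \<in> sets (borel_of (top_of_set S))" if "i \<in> {..<n}" for i
      proof -
        have "X i \<in> \<C>" using X(2) that by (rule PiE_mem)
        then obtain B where "B \<in> \<B>" "X i = S \<inter> B" by (auto simp: \<C>_def)
        moreover from this have "open B" using \<B>(2) by (simp add: topological_basis_open)
        ultimately show ?thesis by (intro openin_borel_of) auto
      qed
      then show ?thesis unfolding X(1) by (intro sets_PiM_I_finite) auto
    qed
    have "W = \<Union>{G \<in> \<G>. G \<subseteq> W}"
    proof (intro equalityI subsetI)
      fix x assume x: "x \<in> W"
      from W[unfolded openin_product_topology_alt, rule_format, OF x]
      obtain U where U: "\<forall>i\<in>{..<n}. openin (top_of_set S) (U i)" "x \<in> PiE {..<n} U" "PiE {..<n} U \<subseteq> W"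
        by (elim exE conjE) simp
      have "\<forall>i\<in>{..<n}. \<exists>C. C \<in> \<C> \<and> x i \<in> C \<and> C \<subseteq> U i"
      proof
        fix i assume i: "i \<in> {..<n}"
        then obtain V where V: "open V" "U i = S \<inter> V" using U(1) by (auto simp: openin_open)
        have "x i \<in> U i" using U(2) i by (rule PiE_mem)
        then have "x i \<in> V" using V(2) by simp
        from topological_basisE[OF \<B>(2) V(1) this] obtain B where "B \<in> \<B>" "x i \<in> B" "B \<subseteq> V" .
        then show "\<exists>C. C \<in> \<C> \<and> x i \<in> C \<and> C \<subseteq> U i"
          using V(2) \<open>x i \<in> U i\<close> by (intro exI[of _ "S \<inter> B"]) (auto simp: \<C>_def)
      qed
      from bchoice[OF this] obtain C where C: "\<forall>i\<in>{..<n}. C i \<in> \<C> \<and> x i \<in> C i \<and> C i \<subseteq> U i" ..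
      \<comment> \<open>The choice function is made extensional so that it belongs to the countable
        family indexing \<open>\<G>\<close>.\<close>
      define C' where "C' = restrict C {..<n}"
      have "PiE {..<n} C' \<in> \<G>" unfolding \<G>_def C'_def using C by (intro imageI) auto
      moreover have "PiE {..<n} C' \<subseteq> PiE {..<n} U" using C by (intro PiE_mono) (simp add: C'_def)
      moreover have "x \<in> PiE {..<n} C'" using C U(2) by (simp add: C'_def PiE_iff)
      ultimately show "x \<in> \<Union>{G \<in> \<G>. G \<subseteq> W}"
        using U(3) by (intro UnionI[of "PiE {..<n} C'"] CollectI conjI) (auto intro: order_trans)
    next
      fix x assume "x \<in> \<Union>{G \<in> \<G>. G \<subseteq> W}"
      then show "x \<in> W" by (elim UnionE CollectE conjE) (rule subsetD)
    qed
    also have "\<dots> \<in> sets ?P"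
      using \<G> \<open>countable \<G>\<close> by (intro sets.countable_Union) auto
    finally show "W \<in> sets ?P" .
  qed
  from sets.sigma_sets_subset[OF this]
  have "sigma_sets (PiE {..<n} (\<lambda>_. S)) {W. openin (power_topology n (top_of_set S)) W} \<subseteq> sets ?P"
    unfolding sp .
  moreover have "topspace (power_topology n (top_of_set S)) = PiE {..<n} (\<lambda>_. S)"
    by (simp add: power_topology_def)
  ultimately show "sets ?B \<subseteq> sets ?P" unfolding sets_borel_of by simp
qed

text \<open>The kernels here are Radon, not of bounded mass. Cutting with \<open>B j\<close> and
  dividing by a finite measurable factor gives subprobability kernels, for which measurability of
  integrals is known; the factor is then restored and \<open>j\<close> sent to infinity.\<close>

lemma nn_integral_kernel_measurable:
  assumes sets: "\<And>\<omega>. \<omega> \<in> space M \<Longrightarrow> sets (\<kappa> \<omega>) = sets N"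
    and meas: "\<And>A. A \<in> sets N \<Longrightarrow> (\<lambda>\<omega>. emeasure (\<kappa> \<omega>) A) \<in> borel_measurable M"
    and B: "\<And>j::nat. B j \<in> sets N" "incseq B" "(\<Union>j. B j) = space N"
    and fin: "\<And>\<omega> j. \<omega> \<in> space M \<Longrightarrow> emeasure (\<kappa> \<omega>) (B j) < \<infinity>"
    and f: "f \<in> borel_measurable (M \<Otimes>\<^sub>M N)"
  shows "(\<lambda>\<omega>. \<integral>\<^sup>+y. f (\<omega>, y) \<partial>\<kappa> \<omega>) \<in> borel_measurable M"
\<comment> \<open>Subprobability spaces are nonempty by definition, so the empty space is treated
  apart.\<close>
proof (cases "space N = {}")
  case True
  then have "(\<integral>\<^sup>+y. f (\<omega>, y) \<partial>\<kappa> \<omega>) = 0" if "\<omega> \<in> space M" for \<omega>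
    using sets_eq_imp_space_eq[OF sets[OF that]] by (simp add: nn_integral_empty)
  then show ?thesis by (simp cong: measurable_cong)
next
  case False
  note B(1)[measurable]
  have sp: "space (\<kappa> \<omega>) = space N" if "\<omega> \<in> space M" for \<omega>
    using sets_eq_imp_space_eq[OF sets[OF that]] .
  have fm: "(\<lambda>y. f (\<omega>, y)) \<in> borel_measurable (\<kappa> \<omega>)" if "\<omega> \<in> space M" for \<omega>
    using measurable_compose[OF measurable_Pair1'[OF that] f] sets[OF that] by (simp cong: measurable_cong_sets)
  have part: "(\<lambda>\<omega>. \<integral>\<^sup>+y. f (\<omega>, y) * indicator (B j) y \<partial>\<kappa> \<omega>) \<in> borel_measurable M" for j
  proof -
    \<comment> \<open>Adding 1 keeps the divisor away from 0 while still dominating the mass of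
      \<open>B j\<close>.\<close>
    define k where "k \<omega> = 1 + emeasure (\<kappa> \<omega>) (B j)" for \<omega>
    have k [measurable]: "k \<in> borel_measurable M" unfolding k_def using meas[OF B(1)] by simp
    define L where "L \<omega> = density (\<kappa> \<omega>) (\<lambda>y. 1 / k \<omega> * indicator (B j) y)" for \<omega>
    have k1: "k \<omega> * (1 / k \<omega>) = 1" if "\<omega> \<in> space M" for \<omega>
    proof -
      have "k \<omega> < top" using fin[OF that, of j] by (simp add: k_def)
      moreover have "k \<omega> \<noteq> 0" by (simp add: k_def)
      ultimately show ?thesis by (simp add: ennreal_times_divide)
    qed
    have eL: "emeasure (L \<omega>) A = 1 / k \<omega> * emeasure (\<kappa> \<omega>) (A \<inter> B j)" if "\<omega> \<in> space M" "A \<in> sets N" for \<omega> A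
    proof -
      have "emeasure (L \<omega>) A = (\<integral>\<^sup>+y. 1 / k \<omega> * indicator (A \<inter> B j) y \<partial>\<kappa> \<omega>)"
        unfolding L_def using that B(1)
        by (subst emeasure_density) (auto simp: sets[OF that(1)] indicator_inter_arith mult_ac cong: measurable_cong_sets)
      also have "\<dots> = 1 / k \<omega> * emeasure (\<kappa> \<omega>) (A \<inter> B j)"
        using that B(1) by (intro nn_integral_cmult_indicator) (auto simp: sets[OF that(1)])
      finally show ?thesis .
    qed
    have "L \<in> measurable M (subprob_algebra N)"
    proof (rule measurable_subprob_algebra)
      fix \<omega> assume \<omega>: "\<omega> \<in> space M"
      show "sets (L \<omega>) = sets N" by (simp add: L_def sets[OF \<omega>])
      have "emeasure (L \<omega>) (space (L \<omega>)) = 1 / k \<omega> * emeasure (\<kappa> \<omega>) (space N \<inter> B j)"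
        using eL[OF \<omega> sets.top] by (simp add: L_def sp[OF \<omega>])
      also have "\<dots> \<le> 1 / k \<omega> * k \<omega>"
        unfolding k_def using sets.sets_into_space[OF B(1), of j]
        by (intro mult_left_mono) (simp_all add: Int_absorb1)
      also have "\<dots> = 1" using k1[OF \<omega>] by (simp add: mult.commute)
      finally show "subprob_space (L \<omega>)"
        using False by (intro subprob_spaceI) (simp_all add: L_def sp[OF \<omega>])
    next
      fix A assume A: "A \<in> sets N"
      have "(\<lambda>\<omega>. 1 / k \<omega> * emeasure (\<kappa> \<omega>) (A \<inter> B j)) \<in> borel_measurable M"
        using meas[of "A \<inter> B j"] A by simp
      then show "(\<lambda>\<omega>. emeasure (L \<omega>) A) \<in> borel_measurable M"
        by (rule measurable_cong[THEN iffD2, rotated]) (rule eL[OF _ A])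
    qed
    from nn_integral_measurable_subprob_algebra2[OF _ this, of "\<lambda>\<omega> y. f (\<omega>, y)"]
    have "(\<lambda>\<omega>. k \<omega> * (\<integral>\<^sup>+y. f (\<omega>, y) \<partial>L \<omega>)) \<in> borel_measurable M" using f by simp
    moreover have "(\<integral>\<^sup>+y. f (\<omega>, y) * indicator (B j) y \<partial>\<kappa> \<omega>) = k \<omega> * (\<integral>\<^sup>+y. f (\<omega>, y) \<partial>L \<omega>)" if "\<omega> \<in> space M" for \<omega>
    proof -
      have [measurable]: "B j \<in> sets (\<kappa> \<omega>)" using sets[OF that] B(1) by simp
      note fm[OF that, measurable]
      have "(\<integral>\<^sup>+y. f (\<omega>, y) \<partial>L \<omega>) = (\<integral>\<^sup>+y. 1 / k \<omega> * (f (\<omega>, y) * indicator (B j) y) \<partial>\<kappa> \<omega>)"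
        unfolding L_def by (subst nn_integral_density) (auto simp: mult_ac)
      also have "\<dots> = 1 / k \<omega> * (\<integral>\<^sup>+y. f (\<omega>, y) * indicator (B j) y \<partial>\<kappa> \<omega>)"
        by (rule nn_integral_cmult) simp
      finally have "k \<omega> * (\<integral>\<^sup>+y. f (\<omega>, y) \<partial>L \<omega>) =
          k \<omega> * (1 / k \<omega>) * (\<integral>\<^sup>+y. f (\<omega>, y) * indicator (B j) y \<partial>\<kappa> \<omega>)"
        by (simp only: mult.assoc)
      then show ?thesis using k1[OF that] by simp
    qed
    ultimately show ?thesis by (subst measurable_cong)
  qed
  have "(\<integral>\<^sup>+y. f (\<omega>, y) \<partial>\<kappa> \<omega>) = (SUP j. \<integral>\<^sup>+y. f (\<omega>, y) * indicator (B j) y \<partial>\<kappa> \<omega>)" if "\<omega> \<in> space M" for \<omega>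
  proof -
    have [measurable]: "B j \<in> sets (\<kappa> \<omega>)" for j using sets[OF that] B(1) by simp
    note fm[OF that, measurable]
    have "(\<integral>\<^sup>+y. f (\<omega>, y) \<partial>\<kappa> \<omega>) = (\<integral>\<^sup>+y. (SUP j. f (\<omega>, y) * indicator (B j) y) \<partial>\<kappa> \<omega>)"
    proof (rule nn_integral_cong)
      fix y assume "y \<in> space (\<kappa> \<omega>)"
      then have "y \<in> (\<Union>j. B j)" by (simp only: sp[OF \<open>\<omega> \<in> space M\<close>] B(3))
      then obtain j where j: "y \<in> B j" by blast
      show "f (\<omega>, y) = (SUP j. f (\<omega>, y) * indicator (B j) y)"
      proof (rule antisym)
        show "f (\<omega>, y) \<le> (SUP j. f (\<omega>, y) * indicator (B j) y)"
          using j by (intro SUP_upper2[of j]) auto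
        show "(SUP j. f (\<omega>, y) * indicator (B j) y) \<le> f (\<omega>, y)"
          by (intro SUP_least) (auto simp: indicator_def)
      qed
    qed
    also have "\<dots> = (SUP j. \<integral>\<^sup>+y. f (\<omega>, y) * indicator (B j) y \<partial>\<kappa> \<omega>)"
    proof (rule nn_integral_monotone_convergence_SUP)
      show "incseq (\<lambda>j y. f (\<omega>, y) * indicator (B j) y)"
        using B(2) by (auto simp: incseq_def le_fun_def indicator_def)
    qed simp
    finally show ?thesis .
  qed
  moreover have "(\<lambda>\<omega>. SUP j. \<integral>\<^sup>+y. f (\<omega>, y) * indicator (B j) y \<partial>\<kappa> \<omega>) \<in> borel_measurable M"
    using part by simp
  ultimately show ?thesis by (subst measurable_cong)
qed

text \<open>The mean measure of the random measure \<kappa>. In contrast to the monadic bind of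
  subprobabilities, infinite masses are allowed, as is necessary for counting measures on infinite
  configurations.\<close>

definition mixture :: "'a measure \<Rightarrow> ('a \<Rightarrow> 'b measure) \<Rightarrow> 'b measure \<Rightarrow> 'b measure" where
  "mixture P \<kappa> N = measure_of (space N) (sets N) (\<lambda>A. \<integral>\<^sup>+\<omega>. emeasure (\<kappa> \<omega>) A \<partial>P)"

lemma sets_mixture [simp, measurable_cong]: "sets (mixture P \<kappa> N) = sets N"
  and space_mixture [simp]: "space (mixture P \<kappa> N) = space N"
  by (simp_all add: mixture_def sets.sets_measure_of_eq sets.space_measure_of_eq)

lemma emeasure_mixture:
  assumes sets: "\<And>\<omega>. \<omega> \<in> space P \<Longrightarrow> sets (\<kappa> \<omega>) = sets N"
    and meas: "\<And>A. A \<in> sets N \<Longrightarrow> (\<lambda>\<omega>. emeasure (\<kappa> \<omega>) A) \<in> borel_measurable P"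
    and "A \<in> sets N"
  shows "emeasure (mixture P \<kappa> N) A = (\<integral>\<^sup>+\<omega>. emeasure (\<kappa> \<omega>) A \<partial>P)"
proof (rule emeasure_measure_of[OF mixture_def])
  show "sets N \<subseteq> Pow (space N)" by (rule sets.space_closed)
  show "positive (sets (mixture P \<kappa> N)) (\<lambda>A. \<integral>\<^sup>+\<omega>. emeasure (\<kappa> \<omega>) A \<partial>P)"
    by (simp add: positive_def)
  show "countably_additive (sets (mixture P \<kappa> N)) (\<lambda>A. \<integral>\<^sup>+\<omega>. emeasure (\<kappa> \<omega>) A \<partial>P)"
  proof (rule countably_additiveI)
    fix A :: "nat \<Rightarrow> 'b set"
    assume A: "range A \<subseteq> sets (mixture P \<kappa> N)" "disjoint_family A"
    have "(\<Sum>i. \<integral>\<^sup>+\<omega>. emeasure (\<kappa> \<omega>) (A i) \<partial>P) = (\<integral>\<^sup>+\<omega>. (\<Sum>i. emeasure (\<kappa> \<omega>) (A i)) \<partial>P)"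
      using A(1) meas by (intro nn_integral_suminf[symmetric]) auto
    also have "\<dots> = (\<integral>\<^sup>+\<omega>. emeasure (\<kappa> \<omega>) (\<Union>i. A i) \<partial>P)"
      using A sets by (intro nn_integral_cong suminf_emeasure) auto
    finally show "(\<Sum>i. \<integral>\<^sup>+\<omega>. emeasure (\<kappa> \<omega>) (A i) \<partial>P) = (\<integral>\<^sup>+\<omega>. emeasure (\<kappa> \<omega>) (\<Union>i. A i) \<partial>P)" .
  qed
qed (use assms(3) in simp)

text \<open>Measurability of the inner integral and the value of the outer one are proved in a
  single induction on \<open>f\<close>, because the cases of scalar multiples, sums and suprema use
  the former to obtain the latter.\<close>

lemma nn_integral_mixture:
  assumes sets: "\<And>\<omega>. \<omega> \<in> space P \<Longrightarrow> sets (\<kappa> \<omega>) = sets N"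
    and meas: "\<And>A. A \<in> sets N \<Longrightarrow> (\<lambda>\<omega>. emeasure (\<kappa> \<omega>) A) \<in> borel_measurable P"
    and f: "f \<in> borel_measurable N"
  shows "(\<lambda>\<omega>. \<integral>\<^sup>+y. f y \<partial>\<kappa> \<omega>) \<in> borel_measurable P \<and>
    (\<integral>\<^sup>+y. f y \<partial>mixture P \<kappa> N) = (\<integral>\<^sup>+\<omega>. \<integral>\<^sup>+y. f y \<partial>\<kappa> \<omega> \<partial>P)"
proof -
  have m: "g \<in> borel_measurable (\<kappa> \<omega>)" if "g \<in> borel_measurable N" "\<omega> \<in> space P" for g :: "'b \<Rightarrow> ennreal" and \<omega>
    using that sets[OF that(2)] by (simp cong: measurable_cong_sets)
  have sp: "space (\<kappa> \<omega>) = space N" if "\<omega> \<in> space P" for \<omega>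
    using sets_eq_imp_space_eq[OF sets[OF that]] .
  show ?thesis
    using f
  proof (induction rule: borel_measurable_induct)
    case (cong f g)
    have *: "(\<integral>\<^sup>+y. f y \<partial>\<kappa> \<omega>) = (\<integral>\<^sup>+y. g y \<partial>\<kappa> \<omega>)" if "\<omega> \<in> space P" for \<omega>
      using cong(3) by (intro nn_integral_cong) (simp add: sp[OF that])
    have "(\<integral>\<^sup>+y. f y \<partial>mixture P \<kappa> N) = (\<integral>\<^sup>+y. g y \<partial>mixture P \<kappa> N)"
      using cong(3) by (intro nn_integral_cong) simp
    moreover have "(\<integral>\<^sup>+\<omega>. \<integral>\<^sup>+y. f y \<partial>\<kappa> \<omega> \<partial>P) = (\<integral>\<^sup>+\<omega>. \<integral>\<^sup>+y. g y \<partial>\<kappa> \<omega> \<partial>P)"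
      using * by (rule nn_integral_cong)
    moreover have "(\<lambda>\<omega>. \<integral>\<^sup>+y. f y \<partial>\<kappa> \<omega>) \<in> borel_measurable P \<longleftrightarrow> (\<lambda>\<omega>. \<integral>\<^sup>+y. g y \<partial>\<kappa> \<omega>) \<in> borel_measurable P"
      using * by (rule measurable_cong)
    ultimately show ?case using cong(4) by simp
  next
    case (set A)
    have *: "(\<integral>\<^sup>+y. indicator A y \<partial>\<kappa> \<omega>) = emeasure (\<kappa> \<omega>) A" if "\<omega> \<in> space P" for \<omega>
      using set sets[OF that] by simp
    have "(\<integral>\<^sup>+\<omega>. \<integral>\<^sup>+y. indicator A y \<partial>\<kappa> \<omega> \<partial>P) = (\<integral>\<^sup>+\<omega>. emeasure (\<kappa> \<omega>) A \<partial>P)"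
      using * by (rule nn_integral_cong)
    moreover have "(\<lambda>\<omega>. \<integral>\<^sup>+y. indicator A y \<partial>\<kappa> \<omega>) \<in> borel_measurable P"
      using meas[OF set] * by (subst measurable_cong)
    ultimately show ?case using set emeasure_mixture[OF sets meas set] by simp
  next
    case (mult u c)
    note conjunct1[OF mult(4), measurable]
    have *: "(\<integral>\<^sup>+y. c * u y \<partial>\<kappa> \<omega>) = c * (\<integral>\<^sup>+y. u y \<partial>\<kappa> \<omega>)" if "\<omega> \<in> space P" for \<omega>
      using mult(2) that by (intro nn_integral_cmult m)
    have "(\<integral>\<^sup>+\<omega>. \<integral>\<^sup>+y. c * u y \<partial>\<kappa> \<omega> \<partial>P) = (\<integral>\<^sup>+\<omega>. c * (\<integral>\<^sup>+y. u y \<partial>\<kappa> \<omega>) \<partial>P)"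
      using * by (rule nn_integral_cong)
    also have "\<dots> = c * (\<integral>\<^sup>+\<omega>. \<integral>\<^sup>+y. u y \<partial>\<kappa> \<omega> \<partial>P)"
      by (intro nn_integral_cmult) measurable
    moreover have "(\<lambda>\<omega>. c * (\<integral>\<^sup>+y. u y \<partial>\<kappa> \<omega>)) \<in> borel_measurable P" by measurable
    then have "(\<lambda>\<omega>. \<integral>\<^sup>+y. c * u y \<partial>\<kappa> \<omega>) \<in> borel_measurable P"
      using * by (subst measurable_cong)
    ultimately show ?case using mult(2,4) by (simp add: nn_integral_cmult)
  next
    case (add u v)
    note conjunct1[OF add(6), measurable] conjunct1[OF add(7), measurable]
    have *: "(\<integral>\<^sup>+y. v y + u y \<partial>\<kappa> \<omega>) = (\<integral>\<^sup>+y. v y \<partial>\<kappa> \<omega>) + (\<integral>\<^sup>+y. u y \<partial>\<kappa> \<omega>)" if "\<omega> \<in> space P" for \<omega>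
      using add(1,3) that by (intro nn_integral_add m)
    have "(\<integral>\<^sup>+\<omega>. \<integral>\<^sup>+y. v y + u y \<partial>\<kappa> \<omega> \<partial>P) = (\<integral>\<^sup>+\<omega>. (\<integral>\<^sup>+y. v y \<partial>\<kappa> \<omega>) + (\<integral>\<^sup>+y. u y \<partial>\<kappa> \<omega>) \<partial>P)"
      using * by (rule nn_integral_cong)
    also have "\<dots> = (\<integral>\<^sup>+\<omega>. \<integral>\<^sup>+y. v y \<partial>\<kappa> \<omega> \<partial>P) + (\<integral>\<^sup>+\<omega>. \<integral>\<^sup>+y. u y \<partial>\<kappa> \<omega> \<partial>P)"
      by (intro nn_integral_add) measurable
    moreover have "(\<lambda>\<omega>. (\<integral>\<^sup>+y. v y \<partial>\<kappa> \<omega>) + (\<integral>\<^sup>+y. u y \<partial>\<kappa> \<omega>)) \<in> borel_measurable P" by measurable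
    then have "(\<lambda>\<omega>. \<integral>\<^sup>+y. v y + u y \<partial>\<kappa> \<omega>) \<in> borel_measurable P"
      using * by (subst measurable_cong)
    ultimately show ?case using add.IH add(1,3) by (simp add: nn_integral_add)
  next
    case (seq U)
    have IH [measurable]: "(\<lambda>\<omega>. \<integral>\<^sup>+y. U i y \<partial>\<kappa> \<omega>) \<in> borel_measurable P" for i
      using seq(5) by blast
    have *: "(\<integral>\<^sup>+y. (SUP i. U i) y \<partial>\<kappa> \<omega>) = (SUP i. \<integral>\<^sup>+y. U i y \<partial>\<kappa> \<omega>)" if "\<omega> \<in> space P" for \<omega>
      unfolding SUP_apply using seq(1,3) that by (intro nn_integral_monotone_convergence_SUP m)
    have "(\<integral>\<^sup>+\<omega>. \<integral>\<^sup>+y. (SUP i. U i) y \<partial>\<kappa> \<omega> \<partial>P) = (\<integral>\<^sup>+\<omega>. (SUP i. \<integral>\<^sup>+y. U i y \<partial>\<kappa> \<omega>) \<partial>P)"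
      using * by (rule nn_integral_cong)
    also have "\<dots> = (SUP i. \<integral>\<^sup>+\<omega>. \<integral>\<^sup>+y. U i y \<partial>\<kappa> \<omega> \<partial>P)"
      using seq(3)
      by (intro nn_integral_monotone_convergence_SUP IH) (auto simp: incseq_def le_fun_def intro!: nn_integral_mono)
    moreover have "(\<lambda>\<omega>. SUP i. \<integral>\<^sup>+y. U i y \<partial>\<kappa> \<omega>) \<in> borel_measurable P" by measurable
    then have "(\<lambda>\<omega>. \<integral>\<^sup>+y. (SUP i. U i) y \<partial>\<kappa> \<omega>) \<in> borel_measurable P"
      using * by (subst measurable_cong)
    moreover have "(\<integral>\<^sup>+y. (SUP i. U i) y \<partial>mixture P \<kappa> N) = (SUP i. \<integral>\<^sup>+y. U i y \<partial>mixture P \<kappa> N)"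
      unfolding SUP_apply using seq(1,3) by (intro nn_integral_monotone_convergence_SUP) auto
    ultimately show ?case using seq.IH by simp
  qed
qed

section \<open>Configurations and tuples of their points\<close>

text \<open>The measure with a unit mass at each point of \<open>Z\<close>. As an image of
  \<open>count_space Z\<close> it makes sense even if \<open>Z\<close> is not a measurable set of
  \<open>N\<close>.\<close>

definition counting :: "'a set \<Rightarrow> 'a measure \<Rightarrow> 'a measure" where
  "counting Z N = distr (count_space Z) N (\<lambda>x. x)"

lemma sets_counting [simp, measurable_cong]: "sets (counting Z N) = sets N"
  and space_counting [simp]: "space (counting Z N) = space N"
  by (simp_all add: counting_def)

lemma nn_integral_counting:
  assumes "Z \<subseteq> space N" "f \<in> borel_measurable N"
  shows "(\<integral>\<^sup>+x. f x \<partial>counting Z N) = (\<integral>\<^sup>+x. f x \<partial>count_space Z)"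
  unfolding counting_def using assms by (subst nn_integral_distr) (auto simp: measurable_count_space_eq1)

lemma emeasure_counting:
  assumes "Z \<subseteq> space N" "A \<in> sets N"
  shows "emeasure (counting Z N) A = emeasure (count_space Z) (A \<inter> Z)"
  unfolding counting_def using assms
  by (subst emeasure_distr) (auto simp: measurable_count_space_eq1)

lemma weighted_dirac_sum_1: "weighted_dirac_sum T \<gamma> (\<lambda>_. 1) = counting \<gamma> (borel_of T)"
proof -
  have "point_measure \<gamma> (\<lambda>_. 1) = count_space \<gamma>"
    unfolding point_measure_def by (rule density_1)
  then show ?thesis by (simp add: weighted_dirac_sum_def counting_def)
qed

lemma configurations_subset: "\<gamma> \<in> configurations T \<Longrightarrow> \<zeta> \<subseteq> \<gamma> \<Longrightarrow> \<zeta> \<in> configurations T"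
  unfolding configurations_def by (auto intro: finite_subset[of "\<zeta> \<inter> _" "\<gamma> \<inter> _"])

lemma finite_configuration: "\<zeta> \<subseteq> topspace T \<Longrightarrow> finite \<zeta> \<Longrightarrow> \<zeta> \<in> configurations T"
  unfolding configurations_def by auto

lemma space_configuration_space: "space (configuration_space T) = configurations T"
  by (simp add: configuration_space_def)

lemma space_finite_configuration_space:
  "space (finite_configuration_space T) = {\<gamma> \<in> configurations T. finite \<gamma>}"
  by (auto simp: finite_configuration_space_def space_restrict_space space_configuration_space)

context lc_open begin

abbreviation "cnt \<equiv> (\<lambda>\<gamma>. counting \<gamma> Bor)"
abbreviation "Conf \<equiv> configurations (top_of_set S)"
abbreviation "CS \<equiv> configuration_space (top_of_set S)"
abbreviation "FC \<equiv> finite_configuration_space (top_of_set S)"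
abbreviation "Pow_Bor \<equiv> (\<lambda>n::nat. PiM {..<n} (\<lambda>_. Bor))"

lemma Conf_subset: "\<gamma> \<in> Conf \<Longrightarrow> \<gamma> \<subseteq> S" by (simp add: configurations_def)

lemma Conf_finite_E: "\<gamma> \<in> Conf \<Longrightarrow> finite (\<gamma> \<inter> E j)"
proof -
  assume "\<gamma> \<in> Conf"
  obtain K where K: "compact K" "E j \<subseteq> K" "K \<subseteq> S" using E_compact by blast
  then have "finite (\<gamma> \<inter> K)" using \<open>\<gamma> \<in> Conf\<close> by (simp add: configurations_def compactin_S)
  then show ?thesis by (rule finite_subset[rotated]) (use K(2) in auto)
qed

text \<open>Inner regularity holds because finite sets are compact: the number of points in
  \<open>B\<close> is the supremum of the numbers of points in finite subsets, also when it is
  infinite.\<close>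

lemma counting_Rad: assumes "\<gamma> \<in> Conf" shows "counting \<gamma> Bor \<in> Rad"
proof -
  have sub: "\<gamma> \<subseteq> space Bor" using Conf_subset[OF assms] by simp
  note e = emeasure_counting[OF sub]
  have fin: "emeasure (cnt \<gamma>) K < \<infinity>" if "compact K" "K \<subseteq> S" for K
  proof -
    have "finite (\<gamma> \<inter> K)" using assms that by (simp add: configurations_def compactin_S)
    then show ?thesis using that
      by (subst e) (auto simp: sets_Bor borel_compact Int_commute emeasure_count_space_finite less_top[symmetric])
  qed
  have reg: "emeasure (cnt \<gamma>) B = (SUP K\<in>{K. compactin (top_of_set S) K \<and> K \<subseteq> B}. emeasure (cnt \<gamma>) K)"
    if B: "B \<in> sets Bor" for B
  proof (rule antisym)
    let ?sup = "(SUP K\<in>{K. compactin (top_of_set S) K \<and> K \<subseteq> B}. emeasure (cnt \<gamma>) K)"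
    show "?sup \<le> emeasure (cnt \<gamma>) B"
      using B by (intro SUP_least emeasure_mono) auto
    have ge: "of_nat (card F) \<le> ?sup"
      if F: "finite F" "F \<subseteq> B \<inter> \<gamma>" for F
    proof (rule SUP_upper2)
      have "compact F" using F(1) by (rule finite_imp_compact)
      moreover have "F \<subseteq> S" using F(2) Conf_subset[OF assms] by blast
      ultimately show "F \<in> {K. compactin (top_of_set S) K \<and> K \<subseteq> B}" using F(2) by (simp add: compactin_S)
      have "emeasure (cnt \<gamma>) F = emeasure (count_space \<gamma>) (F \<inter> \<gamma>)"
        using \<open>compact F\<close> \<open>F \<subseteq> S\<close> by (intro e) (simp add: sets_Bor borel_compact)
      also have "\<dots> = of_nat (card F)" using F by (simp add: Int_absorb2)
      finally show "of_nat (card F) \<le> emeasure (cnt \<gamma>) F" by simp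
    qed
    show "emeasure (cnt \<gamma>) B \<le> ?sup"
    proof (cases "finite (B \<inter> \<gamma>)")
      case True
      then show ?thesis using ge[OF True] by (simp add: e[OF B])
    next
      case False
      have "of_nat n \<le> ?sup" for n
      proof -
        obtain F where "finite F" "card F = n" "F \<subseteq> B \<inter> \<gamma>"
          using infinite_arbitrarily_large[OF False] by blast
        with ge[of F] show ?thesis by simp
      qed
      note large = this
      have "?sup = top"
      proof (rule ccontr)
        assume "?sup \<noteq> top"
        then obtain n where "?sup < of_nat n"
          using ennreal_Ex_less_of_nat less_top by metis
        with large[of n] show False by (metis leD)
      qed
      then show ?thesis by (simp only: top_greatest)
    qed
  qed
  show ?thesis using fin reg by (auto simp: radon_measures_def compactin_S)
qed

lemma emeasure_counting_measurable:
  assumes "B \<in> sets Bor"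
  shows "(\<lambda>\<gamma>. emeasure (cnt \<gamma>) B) \<in> borel_measurable CS"
proof -
  have "(\<lambda>\<gamma>. counting \<gamma> Bor) \<in> measurable CS Vag"
    unfolding configuration_space_def weighted_dirac_sum_1
    using counting_Rad by (intro measurable_vimage_algebra1) (auto simp: topspace_vague_topology)
  from measurable_compose[OF this emeasure_vague_measurable[OF assms]] show ?thesis .
qed

text \<open>Configurations inherit their measurable structure from their counting measures, so
  \<open>vague_measurableI\<close> reduces the question to counts in Borel sets.\<close>

lemma configuration_space_measurableI:
  assumes "\<And>\<omega>. \<omega> \<in> space \<Omega> \<Longrightarrow> g \<omega> \<in> Conf"
    and "\<And>B. B \<in> sets Bor \<Longrightarrow> (\<lambda>\<omega>. emeasure (counting (g \<omega>) Bor) B) \<in> borel_measurable \<Omega>"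
  shows "g \<in> measurable \<Omega> CS"
  unfolding configuration_space_def weighted_dirac_sum_1
  using assms counting_Rad by (intro measurable_vimage_algebra2 vague_measurableI) auto

lemma tuples_subset: "\<gamma> \<in> Conf \<Longrightarrow> PiE {..<n} (\<lambda>_. \<gamma>) \<subseteq> space (Pow_Bor n)"
  using Conf_subset by (auto simp: space_PiM intro!: PiE_mono)

text \<open>In a box the number of tuples is a product of counts, and a Dynkin argument extends this
  to all measurable sets. Points are first confined to \<open>E j\<close>, where configurations are
  finite and counts may be subtracted.\<close>

lemma emeasure_tuples_measurable:
  assumes A: "A \<in> sets (Pow_Bor n)"
  shows "(\<lambda>\<gamma>. emeasure (counting (PiE {..<n} (\<lambda>_. \<gamma>)) (Pow_Bor n)) A) \<in> borel_measurable CS"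
proof -
  let ?Z = "\<lambda>j \<gamma>. PiE {..<n} (\<lambda>_. \<gamma> \<inter> E j)"
  let ?c = "\<lambda>j \<gamma>. counting (?Z j \<gamma>) (Pow_Bor n)"
  have Z: "?Z j \<gamma> \<subseteq> space (Pow_Bor n)" "finite (?Z j \<gamma>)" if "\<gamma> \<in> Conf" for j \<gamma>
    using Conf_subset[OF that] Conf_finite_E[OF that] by (auto simp: space_PiM intro!: PiE_mono finite_PiE)
  have fin: "emeasure (?c j \<gamma>) B \<noteq> \<infinity>" if "\<gamma> \<in> Conf" "B \<in> sets (Pow_Bor n)" for j \<gamma> B
    using Z[OF that(1), of j] that(2) by (simp add: emeasure_counting)
  have "(\<lambda>\<gamma>. emeasure (?c j \<gamma>) A) \<in> borel_measurable CS" for j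
    using Int_stable_prod_algebra prod_algebra_sets_into_space A[unfolded sets_PiM]
  proof (induction rule: sigma_sets_induct_disjoint)
    case (basic A)
    then obtain X where X: "A = PiE {..<n} X" "\<And>i. i < n \<Longrightarrow> X i \<in> sets Bor"
      by (auto simp: prod_algebra_eq_finite)
    have A: "A \<in> sets (Pow_Bor n)" unfolding X(1) using X(2) by (intro sets_PiM_I_finite) auto
    have "(\<lambda>\<gamma>. \<Prod>i<n. emeasure (cnt \<gamma>) (X i \<inter> E j)) \<in> borel_measurable CS"
      using X(2) E_sets by (intro borel_measurable_prod_ennreal emeasure_counting_measurable) auto
    moreover have "emeasure (?c j \<gamma>) A = (\<Prod>i<n. emeasure (cnt \<gamma>) (X i \<inter> E j))" if "\<gamma> \<in> Conf" for \<gamma>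
    proof -
      have AZ: "A \<inter> ?Z j \<gamma> = PiE {..<n} (\<lambda>i. X i \<inter> E j \<inter> \<gamma>)" unfolding X(1) by (auto simp: PiE_iff)
      have f: "finite (X i \<inter> E j \<inter> \<gamma>)" for i
        using Conf_finite_E[OF that, of j] by (rule finite_subset[rotated]) auto
      have "emeasure (?c j \<gamma>) A = emeasure (count_space (?Z j \<gamma>)) (A \<inter> ?Z j \<gamma>)"
        by (rule emeasure_counting[OF Z(1)[OF that] A])
      also have "\<dots> = of_nat (card (A \<inter> ?Z j \<gamma>))"
        using Z(2)[OF that, of j] by (intro emeasure_count_space_finite) auto
      also have "\<dots> = of_nat (\<Prod>i<n. card (X i \<inter> E j \<inter> \<gamma>))"
        unfolding AZ by (simp add: card_PiE)
      also have "\<dots> = (\<Prod>i<n. emeasure (cnt \<gamma>) (X i \<inter> E j))"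
        unfolding of_nat_prod
      proof (rule prod.cong[OF refl])
        fix i assume "i \<in> {..<n}"
        then have "X i \<inter> E j \<in> sets Bor" using X(2) E_sets by auto
        then show "of_nat (card (X i \<inter> E j \<inter> \<gamma>)) = emeasure (cnt \<gamma>) (X i \<inter> E j)"
          using f[of i] Conf_subset[OF that] by (simp add: emeasure_counting)
      qed
      finally show ?thesis .
    qed
    ultimately show ?case by (subst measurable_cong) (auto simp: space_configuration_space)
  next
    case empty
    then show ?case by simp
  next
    case (compl A)
    have A: "A \<in> sets (Pow_Bor n)" using compl(1) by (simp add: sets_PiM)
    have "(\<lambda>\<gamma>. \<Prod>i<n. emeasure (cnt \<gamma>) (E j)) \<in> borel_measurable CS"
      using E_sets by (intro borel_measurable_prod_ennreal emeasure_counting_measurable) auto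
    moreover have "emeasure (?c j \<gamma>) (space (Pow_Bor n)) = (\<Prod>i<n. emeasure (cnt \<gamma>) (E j))" if "\<gamma> \<in> Conf" for \<gamma>
    proof -
      have "emeasure (?c j \<gamma>) (space (Pow_Bor n)) = of_nat (card (?Z j \<gamma>))"
        using Z[OF that, of j] by (subst emeasure_counting) (auto simp: Int_absorb1)
      also have "\<dots> = (\<Prod>i<n. emeasure (cnt \<gamma>) (E j))"
        using Conf_finite_E[OF that, of j] Conf_subset[OF that] E_sets
        by (simp add: card_PiE emeasure_counting Int_commute)
      finally show ?thesis .
    qed
    ultimately have "(\<lambda>\<gamma>. emeasure (?c j \<gamma>) (space (Pow_Bor n))) \<in> borel_measurable CS"
      by (subst measurable_cong) (auto simp: space_configuration_space)
    then have "(\<lambda>\<gamma>. emeasure (?c j \<gamma>) (space (Pow_Bor n)) - emeasure (?c j \<gamma>) A) \<in> borel_measurable CS"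
      using compl(2) by simp
    moreover have "emeasure (?c j \<gamma>) (PiE {..<n} (\<lambda>_. space Bor) - A) =
        emeasure (?c j \<gamma>) (space (Pow_Bor n)) - emeasure (?c j \<gamma>) A" if "\<gamma> \<in> Conf" for \<gamma>
      using emeasure_compl[of A "?c j \<gamma>"] A fin[OF that A] by (simp add: space_PiM)
    ultimately show ?case by (subst measurable_cong) (auto simp: space_configuration_space)
  next
    case (union A)
    have "(\<lambda>\<gamma>. \<Sum>i. emeasure (?c j \<gamma>) (A i)) \<in> borel_measurable CS" using union(3) by simp
    moreover have "emeasure (?c j \<gamma>) (\<Union>i. A i) = (\<Sum>i. emeasure (?c j \<gamma>) (A i))" for \<gamma>
      using union(1,2) by (intro suminf_emeasure[symmetric]) (simp_all add: sets_PiM)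
    ultimately show ?case by simp
  qed
  then have "(\<lambda>\<gamma>. SUP j. emeasure (?c j \<gamma>) A) \<in> borel_measurable CS" by simp
  moreover have "emeasure (counting (PiE {..<n} (\<lambda>_. \<gamma>)) (Pow_Bor n)) A = (SUP j. emeasure (?c j \<gamma>) A)"
    if "\<gamma> \<in> Conf" for \<gamma>
  proof -
    let ?M = "count_space (PiE {..<n} (\<lambda>_. \<gamma>))"
    have sub: "?Z j \<gamma> \<subseteq> PiE {..<n} (\<lambda>_. \<gamma>)" for j by (intro PiE_mono) auto
    \<comment> \<open>A tuple has finite, hence compact, range, and this range lies in a single
      \<open>E j\<close>.\<close>
    have un: "A \<inter> PiE {..<n} (\<lambda>_. \<gamma>) = (\<Union>j. A \<inter> ?Z j \<gamma>)"
    proof (intro equalityI subsetI)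
      fix y assume y: "y \<in> A \<inter> PiE {..<n} (\<lambda>_. \<gamma>)"
      then have "finite (y ` {..<n})" "y ` {..<n} \<subseteq> S" using Conf_subset[OF that] by (auto simp: PiE_iff)
      then obtain j where "y ` {..<n} \<subseteq> E j" using compact_subset_E finite_imp_compact by metis
      then have "y \<in> A \<inter> ?Z j \<gamma>" using y by (auto simp: PiE_iff)
      then show "y \<in> (\<Union>j. A \<inter> ?Z j \<gamma>)" by blast
    qed (use sub in blast)
    have inc: "incseq (\<lambda>j. A \<inter> ?Z j \<gamma>)"
    proof (rule incseq_SucI)
      fix j show "A \<inter> ?Z j \<gamma> \<subseteq> A \<inter> ?Z (Suc j) \<gamma>"
        using incseq_SucD[OF incseq_E, of j] by (intro Int_mono order_refl PiE_mono) auto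
    qed
    have "emeasure (counting (PiE {..<n} (\<lambda>_. \<gamma>)) (Pow_Bor n)) A = emeasure ?M (\<Union>j. A \<inter> ?Z j \<gamma>)"
      using A tuples_subset[OF that] unfolding un[symmetric] by (intro emeasure_counting)
    also have "\<dots> = (SUP j. emeasure ?M (A \<inter> ?Z j \<gamma>))"
      using sub inc by (intro SUP_emeasure_incseq[symmetric]) auto
    also have "\<dots> = (SUP j. emeasure (?c j \<gamma>) A)"
    proof (rule SUP_cong[OF refl])
      fix j
      have "finite (A \<inter> ?Z j \<gamma>)" using Z(2)[OF that, of j] by simp
      moreover have "A \<inter> ?Z j \<gamma> \<subseteq> PiE {..<n} (\<lambda>_. \<gamma>)" using sub[of j] by blast
      ultimately show "emeasure ?M (A \<inter> ?Z j \<gamma>) = emeasure (?c j \<gamma>) A"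
        using A Z[OF that, of j] by (simp add: emeasure_counting emeasure_count_space_finite)
    qed
    finally show ?thesis .
  qed
  ultimately show ?thesis by (subst measurable_cong) (auto simp: space_configuration_space)
qed

theorem nn_integral_tuples_measurable:
  assumes f: "f \<in> borel_measurable (Pow_Bor n)"
  shows "(\<lambda>\<gamma>. \<integral>\<^sup>+y. f y \<partial>count_space (PiE {..<n} (\<lambda>_. \<gamma>))) \<in> borel_measurable CS"
proof -
  have "(\<lambda>\<gamma>. \<integral>\<^sup>+y. f y \<partial>counting (PiE {..<n} (\<lambda>_. \<gamma>)) (Pow_Bor n)) \<in> borel_measurable CS"
    by (rule conjunct1[OF nn_integral_mixture[OF _ _ f]]) (auto intro: emeasure_tuples_measurable)
  then show ?thesis
    by (rule measurable_cong[THEN iffD1, rotated])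
      (simp add: space_configuration_space nn_integral_counting[OF tuples_subset f])
qed

end

section \<open>Ordered tuples of distinct points and finite subsets\<close>

definition distinct_tuples :: "nat \<Rightarrow> 'a set \<Rightarrow> (nat \<Rightarrow> 'a) set" where
  "distinct_tuples n \<gamma> = {y \<in> PiE {..<n} (\<lambda>_. \<gamma>). inj_on y {..<n}}"

lemma permuted_tuple_bij:
  assumes \<pi>: "\<pi> permutes {..<n}"
  shows "bij_betw (\<lambda>y. \<lambda>i\<in>{..<n}. y (\<pi> i)) (distinct_tuples n \<gamma>) (distinct_tuples n \<gamma>)"
proof -
  let ?P = "\<lambda>p y. \<lambda>i\<in>{..<n}. y (p i)"
  have mem: "?P p y \<in> distinct_tuples n \<gamma>" if "p permutes {..<n}" "y \<in> distinct_tuples n \<gamma>" for p y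
  proof -
    have p: "p i \<in> {..<n}" if "i \<in> {..<n}" for i using that permutes_in_image[OF \<open>p permutes {..<n}\<close>] by blast
    have "inj_on (y \<circ> p) {..<n}"
      using that permutes_image[OF that(1)] permutes_inj_on[OF that(1)]
      by (intro comp_inj_on) (auto simp: distinct_tuples_def)
    then have "inj_on (?P p y) {..<n}" by (simp add: inj_on_def)
    then show ?thesis using that(2) p by (auto simp: distinct_tuples_def PiE_iff)
  qed
  have inv: "?P p (?P q y) = y" if "q \<circ> p = id" "p permutes {..<n}" "y \<in> distinct_tuples n \<gamma>" for p q y
  proof
    fix i
    have "q (p i) = i" using that(1) by (metis comp_apply id_apply)
    moreover have "p i \<in> {..<n} \<longleftrightarrow> i \<in> {..<n}" using that(2) by (rule permutes_in_image)
    ultimately show "?P p (?P q y) i = y i"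
      using that(3) by (auto simp: distinct_tuples_def PiE_iff extensional_def)
  qed
  have \<pi>': "Hilbert_Choice.inv \<pi> permutes {..<n}" by (rule permutes_inv[OF \<pi>])
  show ?thesis
    by (rule bij_betw_byWitness[where f' = "?P (Hilbert_Choice.inv \<pi>)"])
      (use mem[OF \<pi>] mem[OF \<pi>'] inv[OF permutes_inv_o(1)[OF \<pi>] \<pi>'] inv[OF permutes_inv_o(2)[OF \<pi>] \<pi>] in auto)
qed

lemma enumerations_differ_by_permutation:
  assumes y: "y \<in> extensional {..<n}" "bij_betw y {..<n} \<zeta>"
    and z: "z \<in> extensional {..<n}" "bij_betw z {..<n} \<zeta>"
  shows "\<exists>\<pi>. \<pi> permutes {..<n} \<and> y = (\<lambda>i\<in>{..<n}. z (\<pi> i))"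
proof -
  define \<pi> where "\<pi> i = (if i \<in> {..<n} then inv_into {..<n} z (y i) else i)" for i
  have "bij_betw (inv_into {..<n} z \<circ> y) {..<n} {..<n}"
    by (rule bij_betw_trans[OF y(2) bij_betw_inv_into[OF z(2)]])
  then have "bij_betw \<pi> {..<n} {..<n}"
    by (rule bij_betw_cong[THEN iffD1, rotated]) (simp add: \<pi>_def)
  then have "\<pi> permutes {..<n}" by (rule bij_imp_permutes) (simp add: \<pi>_def)
  moreover have "y = (\<lambda>i\<in>{..<n}. z (\<pi> i))"
  proof
    fix i
    show "y i = (\<lambda>i\<in>{..<n}. z (\<pi> i)) i"
    proof (cases "i \<in> {..<n}")
      case True
      then have "y i \<in> z ` {..<n}" using y(2) z(2) by (auto simp: bij_betw_def)
      then show ?thesis using True by (simp add: \<pi>_def f_inv_into_f)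
    next
      case False
      then show ?thesis using y(1) by (simp add: extensional_def)
    qed
  qed
  ultimately show ?thesis by blast
qed

lemma enumeration_props:
  assumes "finite \<zeta>" "card \<zeta> = n"
  shows "enumeration n \<zeta> \<in> extensional {..<n}" "bij_betw (enumeration n \<zeta>) {..<n} \<zeta>"
proof -
  obtain h where "bij_betw h {0..<card \<zeta>} \<zeta>" using ex_bij_betw_nat_finite[OF assms(1)] by blast
  then have "bij_betw h {..<n} \<zeta>" using assms(2) by (simp add: lessThan_atLeast0)
  then have "bij_betw (restrict h {..<n}) {..<n} \<zeta>"
    by (rule bij_betw_cong[THEN iffD1, rotated]) simp
  then have "\<exists>y. y \<in> extensional {..<n} \<and> bij_betw y {..<n} \<zeta>" by (intro exI[of _ "restrict h {..<n}"]) simp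
  from someI_ex[OF this] show "enumeration n \<zeta> \<in> extensional {..<n}" "bij_betw (enumeration n \<zeta>) {..<n} \<zeta>"
    by (simp_all add: enumeration_def)
qed

lemma distinct_tuples_iff:
  "y \<in> distinct_tuples n \<gamma> \<and> y ` {..<n} = \<zeta> \<longleftrightarrow> y \<in> extensional {..<n} \<and> bij_betw y {..<n} \<zeta> \<and> \<zeta> \<subseteq> \<gamma>"
  by (auto simp: distinct_tuples_def bij_betw_def PiE_iff)

text \<open>Composing one fixed enumeration of \<zeta> with the permutations of
  \<open>{..<n}\<close> yields every ordering exactly once.\<close>

lemma card_enumerations:
  assumes "\<zeta> \<subseteq> \<gamma>" "finite \<zeta>" "card \<zeta> = n"
  shows "finite {y \<in> distinct_tuples n \<gamma>. y ` {..<n} = \<zeta>}"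
    "card {y \<in> distinct_tuples n \<gamma>. y ` {..<n} = \<zeta>} = fact n"
proof -
  let ?e = "enumeration n \<zeta>"
  note e = enumeration_props[OF assms(2,3)]
  have "bij_betw (\<lambda>\<pi>. \<lambda>i\<in>{..<n}. ?e (\<pi> i)) {\<pi>. \<pi> permutes {..<n}} {y \<in> distinct_tuples n \<gamma>. y ` {..<n} = \<zeta>}"
  proof (rule bij_betw_imageI)
    show "inj_on (\<lambda>\<pi>. \<lambda>i\<in>{..<n}. ?e (\<pi> i)) {\<pi>. \<pi> permutes {..<n}}"
    proof (rule inj_onI)
      fix \<pi> \<sigma> assume *: "\<pi> \<in> {\<pi>. \<pi> permutes {..<n}}" "\<sigma> \<in> {\<pi>. \<pi> permutes {..<n}}"
        "(\<lambda>i\<in>{..<n}. ?e (\<pi> i)) = (\<lambda>i\<in>{..<n}. ?e (\<sigma> i))"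
      show "\<pi> = \<sigma>"
      proof
        fix i
        show "\<pi> i = \<sigma> i"
        proof (cases "i \<in> {..<n}")
          case True
          then have "?e (\<pi> i) = ?e (\<sigma> i)" using fun_cong[OF *(3), of i] by simp
          moreover have "\<pi> i \<in> {..<n}" "\<sigma> i \<in> {..<n}" using * True by (auto simp only: mem_Collect_eq permutes_in_image)
          ultimately show ?thesis using e(2) by (auto simp: bij_betw_def dest: inj_onD)
        next
          case False
          then show ?thesis using * by (simp add: permutes_def)
        qed
      qed
    qed
    show "(\<lambda>\<pi>. \<lambda>i\<in>{..<n}. ?e (\<pi> i)) ` {\<pi>. \<pi> permutes {..<n}} = {y \<in> distinct_tuples n \<gamma>. y ` {..<n} = \<zeta>}"
    proof (intro equalityI subsetI)
      fix y assume "y \<in> (\<lambda>\<pi>. \<lambda>i\<in>{..<n}. ?e (\<pi> i)) ` {\<pi>. \<pi> permutes {..<n}}"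
      then obtain \<pi> where \<pi>: "\<pi> permutes {..<n}" "y = (\<lambda>i\<in>{..<n}. ?e (\<pi> i))" by auto
      have "bij_betw (?e \<circ> \<pi>) {..<n} \<zeta>" by (rule bij_betw_trans[OF permutes_imp_bij[OF \<pi>(1)] e(2)])
      then have "bij_betw y {..<n} \<zeta>"
        by (rule bij_betw_cong[THEN iffD1, rotated]) (simp add: \<pi>(2))
      then show "y \<in> {y \<in> distinct_tuples n \<gamma>. y ` {..<n} = \<zeta>}"
        unfolding mem_Collect_eq distinct_tuples_iff using assms(1) \<pi>(2) by simp
    next
      fix y assume "y \<in> {y \<in> distinct_tuples n \<gamma>. y ` {..<n} = \<zeta>}"
      then have "y \<in> extensional {..<n}" "bij_betw y {..<n} \<zeta>"
        unfolding mem_Collect_eq distinct_tuples_iff by auto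
      from enumerations_differ_by_permutation[OF this e] obtain \<pi>
        where "\<pi> permutes {..<n}" "y = (\<lambda>i\<in>{..<n}. ?e (\<pi> i))" by blast
      then show "y \<in> (\<lambda>\<pi>. \<lambda>i\<in>{..<n}. ?e (\<pi> i)) ` {\<pi>. \<pi> permutes {..<n}}" by (intro image_eqI[of _ _ \<pi>]) auto
    qed
  qed
  note bij = this
  from bij_betw_same_card[OF this] show "card {y \<in> distinct_tuples n \<gamma>. y ` {..<n} = \<zeta>} = fact n"
    by (simp add: card_permutations)
  show "finite {y \<in> distinct_tuples n \<gamma>. y ` {..<n} = \<zeta>}"
    using bij_betw_finite[OF bij] by (simp add: finite_permutations)
qed

lemma ennreal_fact_cancel: "1 / fact n * fact n = (1 :: ennreal)"
proof -
  have "(fact n :: ennreal) = of_nat (fact n)" by simp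
  then have "(fact n :: ennreal) < top" by (simp only: of_nat_less_top)
  moreover have "(fact n :: ennreal) \<noteq> 0" by simp
  ultimately have "fact n * (1 / fact n) = (1 :: ennreal)" by (simp add: ennreal_times_divide)
  then show ?thesis by (simp only: mult.commute)
qed

text \<open>Double counting of the pairs in which the tuple \<open>y\<close> enumerates the set
  \<zeta>: every distinct tuple has one range, and every \<open>n\<close>-point set has
  \<open>fact n\<close> orderings.\<close>

theorem nn_integral_subsets_eq_tuples:
  fixes H :: "'a set \<Rightarrow> ennreal"
  shows "(\<integral>\<^sup>+y. H (y ` {..<n}) \<partial>count_space (distinct_tuples n \<gamma>)) =
    fact n * (\<integral>\<^sup>+\<zeta>. H \<zeta> \<partial>count_space {\<zeta>. \<zeta> \<subseteq> \<gamma> \<and> finite \<zeta> \<and> card \<zeta> = n})"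
proof -
  let ?Y = "distinct_tuples n \<gamma>" and ?Z = "{\<zeta>. \<zeta> \<subseteq> \<gamma> \<and> finite \<zeta> \<and> card \<zeta> = n}"
  define f where "f p = H (snd p) * indicator {y \<in> ?Y. y ` {..<n} = snd p} (fst p)" for p
  have "(\<integral>\<^sup>+y. H (y ` {..<n}) \<partial>count_space ?Y) = (\<integral>\<^sup>+y. H (y ` {..<n}) * indicator ?Y y \<partial>count_space UNIV)"
    by (rule nn_integral_count_space_indicator) simp
  also have "\<dots> = (\<integral>\<^sup>+y. \<integral>\<^sup>+\<zeta>. f (y, \<zeta>) \<partial>count_space UNIV \<partial>count_space UNIV)"
  proof (rule nn_integral_cong)
    fix y
    have "(\<integral>\<^sup>+\<zeta>. f (y, \<zeta>) \<partial>count_space UNIV) = (\<Sum>\<zeta>\<in>{y ` {..<n}}. f (y, \<zeta>))"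
      by (rule nn_integral_count_space') (auto simp: f_def)
    then show "H (y ` {..<n}) * indicator ?Y y = (\<integral>\<^sup>+\<zeta>. f (y, \<zeta>) \<partial>count_space UNIV)"
      by (simp add: f_def indicator_def)
  qed
  also have "\<dots> = (\<integral>\<^sup>+\<zeta>. \<integral>\<^sup>+y. f (y, \<zeta>) \<partial>count_space UNIV \<partial>count_space UNIV)"
    \<comment> \<open>Both iterated sums equal the sum over pairs, whatever the cardinality of
      \<gamma>.\<close>
    by (simp only: nn_integral_fst_count_space nn_integral_snd_count_space)
  also have "\<dots> = (\<integral>\<^sup>+\<zeta>. fact n * (H \<zeta> * indicator ?Z \<zeta>) \<partial>count_space UNIV)"
  proof (rule nn_integral_cong)
    fix \<zeta>
    have "(\<integral>\<^sup>+y. f (y, \<zeta>) \<partial>count_space UNIV) = H \<zeta> * emeasure (count_space UNIV) {y \<in> ?Y. y ` {..<n} = \<zeta>}"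
      unfolding f_def by (simp add: nn_integral_cmult)
    also have "\<dots> = fact n * (H \<zeta> * indicator ?Z \<zeta>)"
    proof (cases "\<zeta> \<in> ?Z")
      case True
      then have "emeasure (count_space UNIV) {y \<in> ?Y. y ` {..<n} = \<zeta>} = of_nat (fact n)"
        using card_enumerations[of \<zeta> \<gamma> n] by (subst emeasure_count_space_finite) auto
      then show ?thesis using True by (simp add: mult.commute)
    next
      case False
      have "{y \<in> ?Y. y ` {..<n} = \<zeta>} = {}"
      proof (rule ccontr)
        assume "{y \<in> ?Y. y ` {..<n} = \<zeta>} \<noteq> {}"
        then obtain y where "y \<in> ?Y \<and> y ` {..<n} = \<zeta>" by blast
        then have "bij_betw y {..<n} \<zeta>" "\<zeta> \<subseteq> \<gamma>" unfolding distinct_tuples_iff by auto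
        then show False using False bij_betw_same_card[of y "{..<n}" \<zeta>] bij_betw_finite[of y "{..<n}" \<zeta>] by simp
      qed
      then have "emeasure (count_space UNIV) {y \<in> ?Y. y ` {..<n} = \<zeta>} = 0" by (simp only: emeasure_empty)
      then show ?thesis using False by simp
    qed
    finally show "(\<integral>\<^sup>+y. f (y, \<zeta>) \<partial>count_space UNIV) = fact n * (H \<zeta> * indicator ?Z \<zeta>)" .
  qed
  also have "\<dots> = fact n * (\<integral>\<^sup>+\<zeta>. H \<zeta> * indicator ?Z \<zeta> \<partial>count_space UNIV)"
    by (rule nn_integral_cmult) simp
  also have "(\<integral>\<^sup>+\<zeta>. H \<zeta> * indicator ?Z \<zeta> \<partial>count_space UNIV) = (\<integral>\<^sup>+\<zeta>. H \<zeta> \<partial>count_space ?Z)"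
    by (rule nn_integral_count_space_indicator[symmetric]) simp
  finally show ?thesis .
qed

text \<open>Sorting by cardinality reduces sums over finite subsets to sums over tuples, whose
  measurable dependence on \<gamma> comes from \<open>emeasure_tuples_measurable\<close>.\<close>

lemma nn_integral_finite_subsets:
  fixes H :: "'a set \<Rightarrow> ennreal"
  shows "(\<integral>\<^sup>+\<zeta>. H \<zeta> \<partial>count_space {\<zeta>. \<zeta> \<subseteq> \<gamma> \<and> finite \<zeta>}) =
    (\<Sum>n. 1 / fact n * (\<integral>\<^sup>+y. H (y ` {..<n}) \<partial>count_space (distinct_tuples n \<gamma>)))"
proof -
  let ?Z = "{\<zeta>. \<zeta> \<subseteq> \<gamma> \<and> finite \<zeta>}" and ?Zn = "\<lambda>n. {\<zeta>. \<zeta> \<subseteq> \<gamma> \<and> finite \<zeta> \<and> card \<zeta> = n}"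
  have "(\<integral>\<^sup>+\<zeta>. H \<zeta> \<partial>count_space ?Z) = (\<integral>\<^sup>+\<zeta>. H \<zeta> * indicator ?Z \<zeta> \<partial>count_space UNIV)"
    by (rule nn_integral_count_space_indicator) simp
  also have "\<dots> = (\<integral>\<^sup>+\<zeta>. (\<Sum>n. H \<zeta> * indicator (?Zn n) \<zeta>) \<partial>count_space UNIV)"
  proof (rule nn_integral_cong)
    fix \<zeta>
    have "(\<Sum>n. H \<zeta> * indicator (?Zn n) \<zeta>) = (\<Sum>n\<in>{card \<zeta>}. H \<zeta> * indicator (?Zn n) \<zeta>)"
      by (rule suminf_finite) auto
    then show "H \<zeta> * indicator ?Z \<zeta> = (\<Sum>n. H \<zeta> * indicator (?Zn n) \<zeta>)" by (simp add: indicator_def)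
  qed
  also have "\<dots> = (\<Sum>n. \<integral>\<^sup>+\<zeta>. H \<zeta> * indicator (?Zn n) \<zeta> \<partial>count_space UNIV)"
    by (rule nn_integral_suminf) simp
  also have "\<dots> = (\<Sum>n. 1 / fact n * (\<integral>\<^sup>+y. H (y ` {..<n}) \<partial>count_space (distinct_tuples n \<gamma>)))"
  proof (rule suminf_cong)
    fix n
    have "(\<integral>\<^sup>+\<zeta>. H \<zeta> * indicator (?Zn n) \<zeta> \<partial>count_space UNIV) = (\<integral>\<^sup>+\<zeta>. H \<zeta> \<partial>count_space (?Zn n))"
      by (rule nn_integral_count_space_indicator[symmetric]) simp
    also have "\<dots> = 1 / fact n * (fact n * (\<integral>\<^sup>+\<zeta>. H \<zeta> \<partial>count_space (?Zn n)))"
    proof -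
      show ?thesis by (simp only: mult.assoc[symmetric] ennreal_fact_cancel mult_1)
    qed
    finally show "(\<integral>\<^sup>+\<zeta>. H \<zeta> * indicator (?Zn n) \<zeta> \<partial>count_space UNIV) =
        1 / fact n * (\<integral>\<^sup>+y. H (y ` {..<n}) \<partial>count_space (distinct_tuples n \<gamma>))"
      by (simp only: nn_integral_subsets_eq_tuples)
  qed
  finally show ?thesis .
qed

section \<open>Measurability of sums over distinct tuples and over finite subsets\<close>

context lc_open begin

lemma coordinate_measurable: "i < n \<Longrightarrow> (\<lambda>y. y i) \<in> measurable (Pow_Bor n) Bor"
  by simp

lemma Bor_borel: "(\<lambda>x. x) \<in> borel_measurable Bor"
proof -
  have "(\<lambda>x. x) \<in> borel_measurable (restrict_space borel S)" by (rule measurable_restrict_space1) simp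
  then show ?thesis by (simp add: sets_borel_of_top_of_set cong: measurable_cong_sets)
qed

lemma injective_tuples_sets: "{y \<in> space (Pow_Bor n). inj_on y {..<n}} \<in> sets (Pow_Bor n)"
proof -
  have coord: "(\<lambda>y. y i) \<in> borel_measurable (Pow_Bor n)" if "i < n" for i
    by (rule measurable_compose[OF coordinate_measurable[OF that] Bor_borel])
  have neq: "{y \<in> space (Pow_Bor n). y i \<noteq> y j} \<in> sets (Pow_Bor n)" if ij: "i < n" "j < n" for i j
  proof -
    have "(\<lambda>y. dist (y i) (y j)) \<in> borel_measurable (Pow_Bor n)"
      using ij by (intro borel_measurable_dist coord)
    then have "{y \<in> space (Pow_Bor n). dist (y i) (y j) \<noteq> 0} \<in> sets (Pow_Bor n)"
      by measurable
    then show ?thesis by simp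
  qed
  have "{y \<in> space (Pow_Bor n). inj_on y {..<n}} =
      {y \<in> space (Pow_Bor n). \<forall>i\<in>{..<n}. \<forall>j\<in>{..<n}. i \<noteq> j \<longrightarrow> y i \<noteq> y j}"
    by (auto simp: inj_on_def)
  also have "\<dots> \<in> sets (Pow_Bor n)"
    using neq by (intro sets.sets_Collect_finite_All sets.sets_Collect_imp sets.sets_Collect_const) auto
  finally show ?thesis .
qed

definition Inj_Bor :: "nat \<Rightarrow> (nat \<Rightarrow> 'b) measure" where
  "Inj_Bor n = restrict_space (Pow_Bor n) {y. inj_on y {..<n}}"

lemma space_Inj_Bor: "space (Inj_Bor n) = distinct_tuples n S"
  by (auto simp: Inj_Bor_def space_restrict_space space_PiM distinct_tuples_def)

text \<open>For an injective tuple the count of its range in \<open>B\<close> is a sum of indicators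
  of the coordinates. Without injectivity repeated points would be counted several times, hence the
  restriction to \<open>Inj_Bor\<close>.\<close>

lemma range_measurable: "(\<lambda>y. y ` {..<n}) \<in> measurable (Inj_Bor n) FC"
  unfolding finite_configuration_space_def
proof (rule measurable_restrict_space2)
  show "(\<lambda>y. y ` {..<n}) \<in> space (Inj_Bor n) \<rightarrow> {\<gamma>. finite \<gamma>}" by simp
  show "(\<lambda>y. y ` {..<n}) \<in> measurable (Inj_Bor n) CS"
  proof (rule configuration_space_measurableI)
    fix y assume "y \<in> space (Inj_Bor n)"
    then show "y ` {..<n} \<in> Conf"
      unfolding space_Inj_Bor by (intro finite_configuration) (auto simp: distinct_tuples_def PiE_iff)
  next
    fix B assume B: "B \<in> sets Bor"
    have "(\<lambda>y. \<Sum>i<n. indicator B (y i) :: ennreal) \<in> borel_measurable (Inj_Bor n)"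
      unfolding Inj_Bor_def
      by (intro measurable_restrict_space1 borel_measurable_sum
          measurable_compose[OF coordinate_measurable borel_measurable_indicator[OF B]]) auto
    moreover have "emeasure (cnt (y ` {..<n})) B = (\<Sum>i<n. indicator B (y i))" if "y \<in> space (Inj_Bor n)" for y
    proof -
      have y: "y ` {..<n} \<subseteq> S" "inj_on y {..<n}"
        using that unfolding space_Inj_Bor by (auto simp: distinct_tuples_def PiE_iff)
      have "emeasure (cnt (y ` {..<n})) B = emeasure (count_space (y ` {..<n})) (B \<inter> y ` {..<n})"
        using y B by (intro emeasure_counting) auto
      also have "\<dots> = (\<integral>\<^sup>+x. indicator (B \<inter> y ` {..<n}) x \<partial>count_space (y ` {..<n}))" by simp
      also have "\<dots> = (\<Sum>x\<in>y ` {..<n}. indicator (B \<inter> y ` {..<n}) x)"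
        by (rule nn_integral_count_space') auto
      also have "\<dots> = (\<Sum>i<n. indicator B (y i))"
        using y(2) by (subst sum.reindex) (auto intro!: sum.cong simp: indicator_def)
      finally show ?thesis .
    qed
    ultimately show "(\<lambda>y. emeasure (cnt (y ` {..<n})) B) \<in> borel_measurable (Inj_Bor n)"
      by (subst measurable_cong)
  qed
qed

lemma nn_integral_distinct_tuples_measurable:
  assumes f: "f \<in> borel_measurable (Inj_Bor n)"
  shows "(\<lambda>\<gamma>. \<integral>\<^sup>+y. f y \<partial>count_space (distinct_tuples n \<gamma>)) \<in> borel_measurable CS"
proof -
  let ?I = "{y. inj_on y {..<n}}"
  have "?I \<inter> space (Pow_Bor n) \<in> sets (Pow_Bor n)"
    using injective_tuples_sets[of n] by (simp add: Int_def conj_commute)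
  then have "(\<lambda>y. f y * indicator ?I y) \<in> borel_measurable (Pow_Bor n)"
    using f unfolding Inj_Bor_def by (subst (asm) borel_measurable_restrict_space_iff_ennreal)
  from nn_integral_tuples_measurable[OF this]
  have "(\<lambda>\<gamma>. \<integral>\<^sup>+y. f y * indicator ?I y \<partial>count_space (PiE {..<n} (\<lambda>_. \<gamma>))) \<in> borel_measurable CS" .
  moreover have "(\<integral>\<^sup>+y. f y * indicator ?I y \<partial>count_space (PiE {..<n} (\<lambda>_. \<gamma>))) =
      (\<integral>\<^sup>+y. f y \<partial>count_space (distinct_tuples n \<gamma>))" for \<gamma>
    by (subst (1 2) nn_integral_count_space_indicator)
      (auto intro!: nn_integral_cong simp: distinct_tuples_def indicator_def)
  ultimately show ?thesis by simp
qed

theorem nn_integral_finite_subsets_measurable: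
  assumes G: "G \<in> borel_measurable FC"
  shows "(\<lambda>\<gamma>. \<integral>\<^sup>+\<zeta>. G \<zeta> \<partial>count_space {\<zeta>. \<zeta> \<subseteq> \<gamma> \<and> finite \<zeta>}) \<in> borel_measurable CS"
  unfolding nn_integral_finite_subsets
  using measurable_compose[OF range_measurable G]
  by (intro borel_measurable_suminf_order borel_measurable_times_ennreal borel_measurable_const
      nn_integral_distinct_tuples_measurable)

text \<open>The number of points is the evaluation at the whole space \<open>S\<close>, which is
  open and therefore Borel.\<close>

lemma n_point_configurations_sets: "n_point_configurations (top_of_set S) n \<in> sets FC"
proof -
  have "S \<in> sets Bor" using open_S by (simp add: sets_Bor)
  then have "(\<lambda>\<gamma>. emeasure (cnt \<gamma>) S) \<in> borel_measurable FC"
    unfolding finite_configuration_space_def by (intro measurable_restrict_space1 emeasure_counting_measurable)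
  then have "{\<gamma> \<in> space FC. emeasure (cnt \<gamma>) S = of_nat n} \<in> sets FC" by measurable
  also have "{\<gamma> \<in> space FC. emeasure (cnt \<gamma>) S = of_nat n} = n_point_configurations (top_of_set S) n"
  proof -
    have "emeasure (cnt \<gamma>) S = of_nat (card \<gamma>)" if "\<gamma> \<in> Conf" "finite \<gamma>" for \<gamma>
      using that Conf_subset[OF that(1)] \<open>S \<in> sets Bor\<close>
      by (subst emeasure_counting) (auto simp: Int_absorb1 emeasure_count_space_finite)
    then show ?thesis
      by (auto simp: n_point_configurations_def space_finite_configuration_space)
  qed
  finally show ?thesis .
qed

end

section \<open>Marks of random discrete measures\<close>

lemma marked_top_eq: "marked_top (euclidean :: 'a::topological_space topology) = top_of_set (UNIV \<times> {0<..})"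
  unfolding marked_top_def pos_top_eq prod_topology_subtopology by simp

lemma lc_open_UNIV:
  assumes "locally_compact_space (euclidean :: 'a::polish_space topology)"
  shows "lc_open (UNIV :: 'a set)"
proof
  fix x :: 'a
  obtain U K where "openin euclidean U" "compactin euclidean K" "x \<in> U" "U \<subseteq> K"
    using assms unfolding locally_compact_space_def by (metis UNIV_I topspace_euclidean)
  then show "\<exists>U K. open U \<and> x \<in> U \<and> U \<subseteq> K \<and> compact K \<and> K \<subseteq> UNIV" by auto
qed simp

lemma lc_open_marked:
  assumes "locally_compact_space (euclidean :: 'a::polish_space topology)"
  shows "lc_open (UNIV \<times> {0<..} :: ('a \<times> real) set)"
proof
  show "open (UNIV \<times> {0<..} :: ('a \<times> real) set)" by (intro open_Times) auto
  fix p :: "'a \<times> real" assume p: "p \<in> UNIV \<times> {0<..}"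
  obtain x s where xs: "p = (x, s)" "0 < s" using p by auto
  interpret X: lc_open "UNIV :: 'a set" by (rule lc_open_UNIV[OF assms])
  obtain U K where UK: "open U" "x \<in> U" "U \<subseteq> K" "compact K" using X.lc[of x] by auto
  show "\<exists>U K. open U \<and> p \<in> U \<and> U \<subseteq> K \<and> compact K \<and> K \<subseteq> UNIV \<times> {0<..}"
  proof (intro exI conjI)
    show "open (U \<times> {s / 2<..<s + 1})" using UK(1) by (intro open_Times) auto
    show "p \<in> U \<times> {s / 2<..<s + 1}" using UK(2) xs by auto
    show "U \<times> {s / 2<..<s + 1} \<subseteq> K \<times> {s / 2..s + 1}" using UK(3) by auto
    show "compact (K \<times> {s / 2..s + 1})" using UK(4) by (intro compact_Times) auto
    show "K \<times> {s / 2..s + 1} \<subseteq> UNIV \<times> {0<..}" using xs(2) by auto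
  qed
qed

text \<open>A mark is the mass of the atom at its position, so \<open>marks \<eta>\<close> is the
  graph of a function. All later identifications of marks through their positions rest on
  this.\<close>

lemma marks_functional:
  assumes "y \<in> marks \<eta>" "z \<in> marks \<eta>" "fst y = fst z"
  shows "y = z"
  using assms by (auto simp: marks_def)

lemma marks_atom: "y \<in> marks \<eta> \<Longrightarrow> emeasure \<eta> {fst y} = ennreal (snd y) \<and> 0 < snd y"
  by (auto simp: marks_def)

text \<open>Substituting \<open>x \<mapsto> (x, s x)\<close> in the representation of \<eta> turns
  integrals against \<eta> into weighted sums over its marks.\<close>

lemma discrete_radon_marks:
  fixes \<eta> :: "'a::polish_space measure"
  assumes "\<eta> \<in> discrete_radon_measures euclidean"
  shows "countable (marks \<eta>)"
    and "f \<in> borel_measurable borel \<Longrightarrow> (\<integral>\<^sup>+x. f x \<partial>\<eta>) = (\<integral>\<^sup>+y. ennreal (snd y) * f (fst y) \<partial>count_space (marks \<eta>))"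
proof -
  obtain A s where A: "countable A" "\<forall>x\<in>A. 0 < s x" "\<eta> = weighted_dirac_sum euclidean A (\<lambda>x. ennreal (s x))"
    using assms by (auto simp: discrete_radon_measures_def)
  have m: "marks \<eta> = (\<lambda>x. (x, s x)) ` A" unfolding A(3) using A(2) by (intro marks_weighted_dirac_sum) auto
  then show "countable (marks \<eta>)" using A(1) by simp
  show "(\<integral>\<^sup>+x. f x \<partial>\<eta>) = (\<integral>\<^sup>+y. ennreal (snd y) * f (fst y) \<partial>count_space (marks \<eta>))"
    if f: "f \<in> borel_measurable borel"
  proof -
    have "(\<integral>\<^sup>+x. f x \<partial>\<eta>) = (\<integral>\<^sup>+x. f x \<partial>point_measure A (\<lambda>x. ennreal (s x)))"
      unfolding A(3) weighted_dirac_sum_def borel_of_euclidean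
      using f by (subst nn_integral_distr) auto
    also have "\<dots> = (\<integral>\<^sup>+x. ennreal (s x) * f x \<partial>count_space A)"
      unfolding point_measure_def by (subst nn_integral_density) auto
    also have "\<dots> = (\<integral>\<^sup>+x. (\<lambda>y. ennreal (snd y) * f (fst y)) (x, s x) \<partial>count_space A)" by simp
    also have "\<dots> = (\<integral>\<^sup>+y. ennreal (snd y) * f (fst y) \<partial>count_space (marks \<eta>))"
      by (rule nn_integral_bij_count_space) (auto simp: m bij_betw_def inj_on_def)
    finally show ?thesis .
  qed
qed

section \<open>The random measure and the measurability of its marks\<close>

locale random_discrete_moments =
  fixes \<mu> :: "'a::polish_space measure measure"
    and M :: "nat \<Rightarrow> (nat \<Rightarrow> 'a) measure"
  assumes locally_compact: "locally_compact_space (euclidean :: 'a topology)"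
    and random_discrete: "random_discrete_measure euclidean \<mu>"
    and moment_measure: "\<And>n. is_moment_measure euclidean \<mu> n (M n)"
    and moment_growth: "\<And>\<Lambda>. \<Lambda> \<in> rel_compact_borel euclidean \<Longrightarrow>
           \<exists>C::real. 0 < C \<and> (\<forall>n\<ge>1. emeasure (M n) (PiE {..<n} (\<lambda>_. \<Lambda>)) \<le> ennreal (C ^ n * fact n))"
begin

sublocale X: lc_open "UNIV :: 'a set" by (rule lc_open_UNIV[OF locally_compact])
sublocale Y: lc_open "UNIV \<times> {0<..} :: ('a \<times> real) set" by (rule lc_open_marked[OF locally_compact])

text \<open>On this set of full measure every \<eta> is the sum of its marks without exception,
  which spares arguments up to null sets from here on.\<close>

definition P :: "'a measure measure" where
  "P = restrict_space \<mu> (discrete_radon_measures euclidean)"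

text \<open>\<open>emeasure\<close> vanishes outside the sigma-algebra, so the value 1 already shows
  measurability.\<close>

lemma discrete_sets: "discrete_radon_measures euclidean \<in> sets \<mu>"
  using random_discrete emeasure_notin_sets[of "discrete_radon_measures euclidean" \<mu>]
  by (auto simp: random_discrete_measure_def)

lemma space_P: "space P = discrete_radon_measures euclidean"
  using random_discrete
  by (auto simp: P_def space_restrict_space random_discrete_measure_def discrete_radon_measures_def)

lemma space_P_Rad: "\<eta> \<in> space P \<Longrightarrow> \<eta> \<in> X.Rad"
  by (auto simp: space_P discrete_radon_measures_def)

lemma sets_P_borel: "\<eta> \<in> space P \<Longrightarrow> sets \<eta> = sets borel"
  using X.RadD(2)[OF space_P_Rad] by (simp add: borel_of_euclidean)

lemma nn_integral_P: "(\<integral>\<^sup>+\<eta>. f \<eta> \<partial>P) = (\<integral>\<^sup>+\<eta>. f \<eta> \<partial>\<mu>)"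
proof -
  interpret prob_space \<mu> using random_discrete by (simp add: random_discrete_measure_def)
  have "emeasure \<mu> (discrete_radon_measures euclidean) = 1"
    using random_discrete by (simp add: random_discrete_measure_def)
  then have "prob (discrete_radon_measures euclidean) = 1" by (simp add: measure_def)
  then have "AE \<eta> in \<mu>. \<eta> \<in> discrete_radon_measures euclidean"
    using discrete_sets by (subst AE_in_set_eq_1) auto
  then have "(\<integral>\<^sup>+\<eta>. f \<eta> * indicator (discrete_radon_measures euclidean) \<eta> \<partial>\<mu>) = (\<integral>\<^sup>+\<eta>. f \<eta> \<partial>\<mu>)"
    by (intro nn_integral_cong_AE) (auto elim!: eventually_mono)
  then show ?thesis
    unfolding P_def using discrete_sets by (subst nn_integral_restrict_space) auto
qed

lemma emeasure_P_measurable: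
  assumes "A \<in> sets borel"
  shows "(\<lambda>\<eta>. emeasure \<eta> A) \<in> borel_measurable P"
proof -
  have "(\<lambda>\<eta>. emeasure \<eta> A) \<in> borel_measurable X.Vag"
    using assms by (intro X.emeasure_vague_measurable) (simp add: borel_of_euclidean)
  moreover have "sets \<mu> = sets X.Vag" using random_discrete by (simp add: random_discrete_measure_def)
  ultimately have "(\<lambda>\<eta>. emeasure \<eta> A) \<in> borel_measurable \<mu>" by (simp cong: measurable_cong_sets)
  then show ?thesis unfolding P_def by (rule measurable_restrict_space1)
qed

lemma nn_integral_P_kernel_measurable:
  assumes f: "f \<in> borel_measurable (P \<Otimes>\<^sub>M borel)"
  shows "(\<lambda>\<eta>. \<integral>\<^sup>+x. f (\<eta>, x) \<partial>\<eta>) \<in> borel_measurable P"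
proof (rule nn_integral_kernel_measurable[where B = X.E and N = borel])
  show "(\<Union>j. X.E j) = space borel" using X.UN_E by simp
qed (use X.E_sets X.RadD(3)[OF space_P_Rad] in
    \<open>auto simp: sets_P_borel emeasure_P_measurable X.incseq_E f borel_of_euclidean\<close>)

text \<open>The mass of \<open>{x}\<close> is the \<eta>-integral of the indicator of the diagonal
  at \<open>x\<close>, and the diagonal is the zero set of a distance. Applying the kernel lemma
  over the base \<open>P \<Otimes>\<^sub>M borel\<close> integrates out the third variable and keeps
  joint measurability in \<eta> and \<open>x\<close>.\<close>

lemma atom_measurable: "(\<lambda>(\<eta>, x). emeasure \<eta> {x}) \<in> borel_measurable (P \<Otimes>\<^sub>M (borel :: 'a measure))"
proof -
  let ?Q = "P \<Otimes>\<^sub>M (borel :: 'a measure)"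
  have fst: "fst q \<in> space P" if "q \<in> space ?Q" for q using that by (auto simp: space_pair_measure)
  let ?f = "\<lambda>z. indicator {z. dist (snd (fst z)) (snd z) = 0} z :: ennreal"
  have "?f \<in> borel_measurable (?Q \<Otimes>\<^sub>M (borel :: 'a measure))"
  proof (rule borel_measurable_indicator')
    show "{z \<in> space (?Q \<Otimes>\<^sub>M (borel :: 'a measure)). z \<in> {z. dist (snd (fst z)) (snd z) = 0}} \<in> sets (?Q \<Otimes>\<^sub>M borel)"
      unfolding mem_Collect_eq by measurable
  qed
  have "(\<lambda>q. \<integral>\<^sup>+x. ?f (q, x) \<partial>fst q) \<in> borel_measurable ?Q"
  proof (rule nn_integral_kernel_measurable[where B = X.E and N = borel])
    show "(\<lambda>q. emeasure (fst q) A) \<in> borel_measurable ?Q" if "A \<in> sets borel" for A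
      by (rule measurable_compose[OF measurable_fst emeasure_P_measurable[OF that]])
    show "(\<Union>j. X.E j) = space borel" using X.UN_E by simp
    show "?f \<in> borel_measurable (?Q \<Otimes>\<^sub>M (borel :: 'a measure))" by fact
  qed (use X.E_sets X.RadD(3)[OF space_P_Rad[OF fst]] in
      \<open>auto simp: sets_P_borel[OF fst] X.incseq_E borel_of_euclidean\<close>)
  moreover have "(\<integral>\<^sup>+x. ?f (q, x) \<partial>fst q) = (case q of (\<eta>, x) \<Rightarrow> emeasure \<eta> {x})" if "q \<in> space ?Q" for q
  proof -
    have "(\<integral>\<^sup>+x. ?f (q, x) \<partial>fst q) = (\<integral>\<^sup>+x. indicator {snd q} x \<partial>fst q)"
      by (intro nn_integral_cong) (auto simp: indicator_def)
    also have "\<dots> = emeasure (fst q) {snd q}"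
      using sets_P_borel[OF fst[OF that]] by simp
    finally show ?thesis by (simp add: case_prod_beta)
  qed
  ultimately show ?thesis by (subst measurable_cong[symmetric])
qed

lemma Y_Bor: "sets Y.Bor = {B \<in> sets borel. B \<subseteq> UNIV \<times> {0<..}}"
  using Y.sets_Bor by blast

text \<open>On a compact set \<open>C\<close> the second components are bounded below by some
  \<open>a > 0\<close>, so \<open>a\<close> times the number of marks in \<open>C\<close> is at most
  the \<eta>-mass of the compact projection of \<open>C\<close>.\<close>

lemma marks_Conf:
  assumes "\<eta> \<in> space P"
  shows "marks \<eta> \<in> Y.Conf"
  unfolding configurations_def
proof (intro CollectI conjI allI impI)
  show "marks \<eta> \<subseteq> topspace (top_of_set (UNIV \<times> {0<..}))" by (auto simp: marks_def)
  fix C :: "('a \<times> real) set" assume "compactin (top_of_set (UNIV \<times> {0<..})) C"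
  then have C: "compact C" "C \<subseteq> UNIV \<times> {0<..}" by (simp_all add: Y.compactin_S)
  have cf: "compact (fst ` C)" by (rule compact_continuous_image[OF continuous_on_fst[OF continuous_on_id] C(1)])
  have cs: "compact (snd ` C)" by (rule compact_continuous_image[OF continuous_on_snd[OF continuous_on_id] C(1)])
  show "finite (marks \<eta> \<inter> C)"
  proof (cases "C = {}")
    case False
    \<comment> \<open>The minimum is attained in \<open>C\<close>, and \<open>C\<close> lies over
      \<open>{0<..}\<close>; this is where the logarithmic metric keeps compact sets away from
      0.\<close>
    then obtain a where a: "a \<in> snd ` C" "\<forall>b\<in>snd ` C. a \<le> b" using compact_attains_inf[OF cs] by blast
    then have "a > 0" using C(2) by auto
    have "ennreal a * emeasure (count_space (marks \<eta>)) (marks \<eta> \<inter> C) =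
        (\<integral>\<^sup>+y. ennreal a * indicator (marks \<eta> \<inter> C) y \<partial>count_space (marks \<eta>))"
      by (rule nn_integral_cmult_indicator[symmetric]) simp
    also have "\<dots> \<le> (\<integral>\<^sup>+y. ennreal (snd y) * indicator (fst ` C) (fst y) \<partial>count_space (marks \<eta>))"
      using a(2) by (intro nn_integral_mono) (auto simp: indicator_def intro!: ennreal_leI)
    also have "\<dots> = (\<integral>\<^sup>+x. indicator (fst ` C) x \<partial>\<eta>)"
      using assms borel_compact[OF cf]
      by (intro discrete_radon_marks(2)[symmetric] borel_measurable_indicator) (simp_all add: space_P)
    also have "\<dots> = emeasure \<eta> (fst ` C)"
      using cf by (intro nn_integral_indicator) (simp add: sets_P_borel[OF assms] borel_compact)
    also have "\<dots> < \<infinity>" using X.RadD(4)[OF space_P_Rad[OF assms] cf] by simp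
    finally have "emeasure (count_space (marks \<eta>)) (marks \<eta> \<inter> C) < top"
      using \<open>a > 0\<close> by (auto simp: ennreal_mult_less_top)
    then show ?thesis by (auto simp: emeasure_count_space split: if_splits)
  qed simp
qed

text \<open>
  Joint measurability of \<open>\<eta> {x}\<close> enters through the identity
  \<open>#(marks \<eta> \<inter> B) = \<integral> 1\<^sub>B(x, \<eta> {x}) / \<eta> {x} d\<eta>(x)\<close>.
\<close>

theorem marks_measurable: "marks \<in> measurable P Y.CS"
proof (rule Y.configuration_space_measurableI)
  fix B assume B: "B \<in> sets Y.Bor"
  then have B': "B \<in> sets borel" "B \<subseteq> UNIV \<times> {0<..}" by (auto simp: Y_Bor)
  \<comment> \<open>Off the atoms the factor \<open>inverse 0\<close> is infinite, but then
    \<open>(x, 0)\<close> lies outside \<open>B\<close>, and the product is 0.\<close>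
  let ?g = "\<lambda>(\<eta>, x). indicator B (x, enn2real (emeasure \<eta> {x})) * inverse (emeasure \<eta> {x}) :: ennreal"
  note atom_measurable[measurable]
  have [measurable]: "(\<lambda>q. (snd q, enn2real (emeasure (fst q) {snd q}))) \<in> borel_measurable (P \<Otimes>\<^sub>M (borel :: 'a measure))"
    and [measurable]: "(\<lambda>q. emeasure (fst q) {snd q}) \<in> borel_measurable (P \<Otimes>\<^sub>M (borel :: 'a measure))"
    using atom_measurable by (simp_all add: case_prod_beta)
  have "?g \<in> borel_measurable (P \<Otimes>\<^sub>M borel)"
    unfolding case_prod_beta using B'(1) by measurable
  from nn_integral_P_kernel_measurable[OF this]
  have "(\<lambda>\<eta>. \<integral>\<^sup>+x. ?g (\<eta>, x) \<partial>\<eta>) \<in> borel_measurable P" .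
  moreover have "emeasure (counting (marks \<eta>) Y.Bor) B = (\<integral>\<^sup>+x. ?g (\<eta>, x) \<partial>\<eta>)" if \<eta>: "\<eta> \<in> space P" for \<eta>
  proof -
    have "(\<lambda>x. ?g (\<eta>, x)) \<in> borel_measurable borel"
      using \<open>?g \<in> borel_measurable (P \<Otimes>\<^sub>M borel)\<close> by (rule measurable_compose[OF measurable_Pair1'[OF \<eta>]])
    then have "(\<integral>\<^sup>+x. ?g (\<eta>, x) \<partial>\<eta>) = (\<integral>\<^sup>+y. ennreal (snd y) * ?g (\<eta>, fst y) \<partial>count_space (marks \<eta>))"
      using \<eta> by (intro discrete_radon_marks(2)) (simp add: space_P)
    also have "\<dots> = (\<integral>\<^sup>+y. indicator (B \<inter> marks \<eta>) y \<partial>count_space (marks \<eta>))"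
    proof (rule nn_integral_cong)
      fix y assume "y \<in> space (count_space (marks \<eta>))"
      then have y: "y \<in> marks \<eta>" by simp
      note a = marks_atom[OF y]
      have "ennreal (snd y) * inverse (ennreal (snd y)) = 1"
        using a by (simp add: inverse_ennreal ennreal_mult[symmetric])
      then show "ennreal (snd y) * ?g (\<eta>, fst y) = indicator (B \<inter> marks \<eta>) y"
        using a y by (simp add: indicator_def)
    qed
    also have "\<dots> = emeasure (counting (marks \<eta>) Y.Bor) B"
      using B Y.Conf_subset[OF marks_Conf[OF \<eta>]] by (simp add: emeasure_counting)
    finally show ?thesis by simp
  qed
  ultimately show "(\<lambda>\<eta>. emeasure (counting (marks \<eta>) Y.Bor) B) \<in> borel_measurable P"
    by (subst measurable_cong)
qed (rule marks_Conf)

end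

section \<open>The correlation measure\<close>

context random_discrete_moments begin

abbreviation "V \<equiv> (\<lambda>n. distinct_positions_space (euclidean :: 'a topology) n)"
abbreviation "DP \<equiv> (\<lambda>n. distinct_positions (euclidean :: 'a topology) n)"
abbreviation "DT \<equiv> (\<lambda>n \<eta>. distinct_tuples n (marks (\<eta> :: 'a measure)))"
abbreviation "\<nu> \<equiv> marked_point_process euclidean \<mu>"

lemma DP_eq: "DP n = {y \<in> PiE {..<n} (\<lambda>_. UNIV \<times> {0<..}). inj_on (\<lambda>i. fst (y i)) {..<n}}"
  unfolding distinct_positions_def off_diagonal_def marked_top_eq
  by (auto simp: inj_on_def restrict_PiE_iff)

lemma sets_power_marked: "sets (borel_of (power_topology n (marked_top (euclidean :: 'a topology)))) = sets (Y.Pow_Bor n)"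
  unfolding marked_top_eq by (rule sets_borel_of_power_topology)

lemma coordinate_borel: "i < n \<Longrightarrow> (\<lambda>y. y i) \<in> borel_measurable (Y.Pow_Bor n)"
  by (rule measurable_compose[OF Y.coordinate_measurable Y.Bor_borel])

lemma fst_coordinate: "i < n \<Longrightarrow> (\<lambda>y. fst (y i)) \<in> borel_measurable (Y.Pow_Bor n)"
  by (rule measurable_compose[OF coordinate_borel]) (auto intro!: borel_measurable_continuous_onI continuous_intros)

lemma snd_coordinate: "i < n \<Longrightarrow> (\<lambda>y. snd (y i)) \<in> borel_measurable (Y.Pow_Bor n)"
  by (rule measurable_compose[OF coordinate_borel]) (auto intro!: borel_measurable_continuous_onI continuous_intros)

lemma DP_sets: "DP n \<in> sets (Y.Pow_Bor n)"
proof -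
  have neq: "{y \<in> space (Y.Pow_Bor n). fst (y i) \<noteq> fst (y j)} \<in> sets (Y.Pow_Bor n)" if ij: "i < n" "j < n" for i j
  proof -
    have "(\<lambda>y. dist (fst (y i)) (fst (y j))) \<in> borel_measurable (Y.Pow_Bor n)"
      using ij by (intro borel_measurable_dist fst_coordinate)
    then have "{y \<in> space (Y.Pow_Bor n). dist (fst (y i)) (fst (y j)) \<noteq> 0} \<in> sets (Y.Pow_Bor n)"
      by measurable
    then show ?thesis by simp
  qed
  have "DP n = {y \<in> space (Y.Pow_Bor n). \<forall>i\<in>{..<n}. \<forall>j\<in>{..<n}. i \<noteq> j \<longrightarrow> fst (y i) \<noteq> fst (y j)}"
    unfolding DP_eq by (auto simp: inj_on_def space_PiM)
  also have "\<dots> \<in> sets (Y.Pow_Bor n)"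
    using neq by (intro sets.sets_Collect_finite_All sets.sets_Collect_imp sets.sets_Collect_const) auto
  finally show ?thesis .
qed

lemma DP_subset: "DP n \<subseteq> space (Y.Pow_Bor n)" by (rule sets.sets_into_space[OF DP_sets])

lemma sets_V [measurable_cong]: "sets (V n) = sets (restrict_space (Y.Pow_Bor n) (DP n))"
  unfolding distinct_positions_space_def by (rule sets_restrict_space_cong[OF sets_power_marked])

lemma space_V: "space (V n) = DP n"
  using sets_eq_imp_space_eq[OF sets_V[of n]] DP_subset[of n] by (simp add: space_restrict_space Int_absorb2)

lemma measurable_V: "f \<in> measurable (Y.Pow_Bor n) N \<Longrightarrow> f \<in> measurable (V n) N"
  unfolding measurable_cong_sets[OF sets_V refl] by (rule measurable_restrict_space1)

text \<open>By \<open>marks_functional\<close> it is the same for a tuple of marks to be off the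
  diagonals in the marked space or in its positions. This places the correlation measure on tuples
  with distinct positions.\<close>

lemma marks_tuples_inj:
  assumes "y \<in> PiE {..<n} (\<lambda>_. marks \<eta>)"
  shows "inj_on (\<lambda>i. fst (y i)) {..<n} \<longleftrightarrow> inj_on y {..<n}"
proof
  assume inj: "inj_on y {..<n}"
  show "inj_on (\<lambda>i. fst (y i)) {..<n}"
  proof (rule inj_onI)
    fix i j assume ij: "i \<in> {..<n}" "j \<in> {..<n}" "fst (y i) = fst (y j)"
    then have "y i = y j" using assms by (intro marks_functional[of _ \<eta>]) (auto simp: PiE_iff)
    then show "i = j" using inj ij by (simp add: inj_on_eq_iff)
  qed
qed (auto simp: inj_on_def)

lemma distinct_tuples_marks: "DT n \<eta> = PiE {..<n} (\<lambda>_. marks \<eta>) \<inter> DP n"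
proof (intro equalityI subsetI)
  fix y assume y: "y \<in> DT n \<eta>"
  then have y': "y \<in> PiE {..<n} (\<lambda>_. marks \<eta>)" "inj_on y {..<n}" by (auto simp: distinct_tuples_def)
  have "marks \<eta> \<subseteq> UNIV \<times> {0<..}" by (auto simp: marks_def)
  then have "y \<in> PiE {..<n} (\<lambda>_. UNIV \<times> {0<..})" using y'(1) PiE_mono by blast
  then show "y \<in> PiE {..<n} (\<lambda>_. marks \<eta>) \<inter> DP n"
    using y' marks_tuples_inj[OF y'(1)] by (simp add: DP_eq)
next
  fix y assume "y \<in> PiE {..<n} (\<lambda>_. marks \<eta>) \<inter> DP n"
  then show "y \<in> DT n \<eta>"
    using marks_tuples_inj[of y n \<eta>] by (simp add: DP_eq distinct_tuples_def)
qed

lemma distinct_tuples_marks_subset: "DT n \<eta> \<subseteq> space (V n)"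
  by (simp add: distinct_tuples_marks space_V)

lemma nn_integral_marks_measurable:
  assumes f: "f \<in> borel_measurable (V n)"
  shows "(\<lambda>\<eta>. \<integral>\<^sup>+y. f y \<partial>count_space (DT n \<eta>)) \<in> borel_measurable P"
proof -
  have "f \<in> borel_measurable (restrict_space (Y.Pow_Bor n) (DP n))"
    using f by (simp cong: measurable_cong_sets)
  then have "(\<lambda>y. f y * indicator (DP n) y) \<in> borel_measurable (Y.Pow_Bor n)"
    using DP_sets DP_subset by (subst (asm) borel_measurable_restrict_space_iff_ennreal) (simp_all add: Int_absorb2)
  from measurable_compose[OF marks_measurable Y.nn_integral_tuples_measurable[OF this]]
  have "(\<lambda>\<eta>. \<integral>\<^sup>+y. f y * indicator (DP n) y \<partial>count_space (PiE {..<n} (\<lambda>_. marks \<eta>))) \<in> borel_measurable P" .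
  moreover have "(\<integral>\<^sup>+y. f y * indicator (DP n) y \<partial>count_space (PiE {..<n} (\<lambda>_. marks \<eta>))) =
      (\<integral>\<^sup>+y. f y \<partial>count_space (DT n \<eta>))" for \<eta>
    unfolding distinct_tuples_marks
    by (subst (1 2) nn_integral_count_space_indicator) (auto intro!: nn_integral_cong simp: indicator_def)
  ultimately show ?thesis by simp
qed

text \<open>In the language of point processes: the \<open>n\<close>-th factorial moment measure of
  the marked process, divided by \<open>fact n\<close>.\<close>

definition tuple_measure :: "nat \<Rightarrow> (nat \<Rightarrow> 'a \<times> real) measure" where
  "tuple_measure n = scale_measure (1 / fact n)
     (mixture P (\<lambda>\<eta>. counting (DT n \<eta>) (V n)) (V n))"

lemma sets_tuple_measure [simp, measurable_cong]: "sets (tuple_measure n) = sets (V n)"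
  by (simp add: tuple_measure_def)

lemma space_tuple_measure: "space (tuple_measure n) = DP n"
  by (simp add: tuple_measure_def space_scale_measure space_V)

lemma nn_integral_tuple_measure:
  assumes f: "f \<in> borel_measurable (V n)"
  shows "(\<integral>\<^sup>+y. f y \<partial>tuple_measure n) =
    1 / fact n * (\<integral>\<^sup>+\<eta>. \<integral>\<^sup>+y. f y \<partial>count_space (DT n \<eta>) \<partial>P)"
proof -
  note sub = distinct_tuples_marks_subset
  let ?m = "mixture P (\<lambda>\<eta>. counting (DT n \<eta>) (V n)) (V n)"
  have "(\<integral>\<^sup>+y. f y \<partial>?m) = (\<integral>\<^sup>+\<eta>. \<integral>\<^sup>+y. f y \<partial>counting (DT n \<eta>) (V n) \<partial>P)"
  proof (rule conjunct2[OF nn_integral_mixture[OF _ _ f]])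
    fix A assume A: "A \<in> sets (V n)"
    have "(\<lambda>\<eta>. \<integral>\<^sup>+y. indicator A y \<partial>count_space (DT n \<eta>)) \<in> borel_measurable P"
      using A by (intro nn_integral_marks_measurable) simp
    moreover have "emeasure (counting (DT n \<eta>) (V n)) A =
        (\<integral>\<^sup>+y. indicator A y \<partial>count_space (DT n \<eta>))" for \<eta>
      using nn_integral_counting[OF sub, OF borel_measurable_indicator[OF A], of \<eta>] A by simp
    ultimately show "(\<lambda>\<eta>. emeasure (counting (DT n \<eta>) (V n)) A) \<in> borel_measurable P"
      by simp
  qed simp
  also have "\<dots> = (\<integral>\<^sup>+\<eta>. \<integral>\<^sup>+y. f y \<partial>count_space (DT n \<eta>) \<partial>P)"
    by (simp add: nn_integral_counting[OF sub f])
  finally show ?thesis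
    unfolding tuple_measure_def using f by (subst nn_integral_scale_measure) auto
qed

text \<open>Permuting coordinates is a bijection of the distinct tuples of each configuration, so
  invariance holds before averaging.\<close>

lemma symmetric_tuple_measure: "symmetric_measure n (tuple_measure n)"
  unfolding symmetric_measure_def
proof (intro allI impI)
  fix \<pi> assume \<pi>: "\<pi> permutes {..<n}"
  let ?T = "\<lambda>x. \<lambda>i\<in>{..<n}. x (\<pi> i)"
  have p: "\<pi> i < n" if "i < n" for i using that permutes_in_image[OF \<pi>, of i] by simp
  have "?T \<in> measurable (Y.Pow_Bor n) (Y.Pow_Bor n)"
    using p by (intro measurable_restrict Y.coordinate_measurable) auto
  then have "?T \<in> measurable (V n) (Y.Pow_Bor n)" by (rule measurable_V)
  moreover have "?T \<in> space (V n) \<rightarrow> DP n"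
  proof
    fix y assume "y \<in> space (V n)"
    then have y: "y \<in> PiE {..<n} (\<lambda>_. UNIV \<times> {0<..})" "inj_on (\<lambda>i. fst (y i)) {..<n}"
      by (simp_all add: space_V DP_eq)
    have "inj_on ((\<lambda>i. fst (y i)) \<circ> \<pi>) {..<n}"
      using y(2) permutes_image[OF \<pi>] permutes_inj_on[OF \<pi>] by (intro comp_inj_on) simp_all
    then show "?T y \<in> DP n" using y(1) p by (auto simp: DP_eq PiE_iff inj_on_def)
  qed
  ultimately have T: "?T \<in> measurable (V n) (V n)"
    by (subst measurable_cong_sets[OF refl sets_V]) (intro measurable_restrict_space2)
  show "distr (tuple_measure n) (tuple_measure n) ?T = tuple_measure n"
  proof (rule measure_eqI)
    fix A assume "A \<in> sets (distr (tuple_measure n) (tuple_measure n) ?T)"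
    then have A: "A \<in> sets (V n)" by simp
    have "emeasure (distr (tuple_measure n) (tuple_measure n) ?T) A =
        (\<integral>\<^sup>+y. indicator A y \<partial>distr (tuple_measure n) (tuple_measure n) ?T)" using A by simp
    also have "\<dots> = (\<integral>\<^sup>+y. indicator A (?T y) \<partial>tuple_measure n)"
      using T A by (subst nn_integral_distr) (auto cong: measurable_cong_sets)
    also have "\<dots> = 1 / fact n * (\<integral>\<^sup>+\<eta>. \<integral>\<^sup>+y. indicator A (?T y) \<partial>count_space (DT n \<eta>) \<partial>P)"
      using measurable_compose[OF T borel_measurable_indicator[OF A]] by (rule nn_integral_tuple_measure)
    also have "\<dots> = 1 / fact n * (\<integral>\<^sup>+\<eta>. \<integral>\<^sup>+y. indicator A y \<partial>count_space (DT n \<eta>) \<partial>P)"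
      by (simp only: nn_integral_bij_count_space[OF permuted_tuple_bij[OF \<pi>], where f = "indicator A"])
    also have "\<dots> = (\<integral>\<^sup>+y. indicator A y \<partial>tuple_measure n)"
      using A by (intro nn_integral_tuple_measure[symmetric]) simp
    also have "\<dots> = emeasure (tuple_measure n) A" using A by simp
    finally show "emeasure (distr (tuple_measure n) (tuple_measure n) ?T) A = emeasure (tuple_measure n) A" .
  qed simp
qed

lemma \<nu>_eq: "\<nu> = distr P Y.CS marks"
  by (simp add: marked_point_process_def P_def marked_top_eq)

text \<open>The defining identity of a correlation measure, read for indicators, dictates this
  candidate: the mean number of finite subconfigurations lying in a given set.\<close>

definition corr :: "('a \<times> real) set measure" where
  "corr = mixture P (\<lambda>\<eta>. counting {\<zeta>. \<zeta> \<subseteq> marks \<eta> \<and> finite \<zeta>} Y.FC) Y.FC"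

lemma finite_subsets_FC: "\<eta> \<in> space P \<Longrightarrow> {\<zeta>. \<zeta> \<subseteq> marks \<eta> \<and> finite \<zeta>} \<subseteq> space Y.FC"
  using marks_Conf configurations_subset by (auto simp: space_finite_configuration_space)

lemma nn_integral_corr:
  assumes G: "G \<in> borel_measurable Y.FC"
  shows "(\<integral>\<^sup>+\<zeta>. G \<zeta> \<partial>corr) = (\<integral>\<^sup>+\<eta>. \<integral>\<^sup>+\<zeta>. G \<zeta> \<partial>count_space {\<zeta>. \<zeta> \<subseteq> marks \<eta> \<and> finite \<zeta>} \<partial>P)"
proof -
  let ?c = "\<lambda>\<eta>. counting {\<zeta>. \<zeta> \<subseteq> marks \<eta> \<and> finite \<zeta>} Y.FC"
  have "(\<integral>\<^sup>+\<zeta>. G \<zeta> \<partial>corr) = (\<integral>\<^sup>+\<eta>. \<integral>\<^sup>+\<zeta>. G \<zeta> \<partial>?c \<eta> \<partial>P)"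
    unfolding corr_def
  proof (rule conjunct2[OF nn_integral_mixture[OF _ _ G]])
    fix A assume A: "A \<in> sets Y.FC"
    have "(\<lambda>\<eta>. \<integral>\<^sup>+\<zeta>. indicator A \<zeta> \<partial>count_space {\<zeta>. \<zeta> \<subseteq> marks \<eta> \<and> finite \<zeta>}) \<in> borel_measurable P"
      by (rule measurable_compose[OF marks_measurable Y.nn_integral_finite_subsets_measurable[OF borel_measurable_indicator[OF A]]])
    then show "(\<lambda>\<eta>. emeasure (?c \<eta>) A) \<in> borel_measurable P"
    proof (rule measurable_cong[THEN iffD1, rotated])
      fix \<eta> assume "\<eta> \<in> space P"
      from nn_integral_counting[OF finite_subsets_FC[OF this] borel_measurable_indicator[OF A]] A
      show "(\<integral>\<^sup>+\<zeta>. indicator A \<zeta> \<partial>count_space {\<zeta>. \<zeta> \<subseteq> marks \<eta> \<and> finite \<zeta>}) = emeasure (?c \<eta>) A" by simp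
    qed
  qed simp
  also have "\<dots> = (\<integral>\<^sup>+\<eta>. \<integral>\<^sup>+\<zeta>. G \<zeta> \<partial>count_space {\<zeta>. \<zeta> \<subseteq> marks \<eta> \<and> finite \<zeta>} \<partial>P)"
    by (intro nn_integral_cong nn_integral_counting finite_subsets_FC G)
  finally show ?thesis .
qed

lemma is_correlation_corr: "is_correlation_measure (marked_top euclidean) \<nu> corr"
  unfolding is_correlation_measure_def marked_top_eq
proof (intro conjI allI impI)
  fix G :: "('a \<times> real) set \<Rightarrow> ennreal" assume G: "G \<in> borel_measurable Y.FC"
  show "(\<integral>\<^sup>+\<gamma>. \<integral>\<^sup>+\<zeta>. G \<zeta> \<partial>count_space {\<zeta>. \<zeta> \<subseteq> \<gamma> \<and> finite \<zeta>} \<partial>\<nu>) = (\<integral>\<^sup>+\<zeta>. G \<zeta> \<partial>corr)"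
    unfolding \<nu>_eq nn_integral_corr[OF G]
    by (rule nn_integral_distr[OF marks_measurable])
      (simp add: Y.nn_integral_finite_subsets_measurable[OF G])
qed (simp_all add: corr_def)

text \<open>Indicators among the test functions \<open>G\<close> determine the measure, so the
  definite description denotes \<open>corr\<close>.\<close>

lemma correlation_measure_eq: "correlation_measure (marked_top euclidean) \<nu> = corr"
  unfolding correlation_measure_def
proof (rule the_equality, rule is_correlation_corr)
  fix \<rho> assume \<rho>: "is_correlation_measure (marked_top euclidean) \<nu> \<rho>"
  note corr = is_correlation_corr
  have sets: "sets \<rho> = sets (finite_configuration_space (marked_top euclidean))"
    "sets corr = sets (finite_configuration_space (marked_top euclidean))"
    using \<rho> corr by (simp_all add: is_correlation_measure_def)
  show "\<rho> = corr"
  proof (rule measure_eqI)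
    fix A assume "A \<in> sets \<rho>"
    then have A: "A \<in> sets (finite_configuration_space (marked_top euclidean))" by (simp add: sets)
    then have "indicator A \<in> borel_measurable (finite_configuration_space (marked_top (euclidean :: 'a topology)))" by simp
    with \<rho> corr have "(\<integral>\<^sup>+\<zeta>. indicator A \<zeta> \<partial>\<rho>) = (\<integral>\<^sup>+\<zeta>. indicator A \<zeta> \<partial>corr)"
      unfolding is_correlation_measure_def by (metis (no_types, lifting))
    then show "emeasure \<rho> A = emeasure corr A" using A by (simp add: sets)
  qed (simp add: sets)
qed

lemma range_measurable_V: "(\<lambda>y. y ` {..<n}) \<in> measurable (V n) Y.FC"
proof -
  have "DP n \<subseteq> {y. inj_on y {..<n}}" by (auto simp: DP_eq inj_on_def)
  from measurable_restrict_mono[OF Y.range_measurable[unfolded Y.Inj_Bor_def] this]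
  show ?thesis by (simp cong: measurable_cong_sets)
qed

lemma nn_integral_n_subsets:
  fixes H :: "'b set \<Rightarrow> ennreal"
  shows "(\<integral>\<^sup>+\<zeta>. H \<zeta> \<partial>count_space {\<zeta>. \<zeta> \<subseteq> \<gamma> \<and> finite \<zeta> \<and> card \<zeta> = n}) =
    1 / fact n * (\<integral>\<^sup>+y. H (y ` {..<n}) \<partial>count_space (distinct_tuples n \<gamma>))"
  by (simp only: nn_integral_subsets_eq_tuples mult.assoc[symmetric] ennreal_fact_cancel mult_1)

text \<open>The last two clauses rest on \<open>nn_integral_n_subsets\<close>: for each
  configuration a sum over \<open>n\<close>-point subsets is a normalised sum over distinct tuples,
  and averaging over \<open>P\<close> gives the two measures.\<close>

theorem represents_correlation_tuple_measure:
  "represents_correlation (marked_top euclidean) \<nu> n (tuple_measure n)"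
  unfolding represents_correlation_def correlation_measure_eq
proof (intro conjI allI impI)
  show "symmetric_measure n (tuple_measure n)" by (rule symmetric_tuple_measure)
  let ?N = "n_point_configurations (top_of_set (UNIV \<times> {0<..} :: ('a \<times> real) set)) n"
  let ?R = "\<lambda>y::nat \<Rightarrow> 'a \<times> real. y ` {..<n}"
  have N: "?N \<in> sets Y.FC" by (rule Y.n_point_configurations_sets)
  have "?R \<in> space (V n) \<rightarrow> ?N"
  proof
    fix y assume y: "y \<in> space (V n)"
    then have "?R y \<in> Y.Conf"
      using measurable_space[OF range_measurable_V y] by (simp add: space_finite_configuration_space)
    moreover have "inj_on y {..<n}" using y by (auto simp: space_V DP_eq inj_on_def)
    ultimately show "?R y \<in> ?N" by (simp add: n_point_configurations_def card_image)
  qed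
  then have R: "?R \<in> measurable (V n) (restrict_space Y.FC ?N)"
    by (intro measurable_restrict_space2 range_measurable_V)
  have "restrict_space corr ?N = distr (tuple_measure n) (restrict_space Y.FC ?N) ?R"
  proof (rule measure_eqI)
    show sets: "sets (restrict_space corr ?N) = sets (distr (tuple_measure n) (restrict_space Y.FC ?N) ?R)"
      by (simp add: corr_def sets_restrict_space)
    fix A assume A0: "A \<in> sets (restrict_space corr ?N)"
    then have A1: "A \<in> sets (restrict_space Y.FC ?N)" using sets by simp
    then have A: "A \<in> sets Y.FC" "A \<subseteq> ?N"
      using N sets.sets_into_space[OF N] by (auto simp: sets_restrict_space_iff Int_absorb2)
    have "emeasure (restrict_space corr ?N) A = emeasure corr A"
      using N sets.sets_into_space[OF N] A by (intro emeasure_restrict_space) (auto simp: corr_def Int_absorb2)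
    also have "\<dots> = (\<integral>\<^sup>+\<zeta>. indicator A \<zeta> \<partial>corr)" using A by (simp add: corr_def)
    also have "\<dots> = (\<integral>\<^sup>+\<eta>. \<integral>\<^sup>+\<zeta>. indicator A \<zeta> \<partial>count_space {\<zeta>. \<zeta> \<subseteq> marks \<eta> \<and> finite \<zeta>} \<partial>P)"
      using A by (intro nn_integral_corr) simp
    also have "\<dots> = (\<integral>\<^sup>+\<eta>. 1 / fact n * (\<integral>\<^sup>+y. indicator A (?R y) \<partial>count_space (DT n \<eta>)) \<partial>P)"
    proof (rule nn_integral_cong)
      fix \<eta> assume "\<eta> \<in> space P"
      \<comment> \<open>\<open>A\<close> consists of \<open>n\<close>-point configurations, so
        subsets of other sizes contribute nothing.\<close>
      have "card \<zeta> = n" if "\<zeta> \<in> A" for \<zeta> using A(2) that by (auto simp: n_point_configurations_def)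
      then have "(\<integral>\<^sup>+\<zeta>. indicator A \<zeta> \<partial>count_space {\<zeta>. \<zeta> \<subseteq> marks \<eta> \<and> finite \<zeta>}) =
          (\<integral>\<^sup>+\<zeta>. indicator A \<zeta> \<partial>count_space {\<zeta>. \<zeta> \<subseteq> marks \<eta> \<and> finite \<zeta> \<and> card \<zeta> = n})"
        by (subst (1 2) nn_integral_count_space_indicator) (auto intro!: nn_integral_cong simp: indicator_def)
      then show "(\<integral>\<^sup>+\<zeta>. indicator A \<zeta> \<partial>count_space {\<zeta>. \<zeta> \<subseteq> marks \<eta> \<and> finite \<zeta>}) =
          1 / fact n * (\<integral>\<^sup>+y. indicator A (?R y) \<partial>count_space (DT n \<eta>))"
        by (simp only: nn_integral_n_subsets)
    qed
    also have "\<dots> = 1 / fact n * (\<integral>\<^sup>+\<eta>. \<integral>\<^sup>+y. indicator A (?R y) \<partial>count_space (DT n \<eta>) \<partial>P)"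
      by (intro nn_integral_cmult nn_integral_marks_measurable
          measurable_compose[OF range_measurable_V borel_measurable_indicator[OF A(1)]])
    also have "\<dots> = (\<integral>\<^sup>+y. indicator A (?R y) \<partial>tuple_measure n)"
      by (intro nn_integral_tuple_measure[symmetric]
          measurable_compose[OF range_measurable_V borel_measurable_indicator[OF A(1)]])
    also have "\<dots> = (\<integral>\<^sup>+\<zeta>. indicator A \<zeta> \<partial>distr (tuple_measure n) (restrict_space Y.FC ?N) ?R)"
      using R A1 by (subst nn_integral_distr) (auto cong: measurable_cong_sets)
    also have "\<dots> = emeasure (distr (tuple_measure n) (restrict_space Y.FC ?N) ?R) A" using A1 by simp
    finally show "emeasure (restrict_space corr ?N) A = emeasure (distr (tuple_measure n) (restrict_space Y.FC ?N) ?R) A" .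
  qed
  then show "restrict_space corr (n_point_configurations (marked_top euclidean) n) =
      distr (tuple_measure n) (restrict_space (finite_configuration_space (marked_top euclidean))
        (n_point_configurations (marked_top euclidean) n)) (\<lambda>y. y ` {..<n})"
    by (simp only: marked_top_eq)
next
  fix f :: "(nat \<Rightarrow> 'a \<times> real) \<Rightarrow> ennreal"
  assume "f \<in> borel_measurable (borel_of (power_topology n (marked_top euclidean)))"
  then have f: "f \<in> borel_measurable (Y.Pow_Bor n)" using sets_power_marked by (simp cong: measurable_cong_sets)
  assume "symmetric_function (marked_top euclidean) n f"
  then have sym: "f (\<lambda>i\<in>{..<n}. y (\<pi> i)) = f y" if "\<pi> permutes {..<n}" "y \<in> PiE {..<n} (\<lambda>_. UNIV \<times> {0<..})" for \<pi> y
    using that by (simp add: symmetric_function_def marked_top_eq)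
  have inner: "(\<integral>\<^sup>+\<zeta>. f (enumeration n \<zeta>) \<partial>count_space {\<zeta>. \<zeta> \<subseteq> \<gamma> \<and> finite \<zeta> \<and> card \<zeta> = n}) =
      1 / fact n * (\<integral>\<^sup>+y. f y \<partial>count_space (distinct_tuples n \<gamma>))" if \<gamma>: "\<gamma> \<in> Y.Conf" for \<gamma>
  proof -
    \<comment> \<open>The chosen enumeration of the range of \<open>y\<close> is \<open>y\<close> up
      to a permutation, and \<open>f\<close> is symmetric.\<close>
    have "f (enumeration n (y ` {..<n})) = f y" if y: "y \<in> distinct_tuples n \<gamma>" for y
    proof -
      have "y \<in> distinct_tuples n \<gamma> \<and> y ` {..<n} = y ` {..<n}" using y by simp
      then have e: "y \<in> extensional {..<n}" "bij_betw y {..<n} (y ` {..<n})" unfolding distinct_tuples_iff by auto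
      have fin: "finite (y ` {..<n})" "card (y ` {..<n}) = n"
        using bij_betw_same_card[OF e(2)] by simp_all
      from enumerations_differ_by_permutation[OF enumeration_props[OF fin] e]
      obtain \<pi> where \<pi>: "\<pi> permutes {..<n}" "enumeration n (y ` {..<n}) = (\<lambda>i\<in>{..<n}. y (\<pi> i))" by blast
      have "y \<in> PiE {..<n} (\<lambda>_. UNIV \<times> {0<..})"
        using y Y.Conf_subset[OF \<gamma>] unfolding distinct_tuples_def PiE_iff by blast
      from sym[OF \<pi>(1) this] show ?thesis by (simp only: \<pi>(2))
    qed
    then show ?thesis unfolding nn_integral_n_subsets
      by (intro arg_cong[where f = "\<lambda>z. 1 / fact n * z"] nn_integral_cong) simp
  qed
  have fI: "f \<in> borel_measurable (Y.Inj_Bor n)"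
    unfolding Y.Inj_Bor_def by (rule measurable_restrict_space1[OF f])
  have fV: "f \<in> borel_measurable (V n)" by (rule measurable_V[OF f])
  have "(\<integral>\<^sup>+\<gamma>. (\<integral>\<^sup>+\<zeta>. f (enumeration n \<zeta>) \<partial>count_space {\<zeta>. \<zeta> \<subseteq> \<gamma> \<and> finite \<zeta> \<and> card \<zeta> = n}) \<partial>\<nu>) =
      (\<integral>\<^sup>+\<gamma>. 1 / fact n * (\<integral>\<^sup>+y. f y \<partial>count_space (distinct_tuples n \<gamma>)) \<partial>\<nu>)"
    using inner by (intro nn_integral_cong) (simp add: \<nu>_eq space_configuration_space)
  also have "\<dots> = (\<integral>\<^sup>+\<eta>. 1 / fact n * (\<integral>\<^sup>+y. f y \<partial>count_space (DT n \<eta>)) \<partial>P)"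
    unfolding \<nu>_eq
    by (rule nn_integral_distr[OF marks_measurable])
      (intro borel_measurable_times_ennreal borel_measurable_const,
        simp add: Y.nn_integral_distinct_tuples_measurable[OF fI])
  also have "\<dots> = 1 / fact n * (\<integral>\<^sup>+\<eta>. \<integral>\<^sup>+y. f y \<partial>count_space (DT n \<eta>) \<partial>P)"
    by (intro nn_integral_cmult nn_integral_marks_measurable fV)
  also have "\<dots> = (\<integral>\<^sup>+y. f y \<partial>tuple_measure n)" by (rule nn_integral_tuple_measure[OF fV, symmetric])
  finally show "(\<integral>\<^sup>+\<gamma>. (\<integral>\<^sup>+\<zeta>. f (enumeration n \<zeta>) \<partial>count_space {\<zeta>. \<zeta> \<subseteq> \<gamma> \<and> finite \<zeta> \<and> card \<zeta> = n}) \<partial>\<nu>) =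
      (\<integral>\<^sup>+y. f y \<partial>tuple_measure n)" .
qed

end

section \<open>Moment measures\<close>

lemma rel_compact_borel_euclidean:
  "A \<in> rel_compact_borel (euclidean :: 'a::topological_space topology) \<longleftrightarrow> A \<in> sets borel \<and> compact (closure A)"
  by (simp add: rel_compact_borel_def borel_of_euclidean)

lemma rel_compact_borel_subset:
  fixes A :: "'a::t2_space set"
  assumes "A \<in> sets borel" "A \<subseteq> K" "compact K"
  shows "A \<in> rel_compact_borel euclidean"
proof -
  have "closure A \<subseteq> K" using assms(2,3) by (intro closure_minimal compact_imp_closed)
  then have "compact (K \<inter> closure A)" using assms(3) by (intro compact_Int_closed) auto
  then show ?thesis using \<open>closure A \<subseteq> K\<close> assms(1) by (simp add: rel_compact_borel_euclidean Int_absorb1)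
qed

lemma rel_compact_borel_Int:
  fixes A :: "'a::t2_space set"
  assumes "A \<in> rel_compact_borel euclidean" "B \<in> sets borel"
  shows "A \<inter> B \<in> rel_compact_borel euclidean"
  using assms closure_subset[of A] unfolding rel_compact_borel_euclidean[of A]
  by (intro rel_compact_borel_subset[of _ "closure A"]) auto

text \<open>Tonelli for counting measures: countability makes the factors sigma-finite, and their
  product is the counting measure on tuples.\<close>

lemma nn_integral_tuples_prod:
  fixes n :: nat
  assumes "countable \<gamma>"
  shows "(\<integral>\<^sup>+y. (\<Prod>j<n. g j (y j)) \<partial>count_space (PiE {..<n} (\<lambda>_. \<gamma>))) =
    (\<Prod>j<n. \<integral>\<^sup>+y. g j y \<partial>count_space \<gamma>)"
proof -
  interpret product_sigma_finite "\<lambda>_::nat. count_space \<gamma>"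
    using assms by (intro product_sigma_finite.intro sigma_finite_measure_count_space_countable)
  have "(\<integral>\<^sup>+y. (\<Prod>j<n. g j (y j)) \<partial>PiM {..<n} (\<lambda>_. count_space \<gamma>)) = (\<Prod>j<n. \<integral>\<^sup>+y. g j y \<partial>count_space \<gamma>)"
    by (rule product_nn_integral_prod) auto
  also have "PiM {..<n} (\<lambda>_. count_space \<gamma>) = count_space (PiE {..<n} (\<lambda>_. \<gamma>))"
    using assms by (intro count_space_PiM_finite) auto
  finally show ?thesis .
qed

lemma nn_integral_count_space_restrict:
  "(\<integral>\<^sup>+y. g y * indicator B y \<partial>count_space A) = (\<integral>\<^sup>+y. g y \<partial>count_space (A \<inter> B))"
  by (subst (1 2) nn_integral_count_space_indicator) (auto intro!: nn_integral_cong simp: indicator_def)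

text \<open>The labels of the positions in a repeated tuple. Separating labels from values makes
  \<open>repeat_coords\<close> a composition with an index map, usable for points and for marks
  alike.\<close>

definition block_index :: "nat \<Rightarrow> (nat \<Rightarrow> nat) \<Rightarrow> nat list" where
  "block_index k i = concat (map (\<lambda>l. replicate (i l) l) [0..<k])"

lemma length_block_index: "length (block_index k i) = (\<Sum>l<k. i l)"
  by (induction k) (auto simp: block_index_def)

lemma set_block_index: "set (block_index k i) = {l. l < k \<and> 0 < i l}"
  by (auto simp: block_index_def)

lemma repeat_coords_eq: "repeat_coords k i x = (\<lambda>j\<in>{..<(\<Sum>l<k. i l)}. x (block_index k i ! j))"
proof -
  have "concat (map (\<lambda>l. replicate (i l) (x l)) [0..<k]) = map x (block_index k i)"
    by (simp add: block_index_def map_concat comp_def)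
  then show ?thesis
    unfolding repeat_coords_def by (auto simp: length_block_index intro!: restrict_ext)
qed

lemma prod_block_index:
  fixes h :: "nat \<Rightarrow> 'a::comm_monoid_mult"
  shows "(\<Prod>j<(\<Sum>l<k. i l). h (block_index k i ! j)) = (\<Prod>l<k. h l ^ i l)"
proof -
  have "(\<Prod>j<(\<Sum>l<k. i l). h (block_index k i ! j)) = prod_list (map h (block_index k i))"
    by (auto simp: prod.list_conv_set_nth length_block_index atLeast0LessThan intro!: prod.cong)
  also have "\<dots> = (\<Prod>l<k. h l ^ i l)"
    by (induction k) (auto simp: block_index_def prod_list_replicate)
  finally show ?thesis .
qed

context random_discrete_moments begin

section \<open>Moment measures as mean tensor powers\<close>

abbreviation "BX \<equiv> (\<lambda>n::nat. PiM {..<n} (\<lambda>_. borel :: 'a measure))"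
abbreviation "positions \<equiv> (\<lambda>(n::nat) (y :: nat \<Rightarrow> 'a \<times> real). \<lambda>i\<in>{..<n}. fst (y i))"
abbreviation "MT \<equiv> (\<lambda>(n::nat) \<eta>. PiE {..<n} (\<lambda>_. marks (\<eta> :: 'a measure)))"
abbreviation "weights \<equiv> (\<lambda>(n::nat) (y :: nat \<Rightarrow> 'a \<times> real). \<lambda>i\<in>{..<n}. snd (y i))"
abbreviation "mass \<equiv> (\<lambda>(n::nat) (y :: nat \<Rightarrow> 'a \<times> real). \<Prod>i<n. ennreal (snd (y i)))"

lemma sets_power_X: "sets (borel_of (power_topology n (euclidean :: 'a topology))) = sets (BX n)"
  using sets_borel_of_power_topology[of n "UNIV :: 'a set"] by (simp add: borel_of_euclidean)

lemma positions_measurable: "positions n \<in> measurable (Y.Pow_Bor n) (BX n)"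
  by (intro measurable_restrict fst_coordinate) simp

lemma mass_measurable: "mass n \<in> borel_measurable (Y.Pow_Bor n)"
  by (intro borel_measurable_prod_ennreal measurable_compose[OF snd_coordinate measurable_ennreal]) simp

lemma marks_tuples_subset: "\<eta> \<in> space P \<Longrightarrow> MT n \<eta> \<subseteq> space (Y.Pow_Bor n)"
  by (rule Y.tuples_subset[OF marks_Conf])

lemma E_rel_compact: "X.E j \<in> rel_compact_borel euclidean"
proof -
  obtain K where "compact K" "X.E j \<subseteq> K" using X.E_compact by blast
  then show ?thesis using X.open_E by (intro rel_compact_borel_subset[of _ K]) auto
qed

text \<open>Moment measures are specified on these rectangles only. They generate, because a
  cylinder over a Borel set is the union of its traces on the boxes of the exhaustion.\<close>

lemma sigma_rel_compact_rectangles: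
  "sets (BX n) = sigma_sets (PiE {..<n} (\<lambda>_. UNIV)) {PiE {..<n} A | A. \<forall>i<n. A i \<in> rel_compact_borel euclidean}"
    (is "_ = sigma_sets ?\<Omega> ?G")
proof
  have "?G \<subseteq> sets (BX n)"
    by (auto intro!: sets_PiM_I_finite simp: rel_compact_borel_euclidean)
  from sets.sigma_sets_subset[OF this] show "sigma_sets ?\<Omega> ?G \<subseteq> sets (BX n)" by (simp add: space_PiM)
  have "{{f \<in> \<Pi>\<^sub>E i\<in>{..<n}. space (borel :: 'a measure). f i \<in> A} | i A. i \<in> {..<n} \<and> A \<in> sets (borel :: 'a measure)} \<subseteq> sigma_sets ?\<Omega> ?G"
  proof
    fix Z assume "Z \<in> {{f \<in> \<Pi>\<^sub>E i\<in>{..<n}. space (borel :: 'a measure). f i \<in> A} | i A. i \<in> {..<n} \<and> A \<in> sets (borel :: 'a measure)}"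
    then obtain i A where Z: "Z = {f \<in> \<Pi>\<^sub>E i\<in>{..<n}. space borel. f i \<in> A}"
      and i: "i \<in> {..<n}" and A: "A \<in> sets (borel :: 'a measure)" by blast
    \<comment> \<open>Side \<open>i\<close> is cut down to \<open>A\<close>, the others only to the
      exhaustion; a tuple of the cylinder has finite range and therefore lies in some
      \<open>R j\<close>.\<close>
    define R where "R j = PiE {..<n} (\<lambda>k. if k = i then X.E j \<inter> A else X.E j)" for j
    have "R j \<in> ?G" for j
    proof -
      have "\<forall>k<n. (if k = i then X.E j \<inter> A else X.E j) \<in> rel_compact_borel euclidean"
        using E_rel_compact rel_compact_borel_Int[OF E_rel_compact A] by simp
      then show ?thesis unfolding R_def by blast
    qed
    then have "(\<Union>j. R j) \<in> sigma_sets ?\<Omega> ?G" by (intro sigma_sets.Union sigma_sets.Basic)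
    also have "(\<Union>j. R j) = {f \<in> \<Pi>\<^sub>E i\<in>{..<n}. space borel. f i \<in> A}"
    proof (intro equalityI subsetI)
      fix f assume "f \<in> (\<Union>j. R j)"
      then obtain j where f: "f \<in> R j" by blast
      have "f i \<in> (if i = i then X.E j \<inter> A else X.E j)" using f[unfolded R_def] i by (rule PiE_mem)
      moreover have "f \<in> extensional {..<n}" using f by (simp add: R_def PiE_iff)
      ultimately show "f \<in> {f \<in> \<Pi>\<^sub>E i\<in>{..<n}. space borel. f i \<in> A}" by (simp add: PiE_iff)
    next
      fix f assume f: "f \<in> {f \<in> \<Pi>\<^sub>E i\<in>{..<n}. space borel. f i \<in> A}"
      have "compact (f ` {..<n})" by (intro finite_imp_compact) simp
      then obtain j where j: "f ` {..<n} \<subseteq> X.E j" using X.compact_subset_E by blast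
      have "f \<in> R j" unfolding R_def PiE_iff
      proof (intro conjI ballI)
        fix k assume k: "k \<in> {..<n}"
        then have "f k \<in> X.E j" using j by blast
        then show "f k \<in> (if k = i then X.E j \<inter> A else X.E j)" using f by (cases "k = i") auto
      qed (use f in \<open>simp add: PiE_iff\<close>)
      then show "f \<in> (\<Union>j. R j)" by blast
    qed
    finally show "Z \<in> sigma_sets ?\<Omega> ?G" unfolding Z .
  qed
  from sigma_algebra.sigma_sets_subset[OF sigma_algebra_sigma_sets this]
  show "sets (BX n) \<subseteq> sigma_sets ?\<Omega> ?G"
    unfolding sets_PiM_single by (auto simp: PiE_iff)
qed

text \<open>The mean of the tensor powers of the random measure, written as a sum over tuples of marks.\<close>

definition tensor_mixture :: "nat \<Rightarrow> (nat \<Rightarrow> 'a) measure" where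
  "tensor_mixture n = mixture P
     (\<lambda>\<eta>. distr (density (counting (MT n \<eta>) (Y.Pow_Bor n)) (mass n)) (BX n) (positions n)) (BX n)"

lemma nn_integral_tensor_mixture:
  assumes g: "g \<in> borel_measurable (BX n)"
  shows "(\<integral>\<^sup>+x. g x \<partial>tensor_mixture n) =
    (\<integral>\<^sup>+\<eta>. \<integral>\<^sup>+y. mass n y * g (positions n y) \<partial>count_space (MT n \<eta>) \<partial>P)"
proof -
  let ?c = "\<lambda>\<eta>. counting (MT n \<eta>) (Y.Pow_Bor n)"
  let ?k = "\<lambda>\<eta>. distr (density (?c \<eta>) (mass n)) (BX n) (positions n)"
  have mg: "(\<lambda>y. mass n y * g (positions n y)) \<in> borel_measurable (Y.Pow_Bor n)" if "g \<in> borel_measurable (BX n)" for g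
    by (intro borel_measurable_times_ennreal mass_measurable measurable_compose[OF positions_measurable that])
  have k: "(\<integral>\<^sup>+x. g x \<partial>?k \<eta>) = (\<integral>\<^sup>+y. mass n y * g (positions n y) \<partial>count_space (MT n \<eta>))"
    if "\<eta> \<in> space P" "g \<in> borel_measurable (BX n)" for g \<eta>
  proof -
    have pm: "positions n \<in> measurable (density (?c \<eta>) (mass n)) (BX n)" "mass n \<in> borel_measurable (?c \<eta>)"
      "(\<lambda>y. g (positions n y)) \<in> borel_measurable (?c \<eta>)"
      using positions_measurable[of n] mass_measurable[of n] measurable_compose[OF positions_measurable that(2)]
      by (simp_all cong: measurable_cong_sets)
    have "(\<integral>\<^sup>+x. g x \<partial>?k \<eta>) = (\<integral>\<^sup>+y. g (positions n y) \<partial>density (?c \<eta>) (mass n))"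
      using that(2) by (intro nn_integral_distr[OF pm(1)]) simp
    also have "\<dots> = (\<integral>\<^sup>+y. mass n y * g (positions n y) \<partial>?c \<eta>)" by (rule nn_integral_density[OF pm(2,3)])
    also have "\<dots> = (\<integral>\<^sup>+y. mass n y * g (positions n y) \<partial>count_space (MT n \<eta>))"
      by (rule nn_integral_counting[OF marks_tuples_subset[OF that(1)] mg[OF that(2)]])
    finally show ?thesis .
  qed
  have "(\<integral>\<^sup>+x. g x \<partial>tensor_mixture n) = (\<integral>\<^sup>+\<eta>. \<integral>\<^sup>+x. g x \<partial>?k \<eta> \<partial>P)"
    unfolding tensor_mixture_def
  proof (rule conjunct2[OF nn_integral_mixture[OF _ _ g]])
    fix A assume A: "A \<in> sets (BX n)"
    have "(\<lambda>\<eta>. \<integral>\<^sup>+y. mass n y * indicator A (positions n y) \<partial>count_space (MT n \<eta>)) \<in> borel_measurable P"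
      by (rule measurable_compose[OF marks_measurable Y.nn_integral_tuples_measurable[OF mg[OF borel_measurable_indicator[OF A]]]])
    then show "(\<lambda>\<eta>. emeasure (?k \<eta>) A) \<in> borel_measurable P"
    proof (rule measurable_cong[THEN iffD1, rotated])
      fix \<eta> assume "\<eta> \<in> space P"
      from k[OF this borel_measurable_indicator[OF A]]
      show "(\<integral>\<^sup>+y. mass n y * indicator A (positions n y) \<partial>count_space (MT n \<eta>)) = emeasure (?k \<eta>) A"
        using A by simp
    qed
  qed simp
  then show ?thesis using k[OF _ g] by (simp cong: nn_integral_cong)
qed

text \<open>The sum runs over all tuples of marks, repetitions included, and hence factorises into
  one integral against \<eta> for each coordinate.\<close>

lemma emeasure_rectangle_tensor_mixture:
  assumes A: "\<And>i. i < n \<Longrightarrow> A i \<in> sets borel"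
  shows "emeasure (tensor_mixture n) (PiE {..<n} A) = (\<integral>\<^sup>+\<eta>. (\<Prod>i<n. emeasure \<eta> (A i)) \<partial>\<mu>)"
proof -
  have S: "PiE {..<n} A \<in> sets (BX n)" using A by (intro sets_PiM_I_finite) auto
  have "emeasure (tensor_mixture n) (PiE {..<n} A) = (\<integral>\<^sup>+x. indicator (PiE {..<n} A) x \<partial>tensor_mixture n)"
    using S by (simp add: tensor_mixture_def)
  also have "\<dots> = (\<integral>\<^sup>+\<eta>. \<integral>\<^sup>+y. mass n y * indicator (PiE {..<n} A) (positions n y) \<partial>count_space (MT n \<eta>) \<partial>P)"
    using S by (intro nn_integral_tensor_mixture) simp
  also have "\<dots> = (\<integral>\<^sup>+\<eta>. (\<Prod>i<n. emeasure \<eta> (A i)) \<partial>P)"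
  proof (rule nn_integral_cong)
    fix \<eta> assume \<eta>: "\<eta> \<in> space P"
    have "mass n y * indicator (PiE {..<n} A) (positions n y) =
        (\<Prod>j<n. ennreal (snd (y j)) * indicator (A j) (fst (y j)))" for y :: "nat \<Rightarrow> 'a \<times> real"
    proof -
      have "(\<Prod>j<n. indicator (A j) (fst (y j)) :: ennreal) = indicator (PiE {..<n} A) (positions n y)"
      proof (cases "\<forall>j<n. fst (y j) \<in> A j")
        case True
        then show ?thesis by (simp add: PiE_iff)
      next
        case False
        then obtain j where "j < n" "fst (y j) \<notin> A j" by blast
        then have "positions n y \<notin> PiE {..<n} A" by (auto simp: PiE_iff)
        moreover have "(\<Prod>j<n. indicator (A j) (fst (y j)) :: ennreal) = 0"
          using \<open>j < n\<close> \<open>fst (y j) \<notin> A j\<close> by (intro prod_zero bexI[of _ j]) auto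
        ultimately show ?thesis by simp
      qed
      then show ?thesis by (simp add: prod.distrib)
    qed
    then have "(\<integral>\<^sup>+y. mass n y * indicator (PiE {..<n} A) (positions n y) \<partial>count_space (MT n \<eta>)) =
        (\<integral>\<^sup>+y. (\<Prod>j<n. (\<lambda>p. ennreal (snd p) * indicator (A j) (fst p)) (y j)) \<partial>count_space (MT n \<eta>))"
      by simp
    also have "\<dots> = (\<Prod>j<n. \<integral>\<^sup>+p. ennreal (snd p) * indicator (A j) (fst p) \<partial>count_space (marks \<eta>))"
      using \<eta> by (intro nn_integral_tuples_prod discrete_radon_marks(1)) (simp add: space_P)
    also have "\<dots> = (\<Prod>j<n. emeasure \<eta> (A j))"
    proof (rule prod.cong[OF refl])
      fix j assume "j \<in> {..<n}"
      then have Aj: "A j \<in> sets borel" using A by simp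
      have "(\<integral>\<^sup>+p. ennreal (snd p) * indicator (A j) (fst p) \<partial>count_space (marks \<eta>)) = (\<integral>\<^sup>+x. indicator (A j) x \<partial>\<eta>)"
        using \<eta> Aj by (intro discrete_radon_marks(2)[symmetric]) (simp_all add: space_P)
      also have "\<dots> = emeasure \<eta> (A j)" using Aj by (simp add: sets_P_borel[OF \<eta>])
      finally show "(\<integral>\<^sup>+p. ennreal (snd p) * indicator (A j) (fst p) \<partial>count_space (marks \<eta>)) = emeasure \<eta> (A j)" .
    qed
    finally show "(\<integral>\<^sup>+y. mass n y * indicator (PiE {..<n} A) (positions n y) \<partial>count_space (MT n \<eta>)) =
        (\<Prod>i<n. emeasure \<eta> (A i))" .
  qed
  finally show ?thesis by (simp only: nn_integral_P)
qed

lemma sets_M: "sets (M n) = sets (BX n)"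
  using moment_measure[of n] sets_power_X[of n] by (simp add: is_moment_measure_def radon_measures_def)

text \<open>Agreement on relatively compact rectangles suffices, as these are closed under
  intersection. The growth bound, stated for orders at least 1, makes the boxes of the exhaustion
  finite.\<close>

lemma moment_measure_eq:
  assumes "n \<ge> 1"
  shows "M n = tensor_mixture n"
proof (rule measure_eqI_generator_eq)
  let ?\<Omega> = "PiE {..<n} (\<lambda>_. UNIV :: 'a set)" and ?G = "{PiE {..<n} A | A. \<forall>i<n. A i \<in> rel_compact_borel (euclidean :: 'a topology)}"
  show "Int_stable ?G"
  proof (rule Int_stableI)
    fix a b assume "a \<in> ?G" "b \<in> ?G"
    then obtain A B where AB: "a = PiE {..<n} A" "b = PiE {..<n} B" "\<forall>i<n. A i \<in> rel_compact_borel euclidean"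
      "\<forall>i<n. B i \<in> rel_compact_borel euclidean" by blast
    have "a \<inter> b = PiE {..<n} (\<lambda>i. A i \<inter> B i)" by (simp add: AB PiE_Int)
    moreover have "\<forall>i<n. A i \<inter> B i \<in> rel_compact_borel euclidean"
      using AB(3,4) rel_compact_borel_Int by (auto simp: rel_compact_borel_euclidean)
    ultimately show "a \<inter> b \<in> ?G" by blast
  qed
  show "?G \<subseteq> Pow ?\<Omega>" by (auto simp: PiE_iff)
  show "sets (M n) = sigma_sets ?\<Omega> ?G" unfolding sets_M by (rule sigma_rel_compact_rectangles)
  show "sets (tensor_mixture n) = sigma_sets ?\<Omega> ?G"
    unfolding tensor_mixture_def sets_mixture by (rule sigma_rel_compact_rectangles)
  show "emeasure (M n) X = emeasure (tensor_mixture n) X" if "X \<in> ?G" for X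
  proof -
    obtain A where A: "X = PiE {..<n} A" "\<forall>i<n. A i \<in> rel_compact_borel euclidean" using \<open>X \<in> ?G\<close> by blast
    have "emeasure (M n) X = (\<integral>\<^sup>+\<eta>. (\<Prod>i<n. emeasure \<eta> (A i)) \<partial>\<mu>)"
      using moment_measure[of n] A unfolding is_moment_measure_def by blast
    also have "\<dots> = emeasure (tensor_mixture n) X"
      unfolding A(1) using A(2) by (intro emeasure_rectangle_tensor_mixture[symmetric]) (auto simp: rel_compact_borel_euclidean)
    finally show ?thesis .
  qed
  show "range (\<lambda>j. PiE {..<n} (\<lambda>_. X.E j)) \<subseteq> ?G" using E_rel_compact by blast
  show "(\<Union>j. PiE {..<n} (\<lambda>_. X.E j)) = ?\<Omega>"
  proof (intro equalityI subsetI)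
    fix f assume f: "f \<in> ?\<Omega>"
    have "compact (f ` {..<n})" by (intro finite_imp_compact) simp
    then obtain j where "f ` {..<n} \<subseteq> X.E j" using X.compact_subset_E by blast
    then have "f \<in> PiE {..<n} (\<lambda>_. X.E j)" using f by (auto simp: PiE_iff)
    then show "f \<in> (\<Union>j. PiE {..<n} (\<lambda>_. X.E j))" by blast
  qed (auto simp: PiE_iff)
  show "emeasure (M n) (PiE {..<n} (\<lambda>_. X.E j)) \<noteq> \<infinity>" for j
    using moment_growth[OF E_rel_compact[of j]] assms by (auto simp: top_unique)
qed

section \<open>Relatively compact off-diagonal sets\<close>

abbreviation "RO \<equiv> (\<lambda>n. rel_compact_off_diagonal (euclidean :: 'a topology) n)"

lemma RO_D:
  assumes "\<Delta> \<in> RO n"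
  shows "\<Delta> \<in> sets (BX n)" "\<Delta> \<subseteq> PiE {..<n} (\<lambda>_. UNIV)" "x \<in> \<Delta> \<Longrightarrow> inj_on x {..<n}"
    "\<exists>\<Lambda>\<in>rel_compact_borel euclidean. \<Delta> \<subseteq> PiE {..<n} (\<lambda>_. \<Lambda>)"
proof -
  let ?T = "product_topology (\<lambda>_. euclidean :: 'a topology) {..<n}"
  have \<Delta>: "\<Delta> \<in> sets (BX n)" "compactin ?T (?T closure_of \<Delta>)" "\<Delta> \<subseteq> off_diagonal euclidean n"
    using assms sets_power_X[of n]
    by (auto simp: rel_compact_off_diagonal_def rel_compact_borel_def power_topology_def)
  show "\<Delta> \<in> sets (BX n)" by (rule \<Delta>(1))
  show sub: "\<Delta> \<subseteq> PiE {..<n} (\<lambda>_. UNIV)" using \<Delta>(3) by (auto simp: off_diagonal_def)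
  show "inj_on x {..<n}" if "x \<in> \<Delta>" using \<Delta>(3) that by (auto simp: off_diagonal_def)
  \<comment> \<open>The finite union of the coordinate projections of the compact closure is a
    compact side for a cube around \<Delta>.\<close>
  define \<Lambda> where "\<Lambda> = (\<Union>i<n. (\<lambda>x. x i) ` (?T closure_of \<Delta>))"
  have "compactin euclidean ((\<lambda>x. x i) ` (?T closure_of \<Delta>))" if "i < n" for i
    using that by (intro image_compactin[OF \<Delta>(2)] continuous_map_product_projection) simp
  then have "compact \<Lambda>" unfolding \<Lambda>_def by (intro compact_UN) auto
  moreover have cl: "\<Delta> \<subseteq> ?T closure_of \<Delta>" using sub by (intro closure_of_subset) simp
  have "\<Delta> \<subseteq> PiE {..<n} (\<lambda>_. \<Lambda>)"
  proof
    fix x assume x: "x \<in> \<Delta>"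
    then have "x i \<in> \<Lambda>" if "i < n" for i
      unfolding \<Lambda>_def using that subsetD[OF cl x] by (intro UN_I[of i] imageI) auto
    then show "x \<in> PiE {..<n} (\<lambda>_. \<Lambda>)" using subsetD[OF sub x] by (simp add: PiE_iff)
  qed
  ultimately show "\<exists>\<Lambda>\<in>rel_compact_borel euclidean. \<Delta> \<subseteq> PiE {..<n} (\<lambda>_. \<Lambda>)"
    by (intro bexI[of _ \<Lambda>] rel_compact_borel_subset[of _ \<Lambda>]) (auto simp: borel_compact)
qed

lemma RO_Int:
  assumes "\<Delta> \<in> RO n" "B \<in> sets (BX n)"
  shows "\<Delta> \<inter> B \<in> RO n"
proof -
  let ?T = "power_topology n (euclidean :: 'a topology)"
  have \<Delta>: "\<Delta> \<in> sets (borel_of ?T)" "compactin ?T (?T closure_of \<Delta>)" "\<Delta> \<subseteq> off_diagonal euclidean n"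
    using assms by (auto simp: rel_compact_off_diagonal_def rel_compact_borel_def)
  have "compactin ?T (?T closure_of (\<Delta> \<inter> B))"
    by (rule closed_compactin[OF \<Delta>(2) closure_of_mono[OF Int_lower1] closedin_closure_of])
  moreover have "\<Delta> \<inter> B \<in> sets (borel_of ?T)" using \<Delta>(1) assms(2) sets_power_X[of n] by auto
  ultimately show ?thesis using \<Delta>(3) by (auto simp: rel_compact_off_diagonal_def rel_compact_borel_def)
qed

lemma off_diagonal_sets: "off_diagonal euclidean n \<in> sets (BX n)"
proof -
  have "{y \<in> space (X.Pow_Bor n). inj_on y {..<n}} \<in> sets (X.Pow_Bor n)" by (rule X.injective_tuples_sets)
  then show ?thesis by (simp add: off_diagonal_def borel_of_euclidean space_PiM)
qed

text \<open>An exhaustion of the off-diagonal set by members of \<open>RO n\<close>. Relative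
  compactness refers to the full power, so these sets may come arbitrarily close to the
  diagonals.\<close>

definition off_diagonal_box :: "nat \<Rightarrow> nat \<Rightarrow> (nat \<Rightarrow> 'a) set" where
  "off_diagonal_box n j = PiE {..<n} (\<lambda>_. X.E j) \<inter> off_diagonal euclidean n"

lemma off_diagonal_box_RO: "off_diagonal_box n j \<in> RO n"
proof -
  let ?T = "power_topology n (euclidean :: 'a topology)"
  obtain K where K: "compact K" "X.E j \<subseteq> K" using X.E_compact by blast
  have comp: "compactin ?T (PiE {..<n} (\<lambda>_. K))"
    unfolding power_topology_def compactin_PiE using K(1) by simp
  have "Hausdorff_space ?T" unfolding power_topology_def by (simp add: Hausdorff_space_product_topology)
  then have closed: "closedin ?T (PiE {..<n} (\<lambda>_. K))" using comp by (rule compactin_imp_closedin)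
  have sub: "off_diagonal_box n j \<subseteq> PiE {..<n} (\<lambda>_. K)"
    unfolding off_diagonal_box_def using K(2) by (auto simp: PiE_iff)
  have "compactin ?T (?T closure_of off_diagonal_box n j)"
    by (rule closed_compactin[OF comp closure_of_minimal[OF sub closed] closedin_closure_of])
  moreover have "off_diagonal_box n j \<in> sets (borel_of ?T)"
    unfolding sets_power_X off_diagonal_box_def
    using X.open_E by (intro sets.Int off_diagonal_sets sets_PiM_I_finite) auto
  ultimately show ?thesis
    by (auto simp: rel_compact_off_diagonal_def rel_compact_borel_def off_diagonal_box_def)
qed

lemma off_diagonal_box_cover: "off_diagonal euclidean n = (\<Union>j. off_diagonal_box n j)"
proof (intro equalityI subsetI)
  fix f assume f: "f \<in> off_diagonal (euclidean :: 'a topology) n"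
  have "compact (f ` {..<n})" by (intro finite_imp_compact) simp
  then obtain j where "f ` {..<n} \<subseteq> X.E j" using X.compact_subset_E by blast
  then have "f \<in> off_diagonal_box n j" using f by (auto simp: off_diagonal_box_def off_diagonal_def PiE_iff)
  then show "f \<in> (\<Union>j. off_diagonal_box n j)" by blast
qed (auto simp: off_diagonal_box_def)

lemma positions_DP: "positions n \<in> measurable (V n) (BX n)"
  by (rule measurable_V[OF positions_measurable])

text \<open>Distinct marks sit at distinct points, so a tuple of marks whose positions have the repetition
  pattern \<open>i\<close> is itself the repetition of a tuple of distinct marks.\<close>

theorem coalesced_moment_eq:
  assumes \<Delta>: "\<Delta> \<in> RO k" and i: "\<And>l. l < k \<Longrightarrow> 1 \<le> i l" and k: "1 \<le> k"
  shows "coalesced_moment M k i \<Delta> = (\<integral>\<^sup>+\<eta>. \<integral>\<^sup>+y. (\<Prod>l<k. ennreal (snd (y l)) ^ i l) * indicator \<Delta> (positions k y)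
    \<partial>count_space (DT k \<eta>) \<partial>P)"
proof -
  define N where "N = (\<Sum>l<k. i l)"
  define b where "b j = block_index k i ! j" for j
  have R: "repeat_coords k i x = (\<lambda>j\<in>{..<N}. x (b j))" for x :: "nat \<Rightarrow> 'z"
    unfolding repeat_coords_eq N_def b_def ..
  have b: "b j < k" if "j < N" for j
    using that nth_mem[of j "block_index k i"] by (auto simp: b_def N_def length_block_index set_block_index)
  \<comment> \<open>Since \<open>i l \<ge> 1\<close>, every label has a nonempty block;
    \<open>s l\<close> will be one position in it, which makes repetition invertible on the
    left.\<close>
  have "\<exists>j. j < N \<and> b j = l" if "l < k" for l
  proof -
    have "l \<in> set (block_index k i)" using i[OF that] that by (simp add: set_block_index)
    then show ?thesis by (auto simp: in_set_conv_nth b_def N_def length_block_index)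
  qed
  then obtain s where s: "\<And>l. l < k \<Longrightarrow> s l < N \<and> b (s l) = l" by metis
  have "N \<ge> 1"
    using s[of 0] k by auto
  define sel where "sel z = (\<lambda>l\<in>{..<k}. z (s l))" for z :: "nat \<Rightarrow> 'a"
  \<comment> \<open>As an image this set is not visibly Borel. It consists of the \<open>z\<close>
    that are constant on every block and whose selected coordinates form a point of \<Delta>; both
    conditions are measurable.\<close>
  have image: "repeat_coords k i ` \<Delta> =
      {z \<in> space (BX N). sel z \<in> \<Delta>} \<inter> {z \<in> space (BX N). \<forall>j\<in>{..<N}. dist (z j) (z (s (b j))) = 0}"
  proof (intro equalityI subsetI)
    fix z assume "z \<in> repeat_coords k i ` \<Delta>"
    then obtain x where x: "x \<in> \<Delta>" "z = (\<lambda>j\<in>{..<N}. x (b j))" by (auto simp: R)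
    have "x \<in> extensional {..<k}" using RO_D(2)[OF \<Delta>] x(1) by (auto simp: PiE_iff)
    then have "sel z = x" using s by (auto simp: sel_def x(2) extensional_def fun_eq_iff)
    then show "z \<in> {z \<in> space (BX N). sel z \<in> \<Delta>} \<inter> {z \<in> space (BX N). \<forall>j\<in>{..<N}. dist (z j) (z (s (b j))) = 0}"
      using x b s by (simp add: space_PiM)
  next
    fix z assume z: "z \<in> {z \<in> space (BX N). sel z \<in> \<Delta>} \<inter> {z \<in> space (BX N). \<forall>j\<in>{..<N}. dist (z j) (z (s (b j))) = 0}"
    have "z = repeat_coords k i (sel z)"
    proof
      fix j
      show "z j = repeat_coords k i (sel z) j"
        using z b[of j] by (cases "j < N") (auto simp: R sel_def space_PiM PiE_iff extensional_def)
    qed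
    then show "z \<in> repeat_coords k i ` \<Delta>" using z by blast
  qed
  have image_sets: "repeat_coords k i ` \<Delta> \<in> sets (BX N)"
    unfolding image
  proof (rule sets.Int)
    have "sel \<in> measurable (BX N) (BX k)"
      unfolding sel_def using s by (intro measurable_restrict measurable_component_singleton) auto
    from measurable_sets[OF this RO_D(1)[OF \<Delta>]]
    show "{z \<in> space (BX N). sel z \<in> \<Delta>} \<in> sets (BX N)" by (simp add: vimage_def Int_def conj_commute)
    have "{z \<in> space (BX N). dist (z j) (z (s (b j))) = 0} \<in> sets (BX N)" if "j < N" for j
    proof -
      have "(\<lambda>z. dist (z j) (z (s (b j)))) \<in> borel_measurable (BX N)"
        using that s[OF b[OF that]] by (intro borel_measurable_dist measurable_component_singleton) auto
      then show ?thesis by measurable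
    qed
    then show "{z \<in> space (BX N). \<forall>j\<in>{..<N}. dist (z j) (z (s (b j))) = 0} \<in> sets (BX N)"
      by (intro sets.sets_Collect_finite_All) auto
  qed
  have inner: "(\<integral>\<^sup>+z. mass N z * indicator (repeat_coords k i ` \<Delta>) (positions N z) \<partial>count_space (MT N \<eta>)) =
      (\<integral>\<^sup>+y. (\<Prod>l<k. ennreal (snd (y l)) ^ i l) * indicator \<Delta> (positions k y) \<partial>count_space (DT k \<eta>))"
    for \<eta>
  proof -
    let ?A = "DT k \<eta> \<inter> {y. positions k y \<in> \<Delta>}"
    let ?B = "MT N \<eta> \<inter> {z. positions N z \<in> repeat_coords k i ` \<Delta>}"
    have pos_rep: "positions N (repeat_coords k i y) = repeat_coords k i (positions k y)" for y :: "nat \<Rightarrow> 'a \<times> real"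
      using b by (auto simp: R fun_eq_iff)
    have bij: "bij_betw (repeat_coords k i) ?A ?B"
    proof (rule bij_betw_imageI)
      show "inj_on (repeat_coords k i) ?A"
      proof (rule inj_onI)
        fix y z assume yz: "y \<in> ?A" "z \<in> ?A" "repeat_coords k i y = repeat_coords k i z"
        show "y = z"
        proof
          fix l
          show "y l = z l"
          proof (cases "l < k")
            case True
            then have "repeat_coords k i y (s l) = y l" "repeat_coords k i z (s l) = z l"
              using s[OF True] by (simp_all add: R)
            then show ?thesis using yz(3) by simp
          next
            case False
            then show ?thesis using yz by (auto simp: distinct_tuples_def PiE_iff extensional_def)
          qed
        qed
      qed
      show "repeat_coords k i ` ?A = ?B"
      proof (intro equalityI subsetI)
        fix z assume "z \<in> repeat_coords k i ` ?A"
        then obtain y where y: "y \<in> ?A" "z = repeat_coords k i y" by auto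
        have "positions N z \<in> repeat_coords k i ` \<Delta>" unfolding y(2) pos_rep using y(1) by blast
        moreover have "z \<in> MT N \<eta>"
          unfolding y(2) R using y(1) b by (auto simp: distinct_tuples_def PiE_iff)
        ultimately show "z \<in> ?B" by simp
      next
        fix z assume z: "z \<in> ?B"
        then obtain x where x: "x \<in> \<Delta>" "positions N z = repeat_coords k i x" by auto
        have fz: "fst (z j) = x (b j)" if "j < N" for j using fun_cong[OF x(2), of j] that by (simp add: R)
        define y where "y = (\<lambda>l\<in>{..<k}. z (s l))"
        have fy: "fst (y l) = x l" if "l < k" for l using fz[of "s l"] s[OF that] that by (simp add: y_def)
        have ym: "y l \<in> marks \<eta>" if "l < k" for l using z s[OF that] that by (auto simp: y_def PiE_iff)
        have "positions k y = x"
        proof -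
          have "x \<in> extensional {..<k}" using RO_D(2)[OF \<Delta>] x(1) by (auto simp: PiE_iff)
          then show ?thesis using fy by (auto simp: fun_eq_iff extensional_def)
        qed
        moreover have "inj_on y {..<k}"
        proof (rule inj_onI)
          fix a c assume ac: "a \<in> {..<k}" "c \<in> {..<k}" "y a = y c"
          then have "x a = x c" using fy[of a] fy[of c] by simp
          then show "a = c" using RO_D(3)[OF \<Delta> x(1)] ac(1,2) by (auto dest: inj_onD)
        qed
        ultimately have "y \<in> ?A" using ym x(1) by (auto simp: distinct_tuples_def PiE_iff y_def)
        moreover have "z = repeat_coords k i y"
        proof
          fix j
          show "z j = repeat_coords k i y j"
          proof (cases "j < N")
            case True
            \<comment> \<open>Marks with equal positions are equal, so \<open>z\<close> repeats
              whole marks and not just their positions.\<close>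
            have "z j \<in> marks \<eta>" using z True by (auto simp: PiE_iff)
            moreover have "fst (z j) = fst (y (b j))" using fz[OF True] fy[OF b[OF True]] by simp
            ultimately have "z j = y (b j)" using ym[OF b[OF True]] by (intro marks_functional[of _ \<eta>])
            then show ?thesis using True by (simp add: R)
          next
            case False
            then show ?thesis using z by (auto simp: R PiE_iff extensional_def)
          qed
        qed
        ultimately show "z \<in> repeat_coords k i ` ?A" by blast
      qed
    qed
    have "(\<integral>\<^sup>+z. mass N z * indicator (repeat_coords k i ` \<Delta>) (positions N z) \<partial>count_space (MT N \<eta>)) =
        (\<integral>\<^sup>+z. mass N z * indicator {z. positions N z \<in> repeat_coords k i ` \<Delta>} z \<partial>count_space (MT N \<eta>))"
      by (intro nn_integral_cong) (simp add: indicator_def)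
    also have "\<dots> = (\<integral>\<^sup>+z. mass N z \<partial>count_space ?B)" by (rule nn_integral_count_space_restrict)
    also have "\<dots> = (\<integral>\<^sup>+y. mass N (repeat_coords k i y) \<partial>count_space ?A)"
      by (rule nn_integral_bij_count_space[OF bij, symmetric])
    also have "\<dots> = (\<integral>\<^sup>+y. (\<Prod>l<k. ennreal (snd (y l)) ^ i l) \<partial>count_space ?A)"
    proof (rule nn_integral_cong)
      fix y :: "nat \<Rightarrow> 'a \<times> real"
      have "mass N (repeat_coords k i y) = (\<Prod>j<N. ennreal (snd (y (b j))))"
        by (intro prod.cong) (auto simp: R)
      also have "\<dots> = (\<Prod>l<k. ennreal (snd (y l)) ^ i l)"
        unfolding N_def b_def by (rule prod_block_index[of "\<lambda>l. ennreal (snd (y l))"])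
      finally show "mass N (repeat_coords k i y) = (\<Prod>l<k. ennreal (snd (y l)) ^ i l)" .
    qed
    also have "\<dots> = (\<integral>\<^sup>+y. (\<Prod>l<k. ennreal (snd (y l)) ^ i l) * indicator {y. positions k y \<in> \<Delta>} y
        \<partial>count_space (DT k \<eta>))"
      by (rule nn_integral_count_space_restrict[symmetric])
    also have "\<dots> = (\<integral>\<^sup>+y. (\<Prod>l<k. ennreal (snd (y l)) ^ i l) * indicator \<Delta> (positions k y)
        \<partial>count_space (DT k \<eta>))"
      by (intro nn_integral_cong) (simp add: indicator_def)
    finally show ?thesis .
  qed
  have "coalesced_moment M k i \<Delta> = emeasure (M N) (repeat_coords k i ` \<Delta>)"
    by (simp add: coalesced_moment_def N_def)
  also have "\<dots> = emeasure (tensor_mixture N) (repeat_coords k i ` \<Delta>)"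
    by (simp only: moment_measure_eq[OF \<open>N \<ge> 1\<close>])
  also have "\<dots> = (\<integral>\<^sup>+x. indicator (repeat_coords k i ` \<Delta>) x \<partial>tensor_mixture N)"
    using image_sets by (simp add: tensor_mixture_def)
  also have "\<dots> = (\<integral>\<^sup>+\<eta>. \<integral>\<^sup>+z. mass N z * indicator (repeat_coords k i ` \<Delta>) (positions N z)
      \<partial>count_space (MT N \<eta>) \<partial>P)"
    using image_sets by (intro nn_integral_tensor_mixture) simp
  finally show ?thesis by (simp only: inner)
qed

text \<open>Repeating coordinates stays within a power of the same set \<Lambda>, so the assumed
  bound applies at the total multiplicity, with one \<open>C\<close> for all
  \<open>i\<close>.\<close>

lemma coalesced_moment_growth:
  assumes \<Delta>: "\<Delta> \<in> RO k" and k: "1 \<le> k"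
  shows "\<exists>C>0. \<forall>i. (\<forall>l<k. 1 \<le> i l) \<longrightarrow>
    coalesced_moment M k i \<Delta> \<le> ennreal (C ^ (\<Sum>l<k. i l) * fact (\<Sum>l<k. i l))"
proof -
  obtain \<Lambda> where \<Lambda>: "\<Lambda> \<in> rel_compact_borel euclidean" "\<Delta> \<subseteq> PiE {..<k} (\<lambda>_. \<Lambda>)" using RO_D(4)[OF \<Delta>] by blast
  obtain C where C: "0 < C" "\<forall>n\<ge>1. emeasure (M n) (PiE {..<n} (\<lambda>_. \<Lambda>)) \<le> ennreal (C ^ n * fact n)"
    using moment_growth[OF \<Lambda>(1)] by blast
  have "coalesced_moment M k i \<Delta> \<le> ennreal (C ^ (\<Sum>l<k. i l) * fact (\<Sum>l<k. i l))" if i: "\<forall>l<k. 1 \<le> i l" for i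
  proof -
    let ?N = "\<Sum>l<k. i l"
    have "repeat_coords k i ` \<Delta> \<subseteq> PiE {..<?N} (\<lambda>_. \<Lambda>)"
    proof
      fix z assume "z \<in> repeat_coords k i ` \<Delta>"
      then obtain x where x: "x \<in> \<Delta>" "z = repeat_coords k i x" by auto
      have "block_index k i ! j < k" if "j < ?N" for j
        using that nth_mem[of j "block_index k i"] by (auto simp: length_block_index set_block_index)
      then show "z \<in> PiE {..<?N} (\<lambda>_. \<Lambda>)"
        unfolding x(2) repeat_coords_eq using subsetD[OF \<Lambda>(2) x(1)] by (auto simp: PiE_iff)
    qed
    moreover have "PiE {..<?N} (\<lambda>_. \<Lambda>) \<in> sets (M ?N)"
      unfolding sets_M using \<Lambda>(1) by (intro sets_PiM_I_finite) (auto simp: rel_compact_borel_euclidean)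
    ultimately have "coalesced_moment M k i \<Delta> \<le> emeasure (M ?N) (PiE {..<?N} (\<lambda>_. \<Lambda>))"
      unfolding coalesced_moment_def by (rule emeasure_mono)
    \<comment> \<open>The growth bound is available for orders at least 1 only, which
      \<open>k \<ge> 1\<close> and \<open>i 0 \<ge> 1\<close> guarantee.\<close>
    moreover have "1 \<le> i 0" "i 0 \<le> ?N" using i k by (auto intro!: member_le_sum)
    then have "?N \<ge> 1" by linarith
    ultimately show ?thesis using C(2) order_trans by blast
  qed
  with C(1) show ?thesis by blast
qed

end

section \<open>The measures \<open>\<xi>\<close>\<close>

context random_discrete_moments begin

section \<open>Slices over off-diagonal sets and their moments\<close>

abbreviation "BP \<equiv> (\<lambda>n::nat. PiM {..<n} (\<lambda>_. restrict_space borel {0<..} :: real measure))"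

lemma sets_power_pos: "sets (borel_of (power_topology n pos_top)) = sets (BP n)"
  unfolding pos_top_eq sets_borel_of_power_topology
  by (intro sets_PiM_cong refl sets_borel_of_top_of_set)

lemma space_BP: "space (BP n) = PiE {..<n} (\<lambda>_. {0<..})"
  by (simp add: space_PiM space_restrict_space)

lemma weights_measurable: "weights n \<in> measurable (V n) (BP n)"
proof (rule measurable_V, rule measurable_restrict)
  fix i assume i: "i \<in> {..<n}"
  show "(\<lambda>y. snd (y i)) \<in> measurable (Y.Pow_Bor n) (restrict_space borel {0<..})"
  proof (rule measurable_restrict_space2)
    show "(\<lambda>y. snd (y i)) \<in> space (Y.Pow_Bor n) \<rightarrow> {0<..}"
    proof
      fix y assume "y \<in> space (Y.Pow_Bor n)"
      then have "y \<in> PiE {..<n} (\<lambda>_. UNIV \<times> {0<..})" by (simp add: space_PiM)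
      from PiE_mem[OF this i] show "snd (y i) \<in> {0<..}" by (simp add: mem_Times_iff)
    qed
    show "(\<lambda>y. snd (y i)) \<in> borel_measurable (Y.Pow_Bor n)" using i by (intro snd_coordinate) simp
  qed
qed

lemma mass_V: "mass n \<in> borel_measurable (V n)"
  by (rule measurable_V[OF mass_measurable])

definition xi_measure :: "nat \<Rightarrow> (nat \<Rightarrow> 'a \<times> real) measure" where
  "xi_measure n = density (tuple_measure n) (mass n)"

lemma sets_xi_measure [simp, measurable_cong]: "sets (xi_measure n) = sets (V n)"
  by (simp add: xi_measure_def)

lemma space_xi_measure: "space (xi_measure n) = DP n"
  by (simp add: xi_measure_def space_tuple_measure)

lemma nn_integral_xi_measure:
  assumes f: "f \<in> borel_measurable (V n)"
  shows "(\<integral>\<^sup>+y. f y \<partial>xi_measure n) =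
    1 / fact n * (\<integral>\<^sup>+\<eta>. \<integral>\<^sup>+y. mass n y * f y \<partial>count_space (DT n \<eta>) \<partial>P)"
proof -
  have "(\<integral>\<^sup>+y. f y \<partial>xi_measure n) = (\<integral>\<^sup>+y. mass n y * f y \<partial>tuple_measure n)"
    unfolding xi_measure_def using f mass_V[of n]
    by (intro nn_integral_density) (simp_all cong: measurable_cong_sets)
  also have "\<dots> = 1 / fact n * (\<integral>\<^sup>+\<eta>. \<integral>\<^sup>+y. mass n y * f y \<partial>count_space (DT n \<eta>) \<partial>P)"
    by (intro nn_integral_tuple_measure borel_measurable_times_ennreal mass_V f)
  finally show ?thesis .
qed

definition xi_marginal :: "nat \<Rightarrow> (nat \<Rightarrow> 'a) set \<Rightarrow> (nat \<Rightarrow> real) measure" where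
  "xi_marginal n \<Delta> = distr (density (xi_measure n) (\<lambda>y. indicator \<Delta> (positions n y)))
     (borel_of (power_topology n pos_top)) (weights n)"

lemma nn_integral_xi_marginal:
  assumes \<Delta>: "\<Delta> \<in> sets (BX n)" and g: "g \<in> borel_measurable (BP n)"
  shows "(\<integral>\<^sup>+s. g s \<partial>xi_marginal n \<Delta>) = (\<integral>\<^sup>+y. indicator \<Delta> (positions n y) * g (weights n y) \<partial>xi_measure n)"
proof -
  have ind: "(\<lambda>y. indicator \<Delta> (positions n y) :: ennreal) \<in> borel_measurable (xi_measure n)"
    using measurable_compose[OF positions_DP borel_measurable_indicator[OF \<Delta>]]
    by (simp cong: measurable_cong_sets)
  have w: "weights n \<in> measurable (density (xi_measure n) (\<lambda>y. indicator \<Delta> (positions n y))) (borel_of (power_topology n pos_top))"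
    using weights_measurable[of n] sets_power_pos[of n] by (simp cong: measurable_cong_sets)
  have gw: "(\<lambda>y. g (weights n y)) \<in> borel_measurable (xi_measure n)"
    using measurable_compose[OF weights_measurable g] by (simp cong: measurable_cong_sets)
  show ?thesis
    unfolding xi_marginal_def
    using g sets_power_pos[of n]
    by (subst nn_integral_distr[OF w], simp cong: measurable_cong_sets)
      (rule nn_integral_density[OF ind gw])
qed

lemma sets_xi_marginal: "sets (xi_marginal n \<Delta>) = sets (borel_of (power_topology n pos_top))"
  and space_xi_marginal: "space (xi_marginal n \<Delta>) = topspace (power_topology n pos_top)"
  by (simp_all add: xi_marginal_def)

lemma emeasure_xi_marginal:
  assumes \<Delta>: "\<Delta> \<in> sets (BX n)" and A: "A \<in> sets (borel_of (power_topology n pos_top))"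
  shows "emeasure (xi_marginal n \<Delta>) A = (\<integral>\<^sup>+y. indicator \<Delta> (positions n y) * indicator A (weights n y) \<partial>xi_measure n)"
proof -
  have "emeasure (xi_marginal n \<Delta>) A = (\<integral>\<^sup>+s. indicator A s \<partial>xi_marginal n \<Delta>)"
    using A by (simp add: sets_xi_marginal)
  also have "\<dots> = (\<integral>\<^sup>+y. indicator \<Delta> (positions n y) * indicator A (weights n y) \<partial>xi_measure n)"
    using A by (intro nn_integral_xi_marginal \<Delta>) (simp add: sets_power_pos)
  finally show ?thesis .
qed

lemma ennreal_inverse_fact: "ennreal (1 / fact n) = 1 / fact n"
proof -
  have "ennreal (fact n) = fact n"
    by (metis ennreal_of_nat_eq_real_of_nat of_nat_fact)
  then show ?thesis using divide_ennreal[of 1 "fact n"] by simp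
qed

text \<open>The density \<open>mass n\<close> contributes one further factor of each mark, which is
  why exponent \<open>i l\<close> corresponds to multiplicity \<open>i l + 1\<close>; the rest is
  \<open>coalesced_moment_eq\<close>.\<close>

lemma xi_marginal_moments:
  assumes \<Delta>: "\<Delta> \<in> RO n" and n: "1 \<le> n"
  shows "(\<integral>\<^sup>+s. ennreal (\<Prod>l<n. s l ^ i l) \<partial>xi_marginal n \<Delta>) =
    ennreal (1 / fact n) * coalesced_moment M n (\<lambda>l. i l + 1) \<Delta>"
proof -
  have coord: "(\<lambda>s. s l) \<in> borel_measurable (BP n)" if "l < n" for l
  proof -
    have "(\<lambda>s. s l) \<in> measurable (BP n) (restrict_space borel {0<..})" using that by simp
    then show ?thesis by (auto simp: measurable_restrict_space2_iff)
  qed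
  have g: "(\<lambda>s. ennreal (\<Prod>l<n. s l ^ i l)) \<in> borel_measurable (BP n)"
    by (intro measurable_compose[OF _ measurable_ennreal] borel_measurable_prod borel_measurable_power coord) simp
  have f: "(\<lambda>y. indicator \<Delta> (positions n y) * ennreal (\<Prod>l<n. weights n y l ^ i l)) \<in> borel_measurable (V n)"
    by (intro borel_measurable_times_ennreal measurable_compose[OF positions_DP borel_measurable_indicator[OF RO_D(1)[OF \<Delta>]]]
        measurable_compose[OF weights_measurable g])
  have "(\<integral>\<^sup>+s. ennreal (\<Prod>l<n. s l ^ i l) \<partial>xi_marginal n \<Delta>) =
      (\<integral>\<^sup>+y. indicator \<Delta> (positions n y) * ennreal (\<Prod>l<n. weights n y l ^ i l) \<partial>xi_measure n)"
    by (rule nn_integral_xi_marginal[OF RO_D(1)[OF \<Delta>] g])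
  also have "\<dots> = 1 / fact n * (\<integral>\<^sup>+\<eta>. \<integral>\<^sup>+y. mass n y * (indicator \<Delta> (positions n y) * ennreal (\<Prod>l<n. weights n y l ^ i l))
      \<partial>count_space (DT n \<eta>) \<partial>P)"
    by (rule nn_integral_xi_measure[OF f])
  also have "\<dots> = 1 / fact n * (\<integral>\<^sup>+\<eta>. \<integral>\<^sup>+y. (\<Prod>l<n. ennreal (snd (y l)) ^ (i l + 1)) * indicator \<Delta> (positions n y)
      \<partial>count_space (DT n \<eta>) \<partial>P)"
  proof (intro arg_cong[where f = "\<lambda>z. 1 / fact n * z"] nn_integral_cong)
    fix \<eta> and y :: "nat \<Rightarrow> 'a \<times> real"
    assume "y \<in> space (count_space (DT n \<eta>))"
    then have "0 < snd (y l)" if "l < n" for l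
      using that marks_atom[of "y l" \<eta>] by (auto simp: distinct_tuples_def PiE_iff)
    then have "ennreal (\<Prod>l<n. weights n y l ^ i l) = (\<Prod>l<n. ennreal (snd (y l)) ^ i l)"
      by (subst prod_ennreal[symmetric]) (auto intro!: prod.cong simp: ennreal_power less_imp_le)
    moreover have "(\<Prod>l<n. ennreal (snd (y l)) ^ (i l + 1)) = mass n y * (\<Prod>l<n. ennreal (snd (y l)) ^ i l)"
      by (simp add: prod.distrib)
    ultimately show "mass n y * (indicator \<Delta> (positions n y) * ennreal (\<Prod>l<n. weights n y l ^ i l)) =
        (\<Prod>l<n. ennreal (snd (y l)) ^ (i l + 1)) * indicator \<Delta> (positions n y)"
      by (simp only: mult_ac)
  qed
  also have "\<dots> = ennreal (1 / fact n) * coalesced_moment M n (\<lambda>l. i l + 1) \<Delta>"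
    unfolding ennreal_inverse_fact using \<Delta> n by (subst coalesced_moment_eq) simp_all
  finally show ?thesis .
qed

text \<open>The multiplicities \<open>i l + 1\<close> add up to the degree plus \<open>n\<close>, so
  the bound acquires the form needed for determinacy with shift \<open>c = n\<close> and
  \<open>A = C ^ n / fact n\<close>.\<close>

lemma coalesced_moment_bound:
  assumes \<Delta>: "\<Delta> \<in> RO n" and n: "1 \<le> n"
  shows "\<exists>A>0. \<exists>C>0. \<forall>i. ennreal (1 / fact n) * coalesced_moment M n (\<lambda>l. i l + 1) \<Delta>
    \<le> ennreal (A * C ^ (\<Sum>l<n. i l) * fact ((\<Sum>l<n. i l) + n))"
proof -
  obtain C where C: "0 < C" "\<forall>i. (\<forall>l<n. 1 \<le> i l) \<longrightarrow>
      coalesced_moment M n i \<Delta> \<le> ennreal (C ^ (\<Sum>l<n. i l) * fact (\<Sum>l<n. i l))"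
    using coalesced_moment_growth[OF assms] by blast
  have "ennreal (1 / fact n) * coalesced_moment M n (\<lambda>l. i l + 1) \<Delta>
      \<le> ennreal (1 / fact n * C ^ n * C ^ (\<Sum>l<n. i l) * fact ((\<Sum>l<n. i l) + n))" for i
  proof -
    have sum: "(\<Sum>l<n. i l + 1) = (\<Sum>l<n. i l) + n" by (simp only: sum.distrib) simp
    have "coalesced_moment M n (\<lambda>l. i l + 1) \<Delta> \<le> ennreal (C ^ ((\<Sum>l<n. i l) + n) * fact ((\<Sum>l<n. i l) + n))"
      using C(2)[rule_format, of "\<lambda>l. i l + 1"] unfolding sum by simp
    then have "ennreal (1 / fact n) * coalesced_moment M n (\<lambda>l. i l + 1) \<Delta>
        \<le> ennreal (1 / fact n) * ennreal (C ^ ((\<Sum>l<n. i l) + n) * fact ((\<Sum>l<n. i l) + n))"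
      by (rule mult_left_mono) simp
    also have "\<dots> = ennreal (1 / fact n * C ^ n * C ^ (\<Sum>l<n. i l) * fact ((\<Sum>l<n. i l) + n))"
      using C(1) by (subst ennreal_mult[symmetric]) (auto simp: power_add mult_ac)
    finally show ?thesis .
  qed
  moreover have "0 < 1 / fact n * C ^ n" using C(1) by simp
  ultimately show ?thesis using C(1) by blast
qed

lemma xi_marginal_solves:
  assumes \<Delta>: "\<Delta> \<in> RO n" and n: "1 \<le> n"
  shows "solves_moment_problem M n \<Delta> (xi_marginal n \<Delta>)"
  unfolding solves_moment_problem_def
proof (intro conjI allI)
  \<comment> \<open>With all exponents 0 the moment is the total mass.\<close>
  obtain A C where "ennreal (1 / fact n) * coalesced_moment M n (\<lambda>l. 0 + 1) \<Delta> \<le> ennreal (A * C ^ (\<Sum>l<n. 0) * fact ((\<Sum>l<n. 0) + n))"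
    using coalesced_moment_bound[OF assms] by meson
  then have "(\<integral>\<^sup>+s. ennreal (\<Prod>l<n. s l ^ 0) \<partial>xi_marginal n \<Delta>) < \<infinity>"
    unfolding xi_marginal_moments[OF assms] by (rule le_less_trans) simp
  then show "finite_measure (xi_marginal n \<Delta>)" by (intro finite_measureI) simp
qed (simp_all only: sets_xi_marginal space_xi_marginal xi_marginal_moments[OF assms])

lemma solves_moment_problem_unique:
  assumes \<Delta>: "\<Delta> \<in> RO n" and n: "1 \<le> n"
    and s1: "solves_moment_problem M n \<Delta> m1" and s2: "solves_moment_problem M n \<Delta> m2"
  shows "m1 = m2"
proof -
  obtain A C where AC: "0 < A" "0 < C" "\<forall>i. ennreal (1 / fact n) * coalesced_moment M n (\<lambda>l. i l + 1) \<Delta>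
      \<le> ennreal (A * C ^ (\<Sum>l<n. i l) * fact ((\<Sum>l<n. i l) + n))"
    using coalesced_moment_bound[OF \<Delta> n] by blast
  have mom: "(\<integral>\<^sup>+s. ennreal (\<Prod>l<n. s l ^ i l) \<partial>m1) = ennreal (1 / fact n) * coalesced_moment M n (\<lambda>l. i l + 1) \<Delta>"
    "(\<integral>\<^sup>+s. ennreal (\<Prod>l<n. s l ^ i l) \<partial>m2) = ennreal (1 / fact n) * coalesced_moment M n (\<lambda>l. i l + 1) \<Delta>" for i
    using s1 s2 unfolding solves_moment_problem_def by blast+
  have sets: "sets m1 = sets (BP n)" "sets m2 = sets (BP n)"
    using s1 s2 sets_power_pos[of n] by (auto simp: solves_moment_problem_def)
  show ?thesis
    by (rule multivariate_moment_determinate[OF sets AC(1,2), of n])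
      (simp_all only: mom, rule AC(3)[rule_format])
qed

theorem moment_problem_unique_solution:
  assumes "\<Delta> \<in> RO n" "1 \<le> n"
  shows "\<exists>!\<xi>. solves_moment_problem M n \<Delta> \<xi>"
  using xi_marginal_solves[OF assms] solves_moment_problem_unique[OF assms] by blast

lemma xi_Delta_eq:
  assumes "\<Delta> \<in> RO n" "1 \<le> n"
  shows "xi_Delta M n \<Delta> = xi_marginal n \<Delta>"
  unfolding xi_Delta_def
  by (rule the1_equality[OF moment_problem_unique_solution[OF assms] xi_marginal_solves[OF assms]])

lemma xi_measure_disintegrates:
  assumes n: "1 \<le> n"
  shows "disintegrates_to_xi_Delta euclidean M n (xi_measure n)"
  unfolding disintegrates_to_xi_Delta_def
proof (intro conjI ballI)
  fix \<Delta> A assume \<Delta>: "\<Delta> \<in> RO n" and A: "A \<in> sets (borel_of (power_topology n pos_top))"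
  show "emeasure (xi_Delta M n \<Delta>) A = (\<integral>\<^sup>+y. indicator \<Delta> (positions n y) * indicator A (weights n y) \<partial>xi_measure n)"
    unfolding xi_Delta_eq[OF \<Delta> n] by (rule emeasure_xi_marginal[OF RO_D(1)[OF \<Delta>] A])
qed (simp_all add: space_xi_measure)

section \<open>Uniqueness of the disintegration and the density of the correlation measure\<close>

definition cylinders :: "nat \<Rightarrow> (nat \<Rightarrow> 'a \<times> real) set set" where
  "cylinders n = {{y \<in> DP n. positions n y \<in> \<Delta> \<and> weights n y \<in> A} | \<Delta> A. \<Delta> \<in> RO n \<and> A \<in> sets (BP n)}"

lemma weights_BP: "y \<in> DP n \<Longrightarrow> weights n y \<in> space (BP n)"
  using measurable_space[OF weights_measurable[of n]] by (simp add: space_V)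

lemma positions_off_diagonal: "y \<in> DP n \<Longrightarrow> positions n y \<in> off_diagonal euclidean n"
  by (simp add: distinct_positions_def)

lemma cylinder_sets:
  assumes "\<Delta> \<in> sets (BX n)" "A \<in> sets (BP n)"
  shows "{y \<in> DP n. positions n y \<in> \<Delta> \<and> weights n y \<in> A} \<in> sets (V n)"
proof -
  have "positions n -` \<Delta> \<inter> space (V n) \<inter> (weights n -` A \<inter> space (V n)) \<in> sets (V n)"
    by (intro sets.Int measurable_sets[OF positions_DP assms(1)] measurable_sets[OF weights_measurable assms(2)])
  also have "positions n -` \<Delta> \<inter> space (V n) \<inter> (weights n -` A \<inter> space (V n)) = {y \<in> DP n. positions n y \<in> \<Delta> \<and> weights n y \<in> A}"
    unfolding space_V by blast
  finally show ?thesis .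
qed

text \<open>Cylinders allow only relatively compact sets of positions. Taking unions over the
  off-diagonal boxes removes this restriction; then all coordinate maps are measurable, and with
  them the whole trace of the product algebra.\<close>

lemma sigma_cylinders: "sets (V n) = sigma_sets (DP n) (cylinders n)"
proof
  have "cylinders n \<subseteq> sets (V n)" unfolding cylinders_def using cylinder_sets RO_D(1) by blast
  from sets.sigma_sets_subset[OF this] show "sigma_sets (DP n) (cylinders n) \<subseteq> sets (V n)"
    unfolding space_V .
next
  let ?S = "sigma (DP n) (cylinders n)"
  have sub: "cylinders n \<subseteq> Pow (DP n)" by (auto simp: cylinders_def)
  have S: "sets ?S = sigma_sets (DP n) (cylinders n)" "space ?S = DP n"
    using sub by (simp_all add: sets_measure_of space_measure_of)
  have cyl: "{y \<in> DP n. positions n y \<in> B \<and> weights n y \<in> A} \<in> sets ?S"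
    if B: "B \<in> sets (BX n)" and A: "A \<in> sets (BP n)" for A B
  proof -
    have "{y \<in> DP n. positions n y \<in> off_diagonal_box n j \<inter> B \<and> weights n y \<in> A} \<in> sets ?S" for j
      unfolding S using RO_Int[OF off_diagonal_box_RO B] A unfolding cylinders_def
      by (intro sigma_sets.Basic) blast
    then have "(\<Union>j. {y \<in> DP n. positions n y \<in> off_diagonal_box n j \<inter> B \<and> weights n y \<in> A}) \<in> sets ?S" by blast
    also have "(\<Union>j. {y \<in> DP n. positions n y \<in> off_diagonal_box n j \<inter> B \<and> weights n y \<in> A}) =
        {y \<in> DP n. positions n y \<in> B \<and> weights n y \<in> A}"
      using positions_off_diagonal[of _ n] unfolding off_diagonal_box_cover by blast
    finally show ?thesis .
  qed
  have fst: "(\<lambda>y. fst (y i)) \<in> borel_measurable ?S" if i: "i < n" for i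
  proof (rule measurableI)
    fix U :: "'a set" assume U: "U \<in> sets borel"
    have "(\<lambda>x. x i) \<in> borel_measurable (BX n)" using i by simp
    from cyl[OF measurable_sets[OF this U] sets.top]
    show "(\<lambda>y. fst (y i)) -` U \<inter> space ?S \<in> sets ?S"
    proof (rule back_subst[where P = "\<lambda>Z. Z \<in> sets ?S"])
      show "{y \<in> DP n. positions n y \<in> (\<lambda>x. x i) -` U \<inter> space (BX n) \<and> weights n y \<in> space (BP n)} =
          (\<lambda>y. fst (y i)) -` U \<inter> space ?S"
        using i weights_BP[of _ n] unfolding S by (auto simp: space_PiM)
    qed
  qed simp
  have snd: "(\<lambda>y. snd (y i)) \<in> borel_measurable ?S" if i: "i < n" for i
  proof (rule measurableI)
    fix U :: "real set" assume U: "U \<in> sets borel"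
    have "(\<lambda>s. s i) \<in> measurable (BP n) (restrict_space borel {0<..})" using i by simp
    then have "(\<lambda>s. s i) \<in> borel_measurable (BP n)" by (auto simp: measurable_restrict_space2_iff)
    from cyl[OF sets.top measurable_sets[OF this U]]
    show "(\<lambda>y. snd (y i)) -` U \<inter> space ?S \<in> sets ?S"
    proof (rule back_subst[where P = "\<lambda>Z. Z \<in> sets ?S"])
      show "{y \<in> DP n. positions n y \<in> space (BX n) \<and> weights n y \<in> (\<lambda>s. s i) -` U \<inter> space (BP n)} =
          (\<lambda>y. snd (y i)) -` U \<inter> space ?S"
        using i weights_BP[of _ n] unfolding S by (auto simp: space_PiM)
    qed
  qed simp
  \<comment> \<open>Every measurable subset of \<open>DP n\<close> is the preimage of a
    product-measurable set under this inclusion map.\<close>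
  have id: "(\<lambda>y. y) \<in> measurable ?S (Y.Pow_Bor n)"
  proof (rule measurable_PiM_single)
    show "(\<lambda>y. y) \<in> space ?S \<rightarrow> (\<Pi>\<^sub>E i\<in>{..<n}. space Y.Bor)"
      unfolding S using DP_subset[of n] by (auto simp: space_PiM)
    fix A i assume A: "A \<in> sets Y.Bor" and i: "i \<in> {..<n}"
    have "(\<lambda>y. (fst (y i), snd (y i))) \<in> borel_measurable ?S"
      using i by (intro borel_measurable_Pair fst snd) auto
    then have "(\<lambda>y. y i) \<in> borel_measurable ?S" by simp
    from measurable_sets[OF this, of A] A
    show "{y \<in> space ?S. y i \<in> A} \<in> sets ?S" by (simp add: Y_Bor vimage_def Int_def conj_commute)
  qed
  show "sets (V n) \<subseteq> sigma_sets (DP n) (cylinders n)"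
  proof
    fix A assume "A \<in> sets (V n)"
    then obtain B where B: "B \<in> sets (Y.Pow_Bor n)" "A = DP n \<inter> B"
      unfolding sets_V sets_restrict_space by blast
    from measurable_sets[OF id B(1)] show "A \<in> sigma_sets (DP n) (cylinders n)"
      unfolding B(2) S by (simp add: Int_commute)
  qed
qed

text \<open>The slices fix the values on cylinders, a generator closed under intersection.
  Finiteness of the slices over the off-diagonal boxes supplies the sigma-finite exhaustion.\<close>

lemma disintegration_unique:
  assumes n: "1 \<le> n" and \<xi>: "disintegrates_to_xi_Delta euclidean M n \<xi>"
  shows "\<xi> = xi_measure n"
proof (rule measure_eqI_generator_eq)
  have val: "emeasure m {y \<in> DP n. positions n y \<in> \<Delta> \<and> weights n y \<in> A} = emeasure (xi_Delta M n \<Delta>) A"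
    if m: "disintegrates_to_xi_Delta euclidean M n m" and \<Delta>: "\<Delta> \<in> RO n" and A: "A \<in> sets (BP n)" for m \<Delta> A
  proof -
    have sm: "sets m = sets (V n)" "space m = DP n"
      using m by (simp_all add: disintegrates_to_xi_Delta_def)
    have "{y \<in> DP n. positions n y \<in> \<Delta> \<and> weights n y \<in> A} \<in> sets m"
      unfolding sm by (rule cylinder_sets[OF RO_D(1)[OF \<Delta>] A])
    then have "emeasure m {y \<in> DP n. positions n y \<in> \<Delta> \<and> weights n y \<in> A} =
        (\<integral>\<^sup>+y. indicator {y \<in> DP n. positions n y \<in> \<Delta> \<and> weights n y \<in> A} y \<partial>m)"
      by (rule nn_integral_indicator[symmetric])
    also have "\<dots> = (\<integral>\<^sup>+y. indicator \<Delta> (positions n y) * indicator A (weights n y) \<partial>m)"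
      by (intro nn_integral_cong) (simp add: sm indicator_def)
    also have "\<dots> = emeasure (xi_Delta M n \<Delta>) A"
      using m \<Delta> A unfolding disintegrates_to_xi_Delta_def sets_power_pos by simp
    finally show ?thesis .
  qed
  show "Int_stable (cylinders n)"
  proof (rule Int_stableI)
    fix a b assume "a \<in> cylinders n" "b \<in> cylinders n"
    then obtain \<Delta> A \<Delta>' A' where ab: "a = {y \<in> DP n. positions n y \<in> \<Delta> \<and> weights n y \<in> A}"
      "b = {y \<in> DP n. positions n y \<in> \<Delta>' \<and> weights n y \<in> A'}"
      "\<Delta> \<in> RO n" "A \<in> sets (BP n)" "\<Delta>' \<in> RO n" "A' \<in> sets (BP n)"
      unfolding cylinders_def by blast
    have "a \<inter> b = {y \<in> DP n. positions n y \<in> \<Delta> \<inter> \<Delta>' \<and> weights n y \<in> A \<inter> A'}" unfolding ab(1,2) by blast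
    moreover have "\<Delta> \<inter> \<Delta>' \<in> RO n" by (rule RO_Int[OF ab(3) RO_D(1)[OF ab(5)]])
    moreover have "A \<inter> A' \<in> sets (BP n)" using ab(4,6) by blast
    ultimately show "a \<inter> b \<in> cylinders n" unfolding cylinders_def by blast
  qed
  show "cylinders n \<subseteq> Pow (DP n)" by (auto simp: cylinders_def)
  show "sets \<xi> = sigma_sets (DP n) (cylinders n)"
    using \<xi> by (simp add: disintegrates_to_xi_Delta_def sigma_cylinders)
  show "sets (xi_measure n) = sigma_sets (DP n) (cylinders n)" by (simp add: sigma_cylinders)
  show "emeasure \<xi> X = emeasure (xi_measure n) X" if "X \<in> cylinders n" for X
    using that val[OF \<xi>] val[OF xi_measure_disintegrates[OF n]] unfolding cylinders_def by auto
  let ?C = "\<lambda>j. {y \<in> DP n. positions n y \<in> off_diagonal_box n j \<and> weights n y \<in> space (BP n)}"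
  show "range ?C \<subseteq> cylinders n" unfolding cylinders_def using off_diagonal_box_RO by blast
  show "(\<Union>j. ?C j) = DP n"
    using positions_off_diagonal[of _ n] weights_BP[of _ n] unfolding off_diagonal_box_cover by blast
  show "emeasure \<xi> (?C j) \<noteq> \<infinity>" for j
  proof -
    have "emeasure \<xi> (?C j) = emeasure (xi_marginal n (off_diagonal_box n j)) (space (BP n))"
      unfolding val[OF \<xi> off_diagonal_box_RO sets.top] xi_Delta_eq[OF off_diagonal_box_RO n] ..
    moreover have "finite_measure (xi_marginal n (off_diagonal_box n j))"
      using xi_marginal_solves[OF off_diagonal_box_RO n] by (simp add: solves_moment_problem_def)
    ultimately show ?thesis by (simp add: finite_measure.emeasure_finite)
  qed
qed

theorem disintegration_unique_solution:
  assumes "1 \<le> n"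
  shows "\<exists>!\<xi>. disintegrates_to_xi_Delta euclidean M n \<xi>"
  using xi_measure_disintegrates[OF assms] disintegration_unique[OF assms] by blast

text \<open>The product of the marks is positive and finite on \<open>DP n\<close>, so multiplying
  by it to get \<open>xi_measure\<close> and dividing again multiplies by 1.\<close>

lemma rho_eq:
  assumes n: "1 \<le> n"
  shows "rho euclidean M n = tuple_measure n"
proof -
  have "xi euclidean M n = xi_measure n"
    unfolding xi_def
    by (rule the1_equality[OF disintegration_unique_solution[OF n] xi_measure_disintegrates[OF n]])
  then have "rho euclidean M n = density (xi_measure n) (\<lambda>y. ennreal (inverse (\<Prod>i<n. snd (y i))))"
    by (simp add: rho_def)
  also have "\<dots> = density (tuple_measure n) (\<lambda>y. mass n y * ennreal (inverse (\<Prod>i<n. snd (y i))))"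
    unfolding xi_measure_def
  proof (rule density_density_eq)
    have "(\<lambda>y. ennreal (inverse (\<Prod>i<n. snd (y i)))) \<in> borel_measurable (Y.Pow_Bor n)"
      by (intro measurable_compose[OF _ measurable_ennreal] borel_measurable_inverse borel_measurable_prod snd_coordinate) simp
    from measurable_V[OF this]
    show "(\<lambda>y. ennreal (inverse (\<Prod>i<n. snd (y i)))) \<in> borel_measurable (tuple_measure n)"
      by (simp cong: measurable_cong_sets)
    show "mass n \<in> borel_measurable (tuple_measure n)"
      using mass_V[of n] by (simp cong: measurable_cong_sets)
  qed
  \<comment> \<open>The two densities agree on the space of the measure, not necessarily outside it,
    so the comparison is made under the integrals that define \<open>density\<close>.\<close>
  also have "\<dots> = density (tuple_measure n) (\<lambda>_. 1)"
    unfolding density_def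
  proof (rule measure_of_eq)
    fix A
    have "mass n y * ennreal (inverse (\<Prod>i<n. snd (y i))) = 1" if y: "y \<in> space (tuple_measure n)" for y
    proof -
      have pos: "0 < snd (y i)" if "i < n" for i
      proof -
        have "y \<in> DP n" using y by (simp only: space_tuple_measure)
        then have "y \<in> PiE {..<n} (\<lambda>_. UNIV \<times> {0<..})" unfolding DP_eq by blast
        then have "y i \<in> UNIV \<times> {0<..}" by (rule PiE_mem) (simp add: that)
        then show ?thesis by (simp add: mem_Times_iff)
      qed
      define a where "a = (\<Prod>i<n. snd (y i))"
      have "0 < a" unfolding a_def using pos by (intro prod_pos) auto
      have "mass n y = ennreal a" unfolding a_def using pos by (intro prod_ennreal) (auto intro: less_imp_le)
      then show ?thesis
        unfolding a_def[symmetric] using \<open>0 < a\<close> by (simp add: ennreal_mult[symmetric])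
    qed
    then show "(\<integral>\<^sup>+y. mass n y * ennreal (inverse (\<Prod>i<n. snd (y i))) * indicator A y \<partial>tuple_measure n) =
        (\<integral>\<^sup>+y. 1 * indicator A y \<partial>tuple_measure n)"
      by (intro nn_integral_cong) simp
  qed (rule sets.space_closed)
  also have "\<dots> = tuple_measure n" by (rule density_1)
  finally show ?thesis .
qed

end

theorem theorem2:
  fixes \<mu> :: "'a::polish_space measure measure"
    and M :: "nat \<Rightarrow> (nat \<Rightarrow> 'a) measure"
  assumes "locally_compact_space (euclidean :: 'a topology)"
    and "random_discrete_measure euclidean \<mu>"
    and "finite_moments euclidean \<mu>"
    and "\<And>n. is_moment_measure euclidean \<mu> n (M n)"
    and "\<And>\<Lambda>. \<Lambda> \<in> rel_compact_borel euclidean \<Longrightarrow>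
           \<exists>C::real. 0 < C \<and> (\<forall>n\<ge>1. emeasure (M n) (PiE {..<n} (\<lambda>_. \<Lambda>)) \<le> ennreal (C ^ n * fact n))"
  shows "(\<forall>n\<ge>1. \<forall>\<Delta>\<in>rel_compact_off_diagonal euclidean n. \<exists>!\<xi>. solves_moment_problem M n \<Delta> \<xi>) \<and>
         (\<forall>n\<ge>1. \<exists>!\<xi>. disintegrates_to_xi_Delta euclidean M n \<xi>) \<and>
         (\<forall>n\<ge>1. represents_correlation (marked_top euclidean) (marked_point_process euclidean \<mu>) n
                  (rho euclidean M n))"
proof -
  interpret random_discrete_moments \<mu> M
    using assms(1,2,4,5) by (rule random_discrete_moments.intro)
  show ?thesis
    using moment_problem_unique_solution disintegration_unique_solution
      represents_correlation_tuple_measure rho_eq by auto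
qed

end
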